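(* Let $\Omega\subset\mathbb{R}^3$ be a bounded domain with $\mathcal{L}^3(\Omega)=1$ and $\mathcal{L}^3(\partial\Omega)=0$. 1. Let $\rho^0$ be a compactly supported probability measure on $\mathbb{R}^3$. Then there exists a global weak measure solution of the semi-geostrophic system $SG$ with initial data $\rho^0$ (that is, a family $(\rho(t))_{t\ge 0}$ whose restriction to $[0,T]$ is a weak measure solution on $[0,T]$ with initial data $\rho^0$ for every $T>0$). 2. Let $T>0$ and let $(\rho_n)_{n\in\mathbb{N}}$ be a sequence of weak measure solutions of $SG$ on $[0,T]$ with initial data $(\rho_n^0)_{n\in\mathbb{N}}$, where all $\rho_n^0$ are supported in $B_R=B(0,R)$ for some $R>0$ independent of $n$. Then the sequence $(\rho_n)_{n\in\mathbb{N}}$ is precompact in $C([0,T],\mathcal{P}\text{-}w* )$, and every converging subsequence converges to a weak measure solution of $SG$ on $[0,T]$.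
   Context: Notation: $\mathcal{L}^3$ is Lebesgue measure on $\mathbb{R}^3$; $\mathcal{P}$ is the set of probability measures on $\mathbb{R}^3$; $C([0,T],\mathcal{P}\text{-}w* )$ is the set of maps $t\mapsto\rho(t)\in\mathcal{P}$ continuous for the weak-$*$ topology of measures. For $v=(v_1,v_2,v_3)\in\mathbb{R}^3$, $v^\perp=(-v_2,v_1,0)$. For a probability measure $\rho$ on $\mathbb{R}^3$ with finite second moment, $\Phi[\rho]$ denotes the convex function, unique up to an additive constant on $\Omega$ (Brenier), such that $\nabla\Phi[\rho]$ pushes the Lebesgue measure of $\Omega$ forward to $\rho$: $\int_\Omega f(\nabla\Phi[\rho](x))\,dx=\int_{\mathbb{R}^3} f\,d\rho$ for all $f\in C_b^0(\mathbb{R}^3)$. Thus $\nabla\Phi[\rho]$ is defined a.e. in $\Omega$. Formally, $SG$ is the system $\partial_t\rho+\nabla\cdot(\rho\,(\nabla\Psi[\rho(t)](x)-x)^\perp)=0$, $\rho(0)=\rho^0$, where $\Psi[\rho]$ is the Legendre transform of $\Phi[\rho]$. Definition (weak measure solution). A family of probability measures $\rho(t)$ on $\mathbb{R}^3$, $t\in[0,T]$, is a weak measure solution of $SG$ on $[0,T]$ with initial data $\rho^0$ if: (1) $\rho\in C([0,T],\mathcal{P}\text{-}w* )$; (2) there is a non-decreasing function $t\mapsto R(t)$ such that $\rho(t)$ is supported in $B(0,R(t))$ for all $t\in[0,T]$; (3) for all $\varphi\in C_c^\infty([0,T]\times\mathbb{R}^3)$, $$\int_0^T\!\!\int_{\mathbb{R}^3}\partial_t\varphi(t,x)\,d\rho(t)(x)\,dt+\int_0^T\!\!\int_\Omega\nabla\varphi(t,\nabla\Phi[\rho(t)](x))\cdot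 x^\perp\,dx\,dt-\int_0^T\!\!\int_{\mathbb{R}^3}\nabla\varphi(t,x)\cdot x^\perp\,d\rho(t)(x)\,dt=\int_{\mathbb{R}^3}\varphi(T,x)\,d\rho(T)(x)-\int_{\mathbb{R}^3}\varphi(0,x)\,d\rho^0(x).$$ *)

theory Defs
  imports "HOL-Probability.Giry_Monad" "HOL-Analysis.Analysis"
begin

text \<open>Borel probability measures on \<open>\<real>\<^sup>3\<close>, with the weak-* topology they inherit from the
  duality between finite measures and continuous functions vanishing at infinity.\<close>

abbreviation prob_measures :: "(real ^ 3) measure set"
  where "prob_measures \<equiv> space (prob_algebra borel)"

definition C0_functions :: "(real ^ 3 \<Rightarrow> real) set"
  where "C0_functions = {f. continuous_on UNIV f \<and> (f \<longlongrightarrow> 0) at_infinity}"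

definition weak_star :: "(real ^ 3) measure topology"
  where "weak_star = pullback_topology prob_measures
    (\<lambda>\<mu>. \<lambda>f\<in>C0_functions. \<integral>x. f x \<partial>\<mu>) (powertop_real C0_functions)"

text \<open>The space \<open>C([0,T], P-w*)\<close>. Its topology is that of uniform convergence in time: the coarsest
  one for which each map \<open>\<rho> \<mapsto> (t \<mapsto> \<integral>f d\<rho>(t))\<close>, with \<open>f\<close> continuous and vanishing at infinity, is
  continuous into \<open>C([0,T], \<real>)\<close> with the supremum metric. Curves are made \<open>extensional\<close>, so that
  they carry no information outside \<open>[0,T]\<close>.\<close>

definition measure_curves :: "real \<Rightarrow> (real \<Rightarrow> (real ^ 3) measure) set"
  where "measure_curves T =
    {\<rho> \<in> extensional {0..T}. continuous_map (top_of_set {0..T}) weak_star \<rho>}"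

definition curve_topology :: "real \<Rightarrow> (real \<Rightarrow> (real ^ 3) measure) topology"
  where "curve_topology T = pullback_topology (measure_curves T)
    (\<lambda>\<rho>. \<lambda>f\<in>C0_functions. \<lambda>t\<in>{0..T}. \<integral>x. f x \<partial>\<rho> t)
    (product_topology
      (\<lambda>_. mtopology_of (cfunspace (top_of_set {0..T}) euclidean_metric)) C0_functions)"

lemma topspace_weak_star: "topspace weak_star = prob_measures"
  by (auto simp: weak_star_def topspace_pullback_topology)

lemma topspace_curve_topology: "topspace (curve_topology T) = measure_curves T"
proof -
  have "(\<lambda>f\<in>C0_functions. \<lambda>t\<in>{0..T}. \<integral>x. f x \<partial>\<rho> t) \<in> topspace (product_topology
      (\<lambda>_. mtopology_of (cfunspace (top_of_set {0..T}) euclidean_metric)) C0_functions)"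
    if \<rho>: "\<rho> \<in> measure_curves T" for \<rho>
  proof -
    have "(\<lambda>t\<in>{0..T}. \<integral>x. f x \<partial>\<rho> t) \<in> mspace (cfunspace (top_of_set {0..T}) euclidean_metric)"
      if f: "f \<in> C0_functions" for f
    proof -
      have "continuous_map weak_star (powertop_real C0_functions)
          (id \<circ> (\<lambda>\<mu>. \<lambda>f\<in>C0_functions. \<integral>x. f x \<partial>\<mu>))"
        unfolding weak_star_def by (rule continuous_map_pullback) auto
      then have "continuous_map (top_of_set {0..T}) (powertop_real C0_functions)
          (\<lambda>t. \<lambda>f\<in>C0_functions. \<integral>x. f x \<partial>\<rho> t)"
        using \<rho> unfolding measure_curves_def
        by (auto dest: continuous_map_compose simp: o_def)
      then have "continuous_map (top_of_set {0..T}) euclideanreal (\<lambda>t. \<integral>x. f x \<partial>\<rho> t)"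
        using f by (auto simp: continuous_map_componentwise)
      then have "continuous_on {0..T} (\<lambda>t\<in>{0..T}. \<integral>x. f x \<partial>\<rho> t)"
        by (subst continuous_on_cong[OF refl, where g = "\<lambda>t. \<integral>x. f x \<partial>\<rho> t"]) auto
      then show ?thesis
        by (subst compactin_mspace_cfunspace) (auto simp: compactin_subtopology)
    qed
    then show ?thesis by (auto simp: PiE_def extensional_def)
  qed
  then show ?thesis
    unfolding curve_topology_def topspace_pullback_topology by auto
qed

definition precompact_in :: "'a topology \<Rightarrow> 'a set \<Rightarrow> bool"
  where "precompact_in X S \<longleftrightarrow> S \<subseteq> topspace X \<and> compactin X (X closure_of S)"

definition msupport :: "'a::topological_space measure \<Rightarrow> 'a set"
  where "msupport \<mu> = {x. \<forall>U. open U \<longrightarrow> x \<in> U \<longrightarrow> emeasure \<mu> U > 0}"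

definition grad :: "('a::euclidean_space \<Rightarrow> real) \<Rightarrow> 'a \<Rightarrow> 'a"
  where "grad f x = (THE D. GDERIV f x :> D)"

definition perp :: "real ^ 3 \<Rightarrow> real ^ 3"
  where "perp v = vector [- v $ 2, v $ 1, 0]"

text \<open>The convex function is only required to be finite on the convex hull of \<open>\<Omega>\<close>. This loses nothing
  compared with convex functions on \<open>\<real>\<^sup>3\<close> with values in \<open>(-\<infinity>,\<infinity>]\<close>: finiteness almost everywhere
  in the open set \<open>\<Omega>\<close> forces finiteness on the convex hull, and conversely one may extend by \<open>\<infinity>\<close>.
  A finite convex function on all of \<open>\<real>\<^sup>3\<close> need not exist when \<open>\<rho>\<close> has unbounded support.
  The points where \<open>\<Phi>\<close> is not differentiable form a null set, so the value of \<open>grad\<close> there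
  does not matter.\<close>

definition is_brenier_potential ::
    "(real ^ 3) set \<Rightarrow> (real ^ 3) measure \<Rightarrow> (real ^ 3 \<Rightarrow> real) \<Rightarrow> bool"
  where "is_brenier_potential \<Omega> \<rho> \<Phi> \<longleftrightarrow> convex_on (convex hull \<Omega>) \<Phi> \<and>
    (\<forall>f :: real ^ 3 \<Rightarrow> real. continuous_on UNIV f \<longrightarrow> bounded (range f) \<longrightarrow>
      (LINT x:\<Omega>|lebesgue. f (grad \<Phi> x)) = (\<integral>y. f y \<partial>\<rho>))"

text \<open>\<open>\<Phi>[\<rho>]\<close>; the choice only fixes the additive constant on \<open>\<Omega>\<close>.\<close>

definition brenier_potential :: "(real ^ 3) set \<Rightarrow> (real ^ 3) measure \<Rightarrow> (real ^ 3 \<Rightarrow> real)"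
  where "brenier_potential \<Omega> \<rho> = (SOME \<Phi>. is_brenier_potential \<Omega> \<rho> \<Phi>)"

primrec C_k :: "nat \<Rightarrow> ('a::euclidean_space \<Rightarrow> real) \<Rightarrow> bool"
  where
    "C_k 0 f \<longleftrightarrow> continuous_on UNIV f"
  | "C_k (Suc k) f \<longleftrightarrow> f differentiable_on UNIV \<and>
      (\<forall>b\<in>Basis. C_k k (\<lambda>x. frechet_derivative f (at x) b))"

text \<open>Elements of \<open>C\<^sub>c\<^sup>\<infinity>([0,T] \<times> \<real>\<^sup>3)\<close> are represented by smooth compactly supported functions
  on \<open>\<real> \<times> \<real>\<^sup>3\<close>, of which only the restriction to \<open>[0,T] \<times> \<real>\<^sup>3\<close> is ever used: a function
  on the closed slab is smooth when it extends smoothly to a neighbourhood. In particular no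
  vanishing is imposed at times \<open>0\<close> and \<open>T\<close>.\<close>

definition test_functions :: "(real \<times> (real ^ 3) \<Rightarrow> real) set"
  where "test_functions = {\<phi>. (\<forall>k. C_k k \<phi>) \<and> compact (closure {z. \<phi> z \<noteq> 0})}"

definition weak_measure_solution ::
    "(real ^ 3) set \<Rightarrow> real \<Rightarrow> (real ^ 3) measure \<Rightarrow> (real \<Rightarrow> (real ^ 3) measure) \<Rightarrow> bool"
  where "weak_measure_solution \<Omega> T \<rho>0 \<rho> \<longleftrightarrow>
    \<rho>0 \<in> prob_measures \<and>
    continuous_map (top_of_set {0..T}) weak_star \<rho> \<and>
    (\<exists>R :: real \<Rightarrow> real. mono_on {0..T} R \<and> (\<forall>t\<in>{0..T}. msupport (\<rho> t) \<subseteq> ball 0 (R t))) \<and>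
    (\<forall>\<phi>\<in>test_functions.
      (LINT t:{0..T}|lebesgue. \<integral>x. deriv (\<lambda>s. \<phi> (s, x)) t \<partial>\<rho> t)
      + (LINT t:{0..T}|lebesgue. LINT x:\<Omega>|lebesgue.
          grad (\<lambda>y. \<phi> (t, y)) (grad (brenier_potential \<Omega> (\<rho> t)) x) \<bullet> perp x)
      - (LINT t:{0..T}|lebesgue. \<integral>x. grad (\<lambda>y. \<phi> (t, y)) x \<bullet> perp x \<partial>\<rho> t)
      = (\<integral>x. \<phi> (T, x) \<partial>\<rho> T) - (\<integral>x. \<phi> (0, x) \<partial>\<rho>0))"

end

theory Submission
  imports Defs "HOL-Complex_Analysis.Great_Picard" "HOL-Real_Asymp.Real_Asymp" "HOL-Library.Diagonal_Subsequence"
begin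

text \<open>Minimising \<open>\<integral>\<^sub>\<Omega> \<psi>\<^sup>* + \<integral> \<psi> d\<rho>\<close> yields, for a measure \<open>\<rho>\<close> on a ball of radius \<open>M\<close>, a
  convex \<open>M\<close>-Lipschitz function on \<open>\<real>\<^sup>3\<close> whose gradient \<open>T\<^sub>\<rho>\<close> transports \<open>\<Omega>\<close> to \<open>\<rho>\<close>; by duality
  this gradient is unique. Such potentials are precompact by Arzela-Ascoli, and pointwise convergence of
  convex functions implies convergence of their gradients almost everywhere. Hence every sequence of measures
  on the ball has a subsequence along which \<open>T\<^sub>\<rho>\<close> converges almost everywhere, and
  \<open>\<rho> \<mapsto> \<integral>\<^sub>\<Omega> G(t, x, T\<^sub>\<rho>(x)) dx\<close> is weakly continuous for every continuous \<open>G\<close>.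

  This continuity makes the weak formulation stable under limits. Existence follows from the explicit Euler
  scheme in which \<open>\<rho>\<^sub>k\<^sub>+\<^sub>1\<close> is the law of \<open>y + h (x - y)\<^sup>\<bottom>\<close> with \<open>y = T\<^sub>\<rho>\<^sub>k(x)\<close> and \<open>x\<close> uniform in \<open>\<Omega>\<close>. For the compactness statement,
  testing a solution against suitable smooth functions bounds its support and its speed by constants that
  only depend on \<open>R\<close>, \<open>T\<close> and \<open>\<Omega>\<close>.\<close>

section \<open>Convex functions\<close>

text \<open>Two obstacles shape the proof. At a point \<open>y\<close> the velocity
  \<open>perp (x - y)\<close> involves the gradient of the Legendre transform of the potential,
  which need not be continuous. Writing every integral over \<open>\<Omega>\<close> in the variables
  \<open>x\<close> and \<open>y = T(x)\<close> leaves only the Brenier map, and solving the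
  transport problem anew after each Euler step avoids any flow. Compactness then yields
  subsequences, and uniqueness of the map promotes them to full convergence; it must hold for
  whatever potential \<open>SOME\<close> picks, known only to be convex on the hull of
  \<open>\<Omega>\<close>.

  The other obstacle is how little a weak solution provides: its support radius may depend on the
  solution, and the identity compares only the times \<open>0\<close> and \<open>T\<close>.
  Localisation in time comes from multiplying test functions by \<open>t ^ n\<close>, since a
  continuous discrepancy with vanishing moments is zero. Once the identity holds at every time, the
  equation itself gives radii and Lipschitz constants common to the whole sequence.\<close>

lemma continuous_on_compact_bounded:
  fixes f :: "'a::topological_space \<Rightarrow> real"
  assumes "compact S" "continuous_on S f"
  shows "\<exists>B. \<forall>x\<in>S. \<bar>f x\<bar> \<le> B"
  using compact_imp_bounded[OF compact_continuous_image[OF assms(2,1)]] by (auto simp: bounded_iff)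

lemma dist_add_le: "dist z (x + c) \<le> dist z x + norm (c :: 'a::real_normed_vector)"
  using dist_triangle[of z "x + c" x] by (simp add: dist_norm)

lemma convex_on_secant:
  fixes f :: "'a::real_vector \<Rightarrow> real"
  assumes f: "convex_on S f" and x: "x \<in> S" "x + h *\<^sub>R v \<in> S" and t: "0 \<le> t" "t \<le> h" "0 < h"
  shows "f (x + t *\<^sub>R v) - f x \<le> (t / h) * (f (x + h *\<^sub>R v) - f x)"
proof -
  have "(1 - t / h) *\<^sub>R x + (t / h) *\<^sub>R (x + h *\<^sub>R v) = x + t *\<^sub>R v"
    using t by (simp add: algebra_simps)
  moreover have "f ((1 - t / h) *\<^sub>R x + (t / h) *\<^sub>R (x + h *\<^sub>R v))
      \<le> (1 - t / h) * f x + (t / h) * f (x + h *\<^sub>R v)"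
    using t x by (intro convex_onD[OF f]) auto
  ultimately have "f (x + t *\<^sub>R v) \<le> (1 - t / h) * f x + (t / h) * f (x + h *\<^sub>R v)"
    by simp
  then show ?thesis by (simp add: left_diff_distrib right_diff_distrib)
qed

text \<open>Monotonicity of slopes, with \<open>x\<close> written as the combination of the
  endpoints with weights \<open>k / (s + k)\<close> and \<open>s / (s + k)\<close>.\<close>

lemma convex_on_two_sided_secant:
  fixes f :: "'a::real_vector \<Rightarrow> real"
  assumes f: "convex_on S f" and x: "x - s *\<^sub>R v \<in> S" "x + k *\<^sub>R v \<in> S" and t: "0 < s" "0 < k"
  shows "(f x - f (x - s *\<^sub>R v)) / s \<le> (f (x + k *\<^sub>R v) - f x) / k"
proof -
  have eq: "(1 - s/(s+k)) *\<^sub>R (x - s *\<^sub>R v) + (s/(s+k)) *\<^sub>R (x + k *\<^sub>R v) = x"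
  proof -
    have "(1 - s/(s+k)) *\<^sub>R (x - s *\<^sub>R v) + (s/(s+k)) *\<^sub>R (x + k *\<^sub>R v)
      = x + ((s/(s+k)) * k - (1 - s/(s+k)) * s) *\<^sub>R v"
      by (simp add: algebra_simps)
    also have "(s/(s+k)) * k - (1 - s/(s+k)) * s = 0"
      using t by (simp add: field_simps)
    finally show ?thesis by simp
  qed
  have "f ((1 - s/(s+k)) *\<^sub>R (x - s *\<^sub>R v) + (s/(s+k)) *\<^sub>R (x + k *\<^sub>R v))
      \<le> (1 - s/(s+k)) * f (x - s *\<^sub>R v) + (s/(s+k)) * f (x + k *\<^sub>R v)"
    using t x by (intro convex_onD[OF f]) auto
  then have "f x \<le> (1 - s/(s+k)) * f (x - s *\<^sub>R v) + (s/(s+k)) * f (x + k *\<^sub>R v)"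
    unfolding eq .
  then have "(s + k) * f x \<le> (s + k) * ((1 - s/(s+k)) * f (x - s *\<^sub>R v) + (s/(s+k)) * f (x + k *\<^sub>R v))"
    using t by (intro mult_left_mono) auto
  also have "\<dots> = ((s + k) * (1 - s/(s+k))) * f (x - s *\<^sub>R v) + ((s + k) * (s/(s+k))) * f (x + k *\<^sub>R v)"
    by (simp only: distrib_left mult.assoc)
  also have "(s + k) * (1 - s/(s+k)) = k" using t by (simp add: right_diff_distrib)
  also have "(s + k) * (s/(s+k)) = s" using t by simp
  finally show ?thesis using t by (simp add: field_simps)
qed

text \<open>For a convex function, vanishing second differences along the coordinate axes already give
  Frechet differentiability: by Jensen, \<open>F v \<le> (\<Sum>b. F (n v\<^sub>b b)) / n\<close> controls the
  remainder \<open>F\<close> from above, and \<open>F v \<ge> - F (- v)\<close> from below.\<close>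

lemma convex_gderivI:
  fixes f :: "'a::euclidean_space \<Rightarrow> real"
  assumes S: "open S" and f: "convex_on S f" and x: "x \<in> S"
    and second: "\<And>b e. b \<in> Basis \<Longrightarrow> e > 0 \<Longrightarrow>
      \<exists>h>0. x + h *\<^sub>R b \<in> S \<and> x - h *\<^sub>R b \<in> S \<and> f (x + h *\<^sub>R b) + f (x - h *\<^sub>R b) - 2 * f x \<le> e * h"
  shows "\<exists>D. GDERIV f x :> D"
proof -
  define Q where "Q b = {(f (x + k *\<^sub>R b) - f x) / k | k. 0 < k \<and> x + k *\<^sub>R b \<in> S}" for b
  \<comment> \<open>By monotonicity of slopes the infimum of the forward quotients is the right
    partial derivative. The backward quotients bound the set from below, so no limit has to be
    formed.\<close>
  define d where "d b = Inf (Q b)" for b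
  define D where "D = (\<Sum>b\<in>Basis. d b *\<^sub>R b)"
  define F where "F v = f (x + v) - f x - v \<bullet> D" for v
  define n where "n = real DIM('a)"
  have n: "n > 0" by (simp add: n_def)
  have ray: "\<exists>h>0. x + h *\<^sub>R b \<in> S \<and> x - h *\<^sub>R b \<in> S \<and>
      (\<forall>t. \<bar>t\<bar> \<le> h \<longrightarrow> F (t *\<^sub>R b) \<le> e * \<bar>t\<bar>)" if b: "b \<in> Basis" and e: "e > 0" for b e
  proof -
    obtain h where h: "h > 0" "x + h *\<^sub>R b \<in> S" "x - h *\<^sub>R b \<in> S"
      and le: "f (x + h *\<^sub>R b) + f (x - h *\<^sub>R b) - 2 * f x \<le> e * h"
      using second[OF b e] by blast
    have ne: "Q b \<noteq> {}" using h by (auto simp: Q_def)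
    have lb: "(f x - f (x - h *\<^sub>R b)) / h \<le> q" if "q \<in> Q b" for q
      using that convex_on_two_sided_secant[OF f h(3) _ h(1)] by (auto simp: Q_def)
    then have bdd: "bdd_below (Q b)" by (auto simp: bdd_below_def)
    have dge: "(f x - f (x - h *\<^sub>R b)) / h \<le> d b"
      unfolding d_def using ne lb by (intro cInf_greatest)
    have dle: "d b \<le> (f (x + h *\<^sub>R b) - f x) / h"
      unfolding d_def using h by (intro cInf_lower bdd) (auto simp: Q_def)
    have Db: "b \<bullet> D = d b"
      using b by (simp add: D_def inner_sum_right inner_Basis if_distrib sum.delta cong: if_cong)
    have "F (t *\<^sub>R b) \<le> e * \<bar>t\<bar>" if t: "\<bar>t\<bar> \<le> h" for t
    proof (cases "t \<ge> 0")
      case True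
      have "f (x + t *\<^sub>R b) - f x \<le> (t / h) * (f (x + h *\<^sub>R b) - f x)"
        using convex_on_secant[OF f x h(2) True _ h(1)] t True by auto
      also have "f (x + h *\<^sub>R b) - f x \<le> e * h + h * d b"
        using le dge h by (simp add: field_simps)
      then have "(t / h) * (f (x + h *\<^sub>R b) - f x) \<le> (t / h) * (e * h + h * d b)"
        using True h by (intro mult_left_mono) auto
      also have "\<dots> = t * e + t * d b" using h by (simp add: field_simps)
      finally show ?thesis using True by (simp add: F_def Db algebra_simps)
    next
      case False
      have "f (x + (-t) *\<^sub>R (- b)) - f x \<le> ((-t) / h) * (f (x + h *\<^sub>R (- b)) - f x)"
        using False t h x by (intro convex_on_secant[OF f]) auto
      also have "f (x + h *\<^sub>R (-b)) - f x \<le> e * h - h * d b"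
        using le dle h by (simp add: field_simps)
      then have "((-t) / h) * (f (x + h *\<^sub>R (-b)) - f x) \<le> ((-t) / h) * (e * h - h * d b)"
        using False h by (intro mult_left_mono) (auto simp: field_simps)
      also have "\<dots> = - t * e + t * d b" using h by (simp add: field_simps)
      finally show ?thesis using False by (simp add: F_def Db algebra_simps)
    qed
    with h show ?thesis by blast
  qed
  have "(f has_derivative (\<lambda>h. h \<bullet> D)) (at x)"
    unfolding has_derivative_at_alt
  proof (intro conjI allI impI)
    show "bounded_linear (\<lambda>h. h \<bullet> D)" by (rule bounded_linear_inner_left)
    fix e :: real assume e: "0 < e"
    have "\<forall>b\<in>Basis. \<exists>h>0. x + h *\<^sub>R b \<in> S \<and> x - h *\<^sub>R b \<in> S \<and>
        (\<forall>t. \<bar>t\<bar> \<le> h \<longrightarrow> F (t *\<^sub>R b) \<le> (e / n) * \<bar>t\<bar>)"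
      using e n by (intro ballI ray divide_pos_pos)
    then obtain H where H: "\<And>b. b \<in> Basis \<Longrightarrow> H b > 0 \<and> x + H b *\<^sub>R b \<in> S \<and> x - H b *\<^sub>R b \<in> S \<and>
        (\<forall>t. \<bar>t\<bar> \<le> H b \<longrightarrow> F (t *\<^sub>R b) \<le> (e / n) * \<bar>t\<bar>)"
      by metis
    define \<delta> where "\<delta> = Min (H ` Basis)"
    have d0: "\<delta> > 0" using H by (auto simp: \<delta>_def)
    have dH: "\<delta> \<le> H b" if "b \<in> Basis" for b using that by (auto simp: \<delta>_def)
    have conv: "convex S" using f by (rule convex_on_imp_convex)
    have inS: "x + t *\<^sub>R b \<in> S" if b: "b \<in> Basis" and t: "\<bar>t\<bar> \<le> \<delta>" for b t
    proof -
      define u where "u = (t / H b + 1) / 2"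
      have Hb: "H b > 0" "x + H b *\<^sub>R b \<in> S" "x - H b *\<^sub>R b \<in> S" using H b by auto
      have "- H b \<le> t" "t \<le> H b" using t dH[OF b] by auto
      then have u: "0 \<le> u" "u \<le> 1" using Hb by (auto simp: u_def field_simps)
      have "(1 - u) *\<^sub>R (x - H b *\<^sub>R b) + u *\<^sub>R (x + H b *\<^sub>R b) \<in> S"
        using Hb u conv by (intro convexD) auto
      also have "(1 - u) *\<^sub>R (x - H b *\<^sub>R b) + u *\<^sub>R (x + H b *\<^sub>R b) = x + ((2 * u - 1) * H b) *\<^sub>R b"
      proof -
        have "(1 - u) *\<^sub>R (x - c) + u *\<^sub>R (x + c) = x + (2 * u - 1) *\<^sub>R c" for c
          by (rule euclidean_eqI) (simp add: inner_simps algebra_simps)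
        then show ?thesis by simp
      qed
      also have "(2 * u - 1) * H b = t" using Hb by (simp add: u_def field_simps)
      finally show ?thesis .
    qed
    \<comment> \<open>The point \<open>x + v\<close> is the average of \<open>n\<close> axis points
      with displacements \<open>n * (v \<bullet> b)\<close>. Hence the radius
      \<open>\<delta> / n\<close>, and the tolerance \<open>e / n\<close> on each axis to compensate
      the factor \<open>n\<close>.\<close>
    have up: "x + v \<in> S \<and> F v \<le> e * norm v" if v: "n * norm v \<le> \<delta>" for v
    proof -
      have ab: "\<bar>n * (v \<bullet> b)\<bar> \<le> \<delta>" if "b \<in> Basis" for b
      proof -
        have "\<bar>v \<bullet> b\<bar> \<le> norm v" using that by (rule Basis_le_norm)
        then have "n * \<bar>v \<bullet> b\<bar> \<le> n * norm v" using n by simp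
        then have "n * \<bar>v \<bullet> b\<bar> \<le> \<delta>" using v by linarith
        then show ?thesis using n by (simp add: abs_mult)
      qed
      have mem: "x + (n * (v \<bullet> b)) *\<^sub>R b \<in> S" if "b \<in> Basis" for b
        using inS[OF that ab[OF that]] .
      have s1: "(\<Sum>b\<in>(Basis::'a set). 1 / n) = 1" using n by (simp add: n_def)
      have eq: "(\<Sum>b\<in>Basis. (1/n) *\<^sub>R (x + (n * (v \<bullet> b)) *\<^sub>R b)) = x + v"
      proof -
        have "(\<Sum>b\<in>Basis. (1/n) *\<^sub>R (x + (n * (v \<bullet> b)) *\<^sub>R b))
          = (\<Sum>b\<in>(Basis::'a set). (1/n) *\<^sub>R x) + (\<Sum>b\<in>Basis. (v \<bullet> b) *\<^sub>R b)"
          using n by (simp add: sum.distrib scaleR_add_right)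
        also have "(\<Sum>b\<in>(Basis::'a set). (1/n) *\<^sub>R x) = x" using s1 by (simp flip: scaleR_left.sum)
        finally show ?thesis by (simp add: euclidean_representation)
      qed
      have "f (x + v) \<le> (\<Sum>b\<in>Basis. (1/n) * f (x + (n * (v \<bullet> b)) *\<^sub>R b))"
        unfolding eq[symmetric] using n mem by (intro convex_on_sum[OF _ _ f s1]) auto
      also have "\<dots> = (\<Sum>b\<in>Basis. (1/n) * (F ((n * (v \<bullet> b)) *\<^sub>R b) + f x + (n * (v \<bullet> b)) * (b \<bullet> D)))"
        by (simp add: F_def)
      also have "\<dots> = (\<Sum>b\<in>Basis. (1/n) * F ((n * (v \<bullet> b)) *\<^sub>R b)) + f x + v \<bullet> D"
      proof -
        have "(\<Sum>b\<in>(Basis::'a set). (1/n) * f x) = f x" using s1 by (simp flip: sum_distrib_right)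
        moreover have "(\<Sum>b\<in>Basis. (1/n) * ((n * (v \<bullet> b)) * (b \<bullet> D))) = v \<bullet> D"
          using n by (subst (2) euclidean_inner) (simp add: inner_commute)
        ultimately show ?thesis by (simp add: distrib_left sum.distrib)
      qed
      finally have "F v \<le> (\<Sum>b\<in>Basis. (1/n) * F ((n * (v \<bullet> b)) *\<^sub>R b))"
        by (simp add: F_def)
      also have "\<dots> \<le> (\<Sum>b\<in>(Basis::'a set). (1/n) * (e * norm v))"
      proof (intro sum_mono mult_left_mono)
        fix b :: 'a assume b: "b \<in> Basis"
        have "\<bar>n * (v \<bullet> b)\<bar> \<le> H b" using ab[OF b] dH[OF b] by simp
        then have "F ((n * (v \<bullet> b)) *\<^sub>R b) \<le> (e / n) * \<bar>n * (v \<bullet> b)\<bar>" using H b by blast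
        also have "\<dots> = e * \<bar>v \<bullet> b\<bar>" using n by (simp add: abs_mult)
        also have "\<dots> \<le> e * norm v" using e Basis_le_norm[OF b, of v] by simp
        finally show "F ((n * (v \<bullet> b)) *\<^sub>R b) \<le> e * norm v" .
      qed (use n in auto)
      also have "\<dots> = e * norm v" using n by (simp add: n_def)
      finally have "F v \<le> e * norm v" .
      moreover have "x + v \<in> S"
        unfolding eq[symmetric] using n mem s1 by (intro convex_sum[OF _ conv]) auto
      ultimately show ?thesis by blast
    qed
    show "\<exists>d>0. \<forall>y. norm (y - x) < d \<longrightarrow> norm (f y - f x - (y - x) \<bullet> D) \<le> e * norm (y - x)"
    proof (intro exI[of _ "\<delta> / n"] conjI allI impI)
      show "\<delta> / n > 0" using d0 n by simp
      fix y assume y: "norm (y - x) < \<delta> / n"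
      define v where "v = y - x"
      have "n * norm v \<le> \<delta>" using y n by (simp add: v_def field_simps)
      then have v: "n * norm v \<le> \<delta>" "n * norm (- v) \<le> \<delta>" by simp_all
      have 1: "x + v \<in> S" "F v \<le> e * norm v" "x - v \<in> S" "F (- v) \<le> e * norm v"
        using up[OF v(1)] up[OF v(2)] by auto
      have "f ((1 - 1/2) *\<^sub>R (x - v) + (1/2) *\<^sub>R (x + v)) \<le> (1 - 1/2) * f (x - v) + (1/2) * f (x + v)"
        using 1 by (intro convex_onD[OF f]) auto
      moreover have "(1 - 1/2) *\<^sub>R (x - v) + (1/2) *\<^sub>R (x + v) = x"
        by (simp add: algebra_simps flip: scaleR_add_left)
      ultimately have "0 \<le> F v + F (- v)" by (simp add: F_def)
      then have "\<bar>F v\<bar> \<le> e * norm v" using 1 by linarith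
      then show "norm (f y - f x - (y - x) \<bullet> D) \<le> e * norm (y - x)"
        by (simp add: F_def v_def)
    qed
  qed
  then show ?thesis by (auto simp: gderiv_def)
qed


section \<open>Almost everywhere differentiability\<close>

lemma lborel_integral_shift:
  fixes g :: "'a::euclidean_space \<Rightarrow> real"
  assumes [measurable]: "g \<in> borel_measurable borel"
  shows "(\<integral>x. g (x + c) \<partial>lborel) = (\<integral>x. g x \<partial>lborel)"
proof -
  have "(\<integral>x. g x \<partial>lborel) = (\<integral>x. g x \<partial>distr lborel borel ((+) c))"
    by (simp add: lborel_distr_plus)
  also have "\<dots> = (\<integral>x. g (c + x) \<partial>lborel)"
    by (intro integral_distr) auto
  finally show ?thesis by (simp add: add.commute)
qed

lemma integrable_bounded_support:
  fixes g :: "'a::euclidean_space \<Rightarrow> real"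
  assumes g[measurable]: "g \<in> borel_measurable borel" and B: "\<And>x. \<bar>g x\<bar> \<le> B"
    and supp: "\<And>x. x \<notin> cball z R \<Longrightarrow> g x = 0"
  shows "integrable lborel g"
proof (rule Bochner_Integration.integrable_bound)
  show "integrable lborel (\<lambda>x. B * indicator (cball z R) x :: real)"
    by (intro integrable_mult_right integrable_real_indicator) (use emeasure_lborel_cball_finite in \<open>auto\<close>)
  show "AE x in lborel. norm (g x) \<le> norm (B * indicator (cball z R) x :: real)"
  proof (intro AE_I2)
    fix x show "norm (g x) \<le> norm (B * indicator (cball z R) x :: real)"
      using B[of x] supp[of x] by (cases "x \<in> cball z R") (auto simp: indicator_def)
  qed
qed simp

text \<open>The integral of \<open>D\<^sub>h x - D\<^sub>h (x - h b)\<close>, with \<open>D\<^sub>h\<close> the bounded difference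
  quotient, against a Lipschitz weight is \<open>O(h)\<close> by translation invariance. As the integrand is
  non-negative for convex \<open>f\<close>, the second difference quotient vanishes almost everywhere; this
  replaces the usual slicing argument.\<close>

lemma convex_AE_second_difference:
  fixes f :: "'a::euclidean_space \<Rightarrow> real"
  assumes f: "convex_on (cball z R) f" and lip: "L-lipschitz_on (cball z R) f"
    and b: "b \<in> Basis" and r: "0 < r" "r < R"
  shows "AE x in lborel. x \<in> ball z r \<longrightarrow> (\<forall>e>0. \<exists>h>0. h < R - r \<and>
    f (x + h *\<^sub>R b) + f (x - h *\<^sub>R b) - 2 * f x \<le> e * h)"
proof -
  \<comment> \<open>A tent: 1-Lipschitz and positive exactly on the open ball of radius
    \<open>r\<close>.\<close>
  define w where "w x = max 0 (r - dist x z)" for x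
  \<comment> \<open>Extension by zero makes \<open>f\<close> bounded and Borel. The jump at the
    sphere is never felt, because the steps \<open>h n\<close> stay below
    \<open>R - r\<close>.\<close>
  define F where "F x = indicator (cball z R) x *\<^sub>R f x" for x
  \<comment> \<open>The \<open>+ 2\<close> keeps even \<open>h 0\<close> strictly below
    \<open>R - r\<close>.\<close>
  define h where "h n = (R - r) / (real n + 2)" for n :: nat
  have h: "h n > 0" "h n < R - r" for n
  proof -
    show "h n > 0" using r by (simp add: h_def)
    have "(R - r) * 1 < (R - r) * (real n + 2)" using r by (intro mult_strict_left_mono) auto
    then show "h n < R - r" by (simp add: h_def divide_less_eq)
  qed
  define u where "u n x = w x * ((F (x + h n *\<^sub>R b) + F (x - h n *\<^sub>R b) - 2 * F x) / h n)" for n x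
  have L0: "L \<ge> 0" using lip by (simp add: lipschitz_on_def)
  have nb: "norm b = 1" using b by simp
  have w_meas[measurable]: "w \<in> borel_measurable borel" unfolding w_def by measurable
  have cont: "continuous_on (cball z R) f" using lip by (rule lipschitz_on_continuous_on)
  then have F_meas[measurable]: "F \<in> borel_measurable borel"
    unfolding F_def by (intro borel_measurable_continuous_on_indicator) auto
  obtain B where B: "\<And>x. x \<in> cball z R \<Longrightarrow> \<bar>f x\<bar> \<le> B"
    using continuous_on_compact_bounded[OF compact_cball cont] by blast
  have B0: "B \<ge> 0" using B[of z] r by fastforce
  have FB: "\<bar>F x\<bar> \<le> B" for x using B[of x] B0 by (auto simp: F_def indicator_def)
  have w0: "0 \<le> w x" "w x \<le> r" for x using r by (auto simp: w_def)
  have wz: "w x = 0" if "x \<notin> ball z r" for x using that by (auto simp: w_def dist_commute)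
  have w_lip: "\<bar>w x - w y\<bar> \<le> norm (x - y)" for x y
    unfolding w_def using dist_triangle[of x z y] dist_triangle[of y z x]
    unfolding dist_norm norm_minus_commute[of z] norm_minus_commute[of y x] by linarith
  have near: "x + t *\<^sub>R b \<in> cball z R" if "x \<in> ball z r" "\<bar>t\<bar> \<le> h n" for x t n
  proof -
    have "dist z (x + t *\<^sub>R b) \<le> dist z x + norm (t *\<^sub>R b)"
      by (rule dist_add_le)
    then show ?thesis using that h(2)[of n] nb by auto
  qed
  have u0: "0 \<le> u n x" for n x
  proof (cases "x \<in> ball z r")
    case True
    have mem: "x + h n *\<^sub>R b \<in> cball z R" "x - h n *\<^sub>R b \<in> cball z R" "x \<in> cball z R"
      using near[OF True, of "h n" n] near[OF True, of "- h n" n] near[OF True, of 0 n] h(1)[of n] by auto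
    have "(f x - f (x - h n *\<^sub>R b)) / h n \<le> (f (x + h n *\<^sub>R b) - f x) / h n"
      using mem h by (intro convex_on_two_sided_secant[OF f]) auto
    then have "0 \<le> (F (x + h n *\<^sub>R b) + F (x - h n *\<^sub>R b) - 2 * F x) / h n"
      using mem h(1)[of n] by (simp add: F_def divide_simps)
    then show ?thesis using w0(1)[of x] unfolding u_def by (intro mult_nonneg_nonneg)
  qed (simp add: u_def wz)
  have u_meas: "u n \<in> borel_measurable borel" for n
    unfolding u_def[abs_def] by measurable
  have int_u: "integrable lborel (u n)" for n
  proof (rule integrable_bounded_support[where z = z and R = r and B = "r * (4 * B / h n)"])
    show "\<bar>u n x\<bar> \<le> r * (4 * B / h n)" for x
    proof -
      have "\<bar>F (x + h n *\<^sub>R b) + F (x - h n *\<^sub>R b) - 2 * F x\<bar> \<le> 4 * B"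
        using FB[of "x + h n *\<^sub>R b"] FB[of "x - h n *\<^sub>R b"] FB[of x] by linarith
      then show ?thesis
        unfolding u_def abs_mult using w0[of x] h(1)[of n] r
        by (intro mult_mono) (auto simp: divide_right_mono)
    qed
    show "u n x = 0" if "x \<notin> cball z r" for x using that wz[of x] by (auto simp: u_def)
  qed (rule u_meas)
  define V where "V = measure lborel (cball z R)"
  have small: "(\<integral>x. u n x \<partial>lborel) \<le> h n * L * V" for n
  proof -
    define D where "D x = (F (x + h n *\<^sub>R b) - F x) / h n" for x
    have D_meas[measurable]: "D \<in> borel_measurable borel" unfolding D_def by measurable
    have DB: "\<bar>D x\<bar> \<le> 2 * B / h n" for x
    proof -
      have "\<bar>F (x + h n *\<^sub>R b) - F x\<bar> \<le> 2 * B"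
        using FB[of "x + h n *\<^sub>R b"] FB[of x] by linarith
      then show ?thesis
        using h(1)[of n] by (simp add: D_def abs_divide divide_right_mono)
    qed
    have i1: "integrable lborel (\<lambda>x. w x * D x)"
    proof (rule integrable_bounded_support[where z = z and R = r and B = "r * (2 * B / h n)"])
      show "\<bar>w x * D x\<bar> \<le> r * (2 * B / h n)" for x
        unfolding abs_mult using w0[of x] DB[of x] r by (intro mult_mono) auto
    qed (use wz in \<open>auto\<close>)
    have i2: "integrable lborel (\<lambda>x. w (x + h n *\<^sub>R b) * D x)"
    proof (rule integrable_bounded_support[where z = z and R = R and B = "r * (2 * B / h n)"])
      show "\<bar>w (x + h n *\<^sub>R b) * D x\<bar> \<le> r * (2 * B / h n)" for x
        unfolding abs_mult using w0[of "x + h n *\<^sub>R b"] DB[of x] r by (intro mult_mono) auto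
      show "w (x + h n *\<^sub>R b) * D x = 0" if "x \<notin> cball z R" for x
        using that near[of "x + h n *\<^sub>R b" "- h n" n] h(1)[of n] wz[of "x + h n *\<^sub>R b"] by auto
    qed simp
    have i3: "integrable lborel (\<lambda>x. w x * D (x - h n *\<^sub>R b))"
    proof (rule integrable_bounded_support[where z = z and R = r and B = "r * (2 * B / h n)"])
      show "\<bar>w x * D (x - h n *\<^sub>R b)\<bar> \<le> r * (2 * B / h n)" for x
        unfolding abs_mult using w0[of x] DB[of "x - h n *\<^sub>R b"] r by (intro mult_mono) auto
    qed (use wz in \<open>auto\<close>)
    \<comment> \<open>Summation by parts: after a shift the difference falls on \<open>w\<close>,
      whose increments are at most \<open>h n\<close>, while \<open>D\<close> is bounded by
      \<open>L\<close> wherever the weights do not vanish.\<close>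
    have "u n x = w x * D x - w x * D (x - h n *\<^sub>R b)" for x
      unfolding u_def D_def right_diff_distrib[symmetric] diff_divide_distrib[symmetric] by (simp add: algebra_simps)
    then have "(\<integral>x. u n x \<partial>lborel) = (\<integral>x. w x * D x \<partial>lborel) - (\<integral>x. w x * D (x - h n *\<^sub>R b) \<partial>lborel)"
      using i1 i3 by simp
    also have "(\<integral>x. w x * D (x - h n *\<^sub>R b) \<partial>lborel) = (\<integral>x. w (x + h n *\<^sub>R b) * D x \<partial>lborel)"
      by (subst lborel_integral_shift[where c = "h n *\<^sub>R b", symmetric]) auto
    also have "(\<integral>x. w x * D x \<partial>lborel) - (\<integral>x. w (x + h n *\<^sub>R b) * D x \<partial>lborel)
        = (\<integral>x. (w x - w (x + h n *\<^sub>R b)) * D x \<partial>lborel)"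
      using i1 i2 by (simp add: left_diff_distrib)
    also have "\<dots> \<le> (\<integral>x. h n * L * indicator (cball z R) x \<partial>lborel)"
    proof (rule integral_mono)
      show "integrable lborel (\<lambda>x. (w x - w (x + h n *\<^sub>R b)) * D x)"
        using i1 i2 by (simp add: left_diff_distrib)
      show "integrable lborel (\<lambda>x. h n * L * indicator (cball z R) x :: real)"
        by (intro integrable_mult_right integrable_real_indicator) (use emeasure_lborel_cball_finite in \<open>auto\<close>)
      fix x
      show "(w x - w (x + h n *\<^sub>R b)) * D x \<le> h n * L * indicator (cball z R) x"
      proof (cases "x \<in> ball z r \<or> x + h n *\<^sub>R b \<in> ball z r")
        case True
        then have mem: "x \<in> cball z R" "x + h n *\<^sub>R b \<in> cball z R"
          using near[of x "h n" n] near[of "x + h n *\<^sub>R b" "- h n" n] near[of x 0 n]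
            near[of "x + h n *\<^sub>R b" 0 n] h(1)[of n] by auto
        have "dist (f (x + h n *\<^sub>R b)) (f x) \<le> L * dist (x + h n *\<^sub>R b) x"
          using lip mem by (intro lipschitz_onD) auto
        then have "\<bar>D x\<bar> \<le> L" using mem h(1)[of n] nb
          by (simp add: D_def F_def dist_norm field_simps)
        moreover have "\<bar>w x - w (x + h n *\<^sub>R b)\<bar> \<le> h n"
          using w_lip[of x "x + h n *\<^sub>R b"] h(1)[of n] nb by simp
        ultimately have "\<bar>(w x - w (x + h n *\<^sub>R b)) * D x\<bar> \<le> h n * L"
          unfolding abs_mult using h(1)[of n] by (intro mult_mono) auto
        then show ?thesis using mem by simp
      next
        case False
        then show ?thesis using wz h(1)[of n] L0 by simp
      qed
    qed
    also have "\<dots> = h n * L * V" by (simp add: V_def)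
    finally show ?thesis .
  qed
  have hlim: "h \<longlonglongrightarrow> 0"
    unfolding h_def by real_asymp
  have "(\<lambda>n. \<integral>x. u n x \<partial>lborel) \<longlonglongrightarrow> 0"
  proof (rule tendsto_sandwich[where f = "\<lambda>_. 0" and h = "\<lambda>n. h n * L * V"])
    show "(\<lambda>n. h n * L * V) \<longlonglongrightarrow> 0" using tendsto_mult_left_zero[OF hlim, of "L * V"] by (simp add: mult.assoc)
    show "\<forall>\<^sub>F n in sequentially. 0 \<le> (\<integral>x. u n x \<partial>lborel)" using u0 by (intro always_eventually allI integral_nonneg_AE) auto
  qed (use small in auto)
  then have "(\<lambda>n. ennreal (\<integral>x. u n x \<partial>lborel)) \<longlonglongrightarrow> ennreal 0" by (intro tendsto_ennrealI)
  then have lim0: "(\<lambda>n. \<integral>\<^sup>+x. ennreal (u n x) \<partial>lborel) \<longlonglongrightarrow> 0"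
    using int_u u0 by (simp add: nn_integral_eq_integral)
  \<comment> \<open>Fatou suffices: a vanishing liminf already supplies, for every \<open>e\<close>,
    some step with second difference at most \<open>e * h\<close>.\<close>
  have "(\<integral>\<^sup>+x. liminf (\<lambda>n. ennreal (u n x)) \<partial>lborel) \<le> liminf (\<lambda>n. \<integral>\<^sup>+x. ennreal (u n x) \<partial>lborel)"
    by (intro nn_integral_liminf) (use u_meas in \<open>auto\<close>)
  also have "\<dots> = 0" using lim0 by (intro lim_imp_Liminf) auto
  finally have "(\<integral>\<^sup>+x. liminf (\<lambda>n. ennreal (u n x)) \<partial>lborel) = 0" by simp
  then have "AE x in lborel. liminf (\<lambda>n. ennreal (u n x)) = 0"
    by (subst (asm) nn_integral_0_iff_AE) (use u_meas in \<open>auto\<close>)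
  then show ?thesis
  proof (rule eventually_mono, intro impI allI)
    fix x and e :: real assume lim: "liminf (\<lambda>n. ennreal (u n x)) = 0" and x: "x \<in> ball z r" and e: "0 < e"
    have wx: "w x > 0" using x by (auto simp: w_def dist_commute)
    show "\<exists>h>0. h < R - r \<and> f (x + h *\<^sub>R b) + f (x - h *\<^sub>R b) - 2 * f x \<le> e * h"
    proof (rule ccontr)
      assume neg: "\<not> ?thesis"
      have "w x * e \<le> u n x" for n
      proof -
        have mem: "x + h n *\<^sub>R b \<in> cball z R" "x - h n *\<^sub>R b \<in> cball z R" "x \<in> cball z R"
          using near[OF x, of "h n" n] near[OF x, of "- h n" n] near[OF x, of 0 n] h(1)[of n] by auto
        have "\<not> f (x + h n *\<^sub>R b) + f (x - h n *\<^sub>R b) - 2 * f x \<le> e * h n" using neg h by blast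
        then have "e \<le> (F (x + h n *\<^sub>R b) + F (x - h n *\<^sub>R b) - 2 * F x) / h n"
          using mem h(1)[of n] by (simp add: F_def field_simps)
        then show ?thesis unfolding u_def using wx by (intro mult_left_mono) auto
      qed
      then have "ennreal (w x * e) \<le> liminf (\<lambda>n. ennreal (u n x))"
        by (intro Liminf_bounded always_eventually allI ennreal_leI)
      then show False using lim wx e by (simp add: ennreal_eq_0_iff mult_le_0_iff)
    qed
  qed
qed

text \<open>On a closed ball of twice the radius \<open>f\<close> is bounded by some
  \<open>B\<close>. Prolonging the segment from \<open>x\<close> to \<open>y\<close> by
  \<open>R\<close> stays in that ball, and the secant inequality bounds the slope by
  \<open>2 * B / R\<close>.\<close>

lemma convex_on_local_lipschitz:
  fixes f :: "'a::euclidean_space \<Rightarrow> real"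
  assumes S: "open S" and f: "convex_on S f" and z: "z \<in> S"
  obtains R L where "R > 0" "cball z R \<subseteq> S" "L-lipschitz_on (cball z R) f"
proof -
  obtain R0 where R0: "R0 > 0" "cball z R0 \<subseteq> S" using S z open_contains_cball by blast
  define R where "R = R0 / 2"
  have R: "R > 0" "cball z (2 * R) \<subseteq> S" using R0 by (auto simp: R_def)
  have cont: "continuous_on (cball z (2 * R)) f"
    using convex_on_continuous[OF S f] R(2) continuous_on_subset by blast
  obtain B where B: "\<And>x. x \<in> cball z (2 * R) \<Longrightarrow> \<bar>f x\<bar> \<le> B"
    using continuous_on_compact_bounded[OF compact_cball cont] by blast
  have B0: "B \<ge> 0" using B[of z] R by fastforce
  have one: "f y - f x \<le> (2 * B / R) * norm (y - x)" if x: "x \<in> cball z R" and y: "y \<in> cball z R" for x y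
  proof (cases "x = y")
    case False
    define v where "v = (y - x) /\<^sub>R norm (y - x)"
    define t where "t = norm (y - x)"
    have t: "t > 0" using False by (simp add: t_def)
    have nv: "norm v = 1" using False by (simp add: v_def)
    have yv: "x + t *\<^sub>R v = y" using t by (simp add: v_def t_def)
    have y': "x + (t + R) *\<^sub>R v = y + R *\<^sub>R v" using yv by (simp add: algebra_simps)
    have "dist z (y + R *\<^sub>R v) \<le> dist z y + norm (R *\<^sub>R v)"
      by (rule dist_add_le)
    then have mem: "y + R *\<^sub>R v \<in> cball z (2 * R)" using y nv R by auto
    have memx: "x \<in> cball z (2 * R)" using x R by auto
    have "f (x + t *\<^sub>R v) - f x \<le> (t / (t + R)) * (f (x + (t + R) *\<^sub>R v) - f x)"
      using t R mem memx y' by (intro convex_on_secant[OF f]) auto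
    also have "\<dots> \<le> (t / (t + R)) * (2 * B)"
      using B[OF mem] B[OF memx] t R unfolding y' by (intro mult_left_mono) (auto simp: abs_if split: if_splits)
    also have "\<dots> \<le> (t / R) * (2 * B)"
      using t R B0 by (intro mult_right_mono) (auto simp: frac_le)
    finally show ?thesis unfolding yv by (simp add: t_def field_simps)
  qed simp
  have "(2 * B / R)-lipschitz_on (cball z R) f"
  proof (rule lipschitz_onI)
    fix x y assume "x \<in> cball z R" "y \<in> cball z R"
    then show "dist (f x) (f y) \<le> 2 * B / R * dist x y"
      using one[of x y] one[of y x] by (simp add: dist_norm norm_minus_commute abs_if)
  qed (use B0 R in auto)
  moreover have "cball z R \<subseteq> S" using R by (auto simp: subset_iff)
  ultimately show ?thesis using that R by blast
qed

text \<open>The second-difference estimate works on a ball where \<open>f\<close> is Lipschitz.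
  Lindelof covers \<open>S\<close> by countably many such balls, and \<open>convex_gderivI\<close>
  turns the coordinatewise statement into differentiability.\<close>

theorem convex_on_AE_gderiv:
  fixes f :: "'a::euclidean_space \<Rightarrow> real"
  assumes S: "open S" and f: "convex_on S f"
  shows "AE x in lborel. x \<in> S \<longrightarrow> (\<exists>D. GDERIV f x :> D)"
proof -
  define \<B> where "\<B> = {ball z r | z r. r > 0 \<and> (\<exists>R L. r < R \<and> cball z R \<subseteq> S \<and> L-lipschitz_on (cball z R) f)}"
  have "\<And>U. U \<in> \<B> \<Longrightarrow> open U" by (auto simp: \<B>_def)
  then obtain \<C> where \<C>: "\<C> \<subseteq> \<B>" "countable \<C>" "\<Union>\<C> = \<Union>\<B>" using Lindelof by metis
  have cover: "S \<subseteq> \<Union>\<B>"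
  proof
    fix z assume "z \<in> S"
    then obtain R L where "R > 0" "cball z R \<subseteq> S" "L-lipschitz_on (cball z R) f"
      using convex_on_local_lipschitz[OF S f] by metis
    then have "ball z (R/2) \<in> \<B>" unfolding \<B>_def
      by (intro CollectI exI[of _ z] exI[of _ "R/2"] conjI exI[of _ R] exI[of _ L]) auto
    then show "z \<in> \<Union>\<B>" using \<open>R > 0\<close> by (intro UnionI[of "ball z (R/2)"]) auto
  qed
  have loc: "AE x in lborel. x \<in> U \<longrightarrow> (\<exists>D. GDERIV f x :> D)" if U: "U \<in> \<C>" for U
  proof -
    obtain z r R L where U_eq: "U = ball z r" and r: "0 < r" "r < R" and cb: "cball z R \<subseteq> S"
      and lip: "L-lipschitz_on (cball z R) f" using U \<C>(1) by (force simp: \<B>_def)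
    have cf: "convex_on (cball z R) f" using f cb convex_on_subset by blast
    have "AE x in lborel. \<forall>b\<in>Basis. x \<in> ball z r \<longrightarrow> (\<forall>e>0. \<exists>h>0. h < R - r \<and>
        f (x + h *\<^sub>R b) + f (x - h *\<^sub>R b) - 2 * f x \<le> e * h)"
      using convex_AE_second_difference[OF cf lip _ r] by (intro AE_finite_allI) auto
    then show ?thesis
    proof (rule eventually_mono, intro impI)
      fix x assume *: "\<forall>b\<in>Basis. x \<in> ball z r \<longrightarrow> (\<forall>e>0. \<exists>h>0. h < R - r \<and>
        f (x + h *\<^sub>R b) + f (x - h *\<^sub>R b) - 2 * f x \<le> e * h)" and "x \<in> U"
      then have x: "x \<in> ball z r" by (simp add: U_eq)
      have mem: "x + t *\<^sub>R b \<in> S" if "b \<in> Basis" "\<bar>t\<bar> < R - r" for b t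
      proof -
        have "dist z (x + t *\<^sub>R b) \<le> dist z x + norm (t *\<^sub>R b)"
          by (rule dist_add_le)
        then show ?thesis using x that cb by (auto simp: subset_iff)
      qed
      show "\<exists>D. GDERIV f x :> D"
      proof (rule convex_gderivI[OF S f])
        show "x \<in> S" using x r cb by (auto simp: subset_iff)
        fix b :: 'a and e :: real assume b: "b \<in> Basis" and e: "0 < e"
        then obtain h where h: "h > 0" "h < R - r" "f (x + h *\<^sub>R b) + f (x - h *\<^sub>R b) - 2 * f x \<le> e * h"
          using * x by blast
        then show "\<exists>h>0. x + h *\<^sub>R b \<in> S \<and> x - h *\<^sub>R b \<in> S \<and> f (x + h *\<^sub>R b) + f (x - h *\<^sub>R b) - 2 * f x \<le> e * h"
          using mem[OF b, of h] mem[OF b, of "- h"] by (intro exI[of _ h]) auto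
      qed
    qed
  qed
  have "AE x in lborel. \<forall>U\<in>\<C>. x \<in> U \<longrightarrow> (\<exists>D. GDERIV f x :> D)"
    using loc \<C>(2) by (subst AE_ball_countable) auto
  then show ?thesis
    by (rule eventually_mono) (use cover \<C>(3) in blast)
qed


section \<open>Gradients, subgradients and their limits\<close>

text \<open>The device that turns compactness and identification of the limit into convergence of a
  whole sequence.\<close>

lemma tendsto_subseqI:
  fixes X :: "nat \<Rightarrow> 'a::metric_space"
  assumes "\<And>r. strict_mono (r :: nat \<Rightarrow> nat) \<Longrightarrow> \<exists>s. strict_mono (s :: nat \<Rightarrow> nat) \<and> (\<lambda>n. X (r (s n))) \<longlonglongrightarrow> l"
  shows "X \<longlonglongrightarrow> l"
proof (rule ccontr)
  assume "\<not> X \<longlonglongrightarrow> l"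
  then obtain e where e: "e > 0" "\<not> eventually (\<lambda>n. dist (X n) l < e) sequentially"
    by (auto simp: tendsto_iff)
  then obtain r :: "nat \<Rightarrow> nat" where r: "strict_mono r" "\<And>n. \<not> dist (X (r n)) l < e"
    using not_eventually_sequentiallyD by blast
  then obtain s :: "nat \<Rightarrow> nat" where "strict_mono s" "(\<lambda>n. X (r (s n))) \<longlonglongrightarrow> l"
    using assms by blast
  then have "eventually (\<lambda>n. dist (X (r (s n))) l < e) sequentially" using e(1) by (auto simp: tendsto_iff)
  then show False using r(2) by simp
qed

lemma grad_eqI: "GDERIV f x :> D \<Longrightarrow> grad f x = D"
  unfolding grad_def
proof (rule the_equality)
  fix D' assume "GDERIV f x :> D" "GDERIV f x :> D'"
  then have "(\<lambda>h. h \<bullet> D) = (\<lambda>h. h \<bullet> D')"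
    unfolding gderiv_def by (rule has_derivative_unique)
  then have "\<forall>h. h \<bullet> D' = h \<bullet> D" by (simp add: fun_eq_iff)
  then show "D' = D" unfolding vector_eq_ldot .
qed

lemma GDERIV_line:
  assumes "GDERIV f x :> D"
  shows "((\<lambda>t. f (x + t *\<^sub>R v)) has_real_derivative (v \<bullet> D)) (at 0)"
proof -
  have "((\<lambda>t. x + t *\<^sub>R v) has_derivative (\<lambda>t. t *\<^sub>R v)) (at 0)"
    by (auto intro!: derivative_eq_intros)
  moreover have "(f has_derivative (\<lambda>h. h \<bullet> D)) (at (x + 0 *\<^sub>R v))"
    using assms by (simp add: gderiv_def)
  ultimately have "((\<lambda>t. f (x + t *\<^sub>R v)) has_derivative (\<lambda>t. (t *\<^sub>R v) \<bullet> D)) (at 0)"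
    by (rule has_derivative_compose)
  moreover have "(\<lambda>t. (t *\<^sub>R v) \<bullet> D) = (*) (v \<bullet> D)" by (auto simp: mult.commute)
  ultimately show ?thesis by (simp add: has_field_derivative_def)
qed

lemma convex_on_gderiv_le:
  fixes f :: "'a::real_inner \<Rightarrow> real"
  assumes f: "convex_on S f" and x: "x \<in> S" "y \<in> S" and D: "GDERIV f x :> D"
  shows "f x + (y - x) \<bullet> D \<le> f y"
proof -
  define v where "v = y - x"
  have "((\<lambda>t. (f (x + t *\<^sub>R v) - f x) / t) \<longlongrightarrow> v \<bullet> D) (at 0)"
    using GDERIV_line[OF D, of v] by (simp add: has_field_derivative_iff)
  then have lim: "((\<lambda>t. (f (x + t *\<^sub>R v) - f x) / t) \<longlongrightarrow> v \<bullet> D) (at_right 0)"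
    by (rule filterlim_mono) (auto simp: at_le)
  have "eventually (\<lambda>t::real. t \<in> {0<..<1}) (at_right 0)"
    by (rule eventually_at_right_real) simp
  then have "eventually (\<lambda>t. (f (x + t *\<^sub>R v) - f x) / t \<le> f y - f x) (at_right 0)"
  proof (rule eventually_mono)
    fix t :: real assume t: "t \<in> {0<..<1}"
    have "f (x + t *\<^sub>R v) - f x \<le> (t / 1) * (f (x + 1 *\<^sub>R v) - f x)"
      using t x by (intro convex_on_secant[OF f]) (auto simp: v_def)
    then show "(f (x + t *\<^sub>R v) - f x) / t \<le> f y - f x"
      using t by (simp add: v_def divide_le_eq mult.commute)
  qed
  then have "v \<bullet> D \<le> f y - f x"
    using lim by (intro tendsto_upperbound[OF lim]) auto
  then show ?thesis by (simp add: v_def)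
qed

text \<open>Subtracting the affine minorant leaves a function with a minimum over \<open>S\<close>
  at \<open>x\<close>, so its derivative \<open>h \<bullet> D - h \<bullet> p\<close>
  vanishes.\<close>

lemma gderiv_eq_subgradient:
  fixes f :: "'a::euclidean_space \<Rightarrow> real"
  assumes D: "GDERIV f x :> D" and S: "open S" "x \<in> S"
    and sub: "\<And>y. y \<in> S \<Longrightarrow> f x + (y - x) \<bullet> p \<le> f y"
  shows "p = D"
proof -
  have "((\<lambda>y. f y - (y - x) \<bullet> p) has_derivative (\<lambda>h. h \<bullet> D - h \<bullet> p)) (at x)"
    using D unfolding gderiv_def by (auto intro!: derivative_eq_intros)
  moreover have "(\<forall>y\<in>S. f y - (y - x) \<bullet> p \<le> f x - (x - x) \<bullet> p) \<or>
      (\<forall>y\<in>S. f x - (x - x) \<bullet> p \<le> f y - (y - x) \<bullet> p)"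
    using sub by (auto simp: algebra_simps)
  ultimately have "(\<lambda>h. h \<bullet> D - h \<bullet> p) = (\<lambda>v. 0)"
    by (intro differential_zero_maxmin[OF S(2,1)]) auto
  then have "\<forall>h. h \<bullet> p = h \<bullet> D" by (simp add: fun_eq_iff)
  then show ?thesis unfolding vector_eq_ldot .
qed

text \<open>At the point \<open>x + D\<close> the gradient inequality produces the squared norm of
  \<open>D\<close>, the Lipschitz bound only \<open>M * norm D\<close>.\<close>

lemma gderiv_norm_le:
  fixes f :: "'a::euclidean_space \<Rightarrow> real"
  assumes f: "convex_on UNIV f" and lip: "M-lipschitz_on UNIV f" and D: "GDERIV f x :> D"
  shows "norm D \<le> M"
proof (cases "D = 0")
  case False
  have "D \<bullet> D \<le> f (x + D) - f x" using convex_on_gderiv_le[OF f _ _ D, of "x + D"] by simp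
  also have "\<dots> \<le> M * norm D"
    using lipschitz_onD[OF lip, of "x + D" x] by (simp add: dist_norm)
  finally show ?thesis using False by (simp add: dot_square_norm power2_eq_square)
qed (use lip in \<open>auto simp: lipschitz_on_def\<close>)

text \<open>Gradient inequalities survive pointwise limits, so each cluster point of the bounded
  sequence \<open>D\<close> is a subgradient of \<open>g\<close> at \<open>x\<close>, and
  differentiability of \<open>g\<close> leaves only \<open>E\<close>.\<close>

lemma convex_gderiv_tendsto:
  fixes f :: "nat \<Rightarrow> 'a::euclidean_space \<Rightarrow> real"
  assumes S: "open S" "x \<in> S" and f: "\<And>n. convex_on S (f n)"
    and lim: "\<And>y. y \<in> S \<Longrightarrow> (\<lambda>n. f n y) \<longlonglongrightarrow> g y"
    and D: "\<And>n. GDERIV (f n) x :> D n" and bound: "\<And>n. norm (D n) \<le> M" and E: "GDERIV g x :> E"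
  shows "D \<longlonglongrightarrow> E"
proof (rule tendsto_subseqI)
  fix r :: "nat \<Rightarrow> nat" assume r: "strict_mono r"
  have "compact (cball (0::'a) M)" "\<forall>n. D (r n) \<in> cball 0 M" using bound by auto
  then obtain p s where s: "strict_mono (s :: nat \<Rightarrow> nat)" "((\<lambda>n. D (r n)) \<circ> s) \<longlonglongrightarrow> p"
    by (metis compact_imp_seq_compact seq_compactE)
  have p: "(\<lambda>n. D (r (s n))) \<longlonglongrightarrow> p" using s(2) by (simp add: o_def)
  have rs: "strict_mono (\<lambda>n. r (s n))" using strict_mono_o[OF r s(1)] by (simp add: o_def)
  have limr: "(\<lambda>n. f (r (s n)) y) \<longlonglongrightarrow> g y" if "y \<in> S" for y
    using LIMSEQ_subseq_LIMSEQ[OF lim[OF that] rs] by (simp add: o_def)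
  have "p = E"
  proof (rule gderiv_eq_subgradient[OF E S])
    fix y assume y: "y \<in> S"
    have "f (r (s n)) x + (y - x) \<bullet> D (r (s n)) \<le> f (r (s n)) y" for n
      by (rule convex_on_gderiv_le[OF f S(2) y D])
    then show "g x + (y - x) \<bullet> p \<le> g y"
      by (intro LIMSEQ_le[OF tendsto_add[OF limr[OF S(2)] tendsto_inner[OF tendsto_const p]] limr[OF y]]) auto
  qed
  then show "\<exists>s. strict_mono (s :: nat \<Rightarrow> nat) \<and> (\<lambda>n. D (r (s n))) \<longlonglongrightarrow> E" using s p by blast
qed

text \<open>\<open>grad\<close> is given by a description and carries no information at bad points.
  The limit \<open>G\<close> of difference quotients is Borel everywhere and agrees with
  \<open>grad f\<close> almost everywhere on \<open>T\<close>; the completed measure absorbs the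
  exceptional null set.\<close>

lemma grad_measurable:
  fixes f :: "'a::euclidean_space \<Rightarrow> real"
  assumes S: "open S" and f: "convex_on S f" and T: "T \<subseteq> S" "T \<in> sets lebesgue"
  shows "grad f \<in> borel_measurable (lebesgue_on T)"
proof -
  define F where "F x = indicator S x *\<^sub>R f x" for x
  have F_meas[measurable]: "F \<in> borel_measurable borel"
    unfolding F_def using S convex_on_continuous[OF S f]
    by (intro borel_measurable_continuous_on_indicator) auto
  define G where "G x = (\<Sum>b\<in>Basis. lim (\<lambda>n. (F (x + (1 / real (Suc n)) *\<^sub>R b) - F x) / (1 / real (Suc n))) *\<^sub>R b)" for x
  have G_meas: "G \<in> borel_measurable borel" unfolding G_def[abs_def] by measurable
  have "AE x in lebesgue. x \<in> S \<longrightarrow> (\<exists>D. GDERIV f x :> D)"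
    using convex_on_AE_gderiv[OF S f] by (rule AE_completion)
  then have ae: "AE x in lebesgue. indicator T x *\<^sub>R G x = indicator T x *\<^sub>R grad f x"
  proof (rule eventually_mono)
    fix x assume *: "x \<in> S \<longrightarrow> (\<exists>D. GDERIV f x :> D)"
    show "indicator T x *\<^sub>R G x = indicator T x *\<^sub>R grad f x"
    proof (cases "x \<in> T")
      case True
      then obtain D where D: "GDERIV f x :> D" and x: "x \<in> S" using * T by blast
      have lim: "(\<lambda>n. (F (x + (1 / real (Suc n)) *\<^sub>R b) - F x) / (1 / real (Suc n))) \<longlonglongrightarrow> b \<bullet> D" for b
      proof -
        have "((\<lambda>t. (f (x + t *\<^sub>R b) - f x) / t) \<longlongrightarrow> b \<bullet> D) (at 0)"
          using GDERIV_line[OF D, of b] by (simp add: has_field_derivative_iff)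
        moreover have "filterlim (\<lambda>n. 1 / real (Suc n)) (at 0) sequentially"
          unfolding filterlim_at using LIMSEQ_Suc[OF lim_1_over_n] by auto
        ultimately have l1: "(\<lambda>n. (f (x + (1 / real (Suc n)) *\<^sub>R b) - f x) / (1 / real (Suc n))) \<longlonglongrightarrow> b \<bullet> D"
          by (rule filterlim_compose)
        have "(\<lambda>n. x + (1 / real (Suc n)) *\<^sub>R b) \<longlonglongrightarrow> x + 0 *\<^sub>R b"
          by (intro tendsto_intros LIMSEQ_Suc[OF lim_1_over_n])
        then have "eventually (\<lambda>n. x + (1 / real (Suc n)) *\<^sub>R b \<in> S) sequentially"
          using S x by (intro topological_tendstoD) auto
        then have "eventually (\<lambda>n. (f (x + (1 / real (Suc n)) *\<^sub>R b) - f x) / (1 / real (Suc n))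
            = (F (x + (1 / real (Suc n)) *\<^sub>R b) - F x) / (1 / real (Suc n))) sequentially"
          by (rule eventually_mono) (use x in \<open>simp add: F_def\<close>)
        then show ?thesis using l1 by (rule Lim_transform_eventually[rotated])
      qed
      have "G x = (\<Sum>b\<in>Basis. (b \<bullet> D) *\<^sub>R b)" unfolding G_def using limI[OF lim] by simp
      also have "\<dots> = grad f x" by (simp add: grad_eqI[OF D] inner_commute[of _ D] euclidean_representation)
      finally show ?thesis by simp
    qed simp
  qed
  have "(\<lambda>x. indicator T x *\<^sub>R G x) \<in> borel_measurable lebesgue"
    using T G_meas by (intro borel_measurable_scaleR borel_measurable_indicator measurable_completion) auto
  then have "(\<lambda>x. indicator T x *\<^sub>R grad f x) \<in> borel_measurable lebesgue"
    using ae by (rule borel_measurable_AE)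
  then show ?thesis using T by (subst borel_measurable_restrict_space_iff) auto
qed

section \<open>Uniqueness of the Brenier map\<close>

lemma continuous_on_ball_bounded:
  fixes f :: "'a::euclidean_space \<Rightarrow> real"
  assumes "continuous_on UNIV f"
  obtains B where "B \<ge> 0" "\<And>y. norm y \<le> M \<Longrightarrow> \<bar>f y\<bar> \<le> B"
proof -
  obtain B where B: "\<forall>x\<in>cball 0 M. \<bar>f x\<bar> \<le> B"
    using continuous_on_compact_bounded[OF compact_cball continuous_on_subset[OF assms subset_UNIV]] by blast
  show ?thesis
  proof (rule that)
    show "\<bar>f y\<bar> \<le> max 0 B" if "norm y \<le> M" for y
      using B that by (simp add: le_max_iff_disj)
  qed simp
qed

lemma prob_measuresD:
  assumes "\<mu> \<in> prob_measures"
  shows "prob_space \<mu>" "sets \<mu> = sets borel" "space \<mu> = UNIV"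
  using assms sets_eq_imp_space_eq[of \<mu> borel] by (auto simp: space_prob_algebra)

lemma C0_functions_bounded:
  assumes "f \<in> C0_functions" shows "\<exists>B. \<forall>x. \<bar>f x\<bar> \<le> B"
proof -
  have f: "continuous_on UNIV f" "(f \<longlongrightarrow> 0) at_infinity" using assms by (auto simp: C0_functions_def)
  have "eventually (\<lambda>x. dist (f x) 0 < 1) at_infinity" using f(2) by (rule tendstoD) simp
  then obtain b where b: "\<And>x. norm x \<ge> b \<Longrightarrow> \<bar>f x\<bar> < 1" by (auto simp: eventually_at_infinity)
  obtain B where B: "\<And>x. norm x \<le> b \<Longrightarrow> \<bar>f x\<bar> \<le> B"
    using continuous_on_ball_bounded[OF f(1), of b] by blast
  have "\<bar>f x\<bar> \<le> max 1 B" for x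
    using b[of x] B[of x] by (cases "norm x \<le> b") (auto simp: le_max_iff_disj)
  then show ?thesis by blast
qed

lemma C0_functionsI_bounded_support:
  assumes "continuous_on UNIV f" "bounded S" "\<And>x. x \<notin> S \<Longrightarrow> f x = 0"
  shows "f \<in> C0_functions"
proof -
  obtain b where b: "\<And>x. x \<in> S \<Longrightarrow> norm x \<le> b" using assms(2) by (auto simp: bounded_iff)
  have "eventually (\<lambda>x. f x = 0) at_infinity"
    unfolding eventually_at_infinity
    using assms(3) b by (intro exI[of _ "b + 1"]) force
  then have "(f \<longlongrightarrow> 0) at_infinity" by (rule tendsto_eventually)
  then show ?thesis using assms(1) by (simp add: C0_functions_def)
qed

lemma C0_functions_measurable: "f \<in> C0_functions \<Longrightarrow> f \<in> borel_measurable borel"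
  by (auto simp: C0_functions_def intro: borel_measurable_continuous_onI)

section \<open>Probability measures and test functions\<close>

text \<open>Open boxes form an intersection-stable generator, and the indicator of a box is the
  limit of continuous functions with bounded support built from the distance to its
  complement.\<close>

lemma prob_measures_eqI:
  assumes \<mu>: "\<mu> \<in> prob_measures" and \<nu>: "\<nu> \<in> prob_measures"
    and eq: "\<And>f. f \<in> C0_functions \<Longrightarrow> (\<integral>x. f x \<partial>\<mu>) = (\<integral>x. f x \<partial>\<nu>)"
  shows "\<mu> = \<nu>"
proof -
  interpret \<mu>: prob_space \<mu> using \<mu> by (rule prob_measuresD)
  interpret \<nu>: prob_space \<nu> using \<nu> by (rule prob_measuresD)
  have box_eq: "emeasure \<mu> (box a b) = emeasure \<nu> (box a b)" for a b :: "real ^ 3"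
  proof -
    define f where "f n x = min 1 (real n * infdist x (- box a b))" for n x
    \<comment> \<open>\<open>infdist\<close> to the empty set is \<open>0\<close> by convention, so
      the complement has to be nonempty for the distance to detect the box.\<close>
    have ne: "- box a b \<noteq> {}"
      using bounded_box[of a b] not_bounded_UNIV[where 'a = "real ^ 3"] by (metis Compl_empty_eq double_complement)
    have cl: "closed (- box a b)" by (simp add: open_box closed_Compl)
    have pos: "infdist x (- box a b) > 0 \<longleftrightarrow> x \<in> box a b" for x
      using in_closed_iff_infdist_zero[OF cl ne, of x] infdist_nonneg[of x "- box a b"]
      by (auto simp: less_le)
    have zero: "infdist x (- box a b) = 0" if "x \<notin> box a b" for x
      using pos[of x] that infdist_nonneg[of x "- box a b"] by linarith
    have cont: "continuous_on UNIV (f n)" for n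
      unfolding f_def by (intro continuous_intros)
    have C0: "f n \<in> C0_functions" for n
      by (rule C0_functionsI_bounded_support[OF cont bounded_box[of a b]]) (simp add: f_def zero)
    have lim: "(\<lambda>n. f n x) \<longlonglongrightarrow> indicator (box a b) x" for x
    proof (cases "x \<in> box a b")
      case True
      then have p: "infdist x (- box a b) > 0" using pos by simp
      obtain N :: nat where N: "1 / infdist x (- box a b) \<le> real N" using real_arch_simple by blast
      have "f n x = 1" if "n \<ge> N" for n
      proof -
        have "1 \<le> real N * infdist x (- box a b)" using N p by (simp add: divide_le_eq)
        also have "\<dots> \<le> real n * infdist x (- box a b)" using that p by (intro mult_right_mono) auto
        finally show ?thesis by (simp add: f_def)
      qed
      then show ?thesis using True by (intro tendsto_eventually) (auto simp: eventually_sequentially)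
    qed (simp add: f_def zero)
    have conv: "(\<lambda>n. \<integral>x. f n x \<partial>M) \<longlonglongrightarrow> measure M (box a b)" if "prob_space M" "sets M = sets borel" for M :: "(real ^ 3) measure"
    proof -
      interpret M: prob_space M by fact
      have "(\<lambda>n. \<integral>x. f n x \<partial>M) \<longlonglongrightarrow> (\<integral>x. indicator (box a b) x \<partial>M)"
      proof (rule integral_dominated_convergence[where w = "\<lambda>_. 1"])
        show "f n \<in> borel_measurable M" for n
          using C0_functions_measurable[OF C0] that(2) by (simp cong: measurable_cong_sets)
        show "AE x in M. norm (f n x) \<le> 1" for n
          by (auto simp: f_def abs_if min_def infdist_nonneg not_less intro!: AE_I2)
             (smt (verit) infdist_nonneg mult_nonneg_nonneg of_nat_0_le_iff)
      qed (use lim that(2) in \<open>auto\<close>)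
      then show ?thesis using that(2) by simp
    qed
    have "measure \<mu> (box a b) = measure \<nu> (box a b)"
      using conv[OF prob_measuresD(1,2)[OF \<mu>]] conv[OF prob_measuresD(1,2)[OF \<nu>]] eq[OF C0]
      by (simp add: LIMSEQ_unique)
    then show ?thesis by (simp add: \<mu>.emeasure_eq_measure \<nu>.emeasure_eq_measure)
  qed
  show ?thesis
  proof (rule measure_eqI_generator_eq[where E = "range (\<lambda>(a, b). box a b)" and \<Omega> = UNIV
        and A = "\<lambda>i::nat. box (- (real i *\<^sub>R One)) (real i *\<^sub>R One)"])
    show "Int_stable (range (\<lambda>(a, b). box a b :: (real ^ 3) set))"
      by (auto simp: Int_stable_def box_Int_box)
    show "sets \<mu> = sigma_sets UNIV (range (\<lambda>(a, b). box a b))"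
      "sets \<nu> = sigma_sets UNIV (range (\<lambda>(a, b). box a b))"
      using prob_measuresD(2)[OF \<mu>] prob_measuresD(2)[OF \<nu>] by (simp_all add: borel_eq_box)
    show "(\<Union>i. box (- (real i *\<^sub>R One)) (real i *\<^sub>R One)) = (UNIV :: (real ^ 3) set)"
      by (rule UN_box_eq_UNIV)
  qed (auto simp: box_eq)
qed

text \<open>The almost everywhere form, rather than one with \<open>msupport\<close>, passes
  directly through image measures and integrals. The two are reconciled in
  \<open>msupport_imp_ball_measures\<close> and \<open>ball_measures_msupport\<close>.\<close>

definition ball_measures :: "real \<Rightarrow> (real ^ 3) measure set"
  where "ball_measures M = {\<mu> \<in> prob_measures. AE y in \<mu>. y \<in> cball 0 M}"

lemma ball_measuresD:
  assumes "\<mu> \<in> ball_measures M"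
  shows "\<mu> \<in> prob_measures" "AE y in \<mu>. norm y \<le> M" "prob_space \<mu>" "sets \<mu> = sets borel" "space \<mu> = UNIV"
  using assms prob_measuresD[of \<mu>] by (auto simp: ball_measures_def)

lemma ball_measures_mono: "M \<le> M' \<Longrightarrow> ball_measures M \<subseteq> ball_measures M'"
  by (auto simp: ball_measures_def elim!: eventually_mono)

lemma ball_measures_nonneg: assumes "\<mu> \<in> ball_measures M" shows "M \<ge> 0"
proof -
  interpret prob_space \<mu> using assms by (rule ball_measuresD)
  have "AE y in \<mu>. M \<ge> 0" using ball_measuresD(2)[OF assms] by (rule eventually_mono) (meson norm_ge_zero order_trans)
  then show ?thesis by (simp add: AE_const)
qed

lemma ball_measures_integrable:
  assumes \<mu>: "\<mu> \<in> ball_measures M" and f: "f \<in> borel_measurable borel" and B: "\<And>y. norm y \<le> M \<Longrightarrow> \<bar>f y\<bar> \<le> B"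
  shows "integrable \<mu> (f :: real ^ 3 \<Rightarrow> real)"
proof -
  interpret prob_space \<mu> using \<mu> by (rule ball_measuresD)
  show ?thesis
  proof (rule integrable_const_bound[where B = B])
    show "AE x in \<mu>. norm (f x) \<le> B" using ball_measuresD(2)[OF \<mu>] by (rule eventually_mono) (use B in auto)
    show "f \<in> borel_measurable \<mu>" using f ball_measuresD(4)[OF \<mu>] by (simp cong: measurable_cong_sets)
  qed
qed

lemma ball_measures_integrable_continuous:
  assumes \<mu>: "\<mu> \<in> ball_measures M" and f: "continuous_on UNIV (f :: real ^ 3 \<Rightarrow> real)"
  shows "integrable \<mu> f"
proof -
  obtain B where "\<And>y. norm y \<le> M \<Longrightarrow> \<bar>f y\<bar> \<le> B"
    using continuous_on_ball_bounded[OF f, of M] by blast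
  then show ?thesis using f by (intro ball_measures_integrable[OF \<mu>, of f B] borel_measurable_continuous_onI) auto
qed

section \<open>The source domain as a probability space\<close>

text \<open>\<open>r\<close> bounds the labels \<open>x\<close>, hence the part of the velocity
  \<open>perp (x - y)\<close> that can push mass outwards. The quantitative bounds below depend on
  the domain only through it.\<close>

locale source_domain =
  fixes \<Omega> :: "(real ^ 3) set" and r :: real
  assumes open_domain: "open \<Omega>" and domain_le: "\<And>x. x \<in> \<Omega> \<Longrightarrow> norm x \<le> r"
    and domain_mass: "emeasure lebesgue \<Omega> = 1"
begin

abbreviation vol :: "(real ^ 3) measure"
  where "vol \<equiv> lebesgue_on \<Omega>"

lemma domain_sets[measurable, simp]: "\<Omega> \<in> sets lebesgue"
  using open_domain by auto

sublocale vol: prob_space vol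
  by (rule prob_spaceI) (simp add: emeasure_restrict_space domain_mass)

lemma domain_nonempty: "\<Omega> \<noteq> {}" using domain_mass by auto

lemma r_nonneg: "r \<ge> 0"
  using domain_nonempty domain_le by (meson all_not_in_conv norm_ge_zero order_trans)

lemma set_integral_domain: "(LINT x:\<Omega>|lebesgue. f x) = (\<integral>x. f x \<partial>vol)" for f :: "real ^ 3 \<Rightarrow> real"
  by (simp add: set_lebesgue_integral_def integral_restrict_space)

lemma AE_vol_le: "AE x in vol. norm x \<le> r"
  by (intro AE_I2) (auto intro: domain_le)

lemma hull: "open (convex hull \<Omega>)" "\<Omega> \<subseteq> convex hull \<Omega>"
  using open_convex_hull[OF open_domain] by (auto intro: hull_inc)

lemma borel_vol: "f \<in> borel_measurable borel \<Longrightarrow> f \<in> borel_measurable vol"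
  by (intro measurable_restrict_space1 measurable_completion) simp

lemma vol_integrable:
  assumes "f \<in> borel_measurable vol" "AE x in vol. \<bar>f x\<bar> \<le> B"
  shows "integrable vol (f :: real ^ 3 \<Rightarrow> real)"
  using assms by (intro vol.integrable_const_bound[where B = B]) auto

lemma AE_vol_gderiv:
  assumes "convex_on (convex hull \<Omega>) \<Phi>"
  shows "AE x in vol. \<exists>D. GDERIV \<Phi> x :> D"
proof -
  have "AE x in lebesgue. x \<in> convex hull \<Omega> \<longrightarrow> (\<exists>D. GDERIV \<Phi> x :> D)"
    using convex_on_AE_gderiv[OF hull(1) assms] by (rule AE_completion)
  then have "AE x in lebesgue. x \<in> \<Omega> \<longrightarrow> (\<exists>D. GDERIV \<Phi> x :> D)"
    by (rule eventually_mono) (use hull in blast)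
  then show ?thesis by (subst AE_restrict_space_iff) auto
qed

lemma grad_vol_measurable:
  assumes "convex_on (convex hull \<Omega>) \<Phi>"
  shows "grad \<Phi> \<in> borel_measurable vol"
  using grad_measurable[OF hull(1) assms hull(2)] by simp

lemma distr_vol_prob:
  assumes "T \<in> borel_measurable vol"
  shows "distr vol borel T \<in> prob_measures"
  using vol.prob_space_distr[OF assms] by (simp add: space_prob_algebra)

lemma distr_vol_ball:
  assumes T: "T \<in> borel_measurable vol" and b: "AE x in vol. norm (T x) \<le> M"
  shows "distr vol borel T \<in> ball_measures M"
  using distr_vol_prob[OF T] T b by (simp add: ball_measures_def AE_distr_iff)

text \<open>Bounded continuous functions include \<open>C0_functions\<close>, which already
  determine a probability measure. So the pushforward condition is an equality of image measures,
  the form used from here on.\<close>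

lemma is_brenier_potential_iff:
  assumes \<rho>: "\<rho> \<in> prob_measures"
  shows "is_brenier_potential \<Omega> \<rho> \<Phi> \<longleftrightarrow>
    convex_on (convex hull \<Omega>) \<Phi> \<and> distr vol borel (grad \<Phi>) = \<rho>"
proof
  assume B: "is_brenier_potential \<Omega> \<rho> \<Phi>"
  then have c: "convex_on (convex hull \<Omega>) \<Phi>" by (simp add: is_brenier_potential_def)
  note m = grad_vol_measurable[OF c]
  have "distr vol borel (grad \<Phi>) = \<rho>"
  proof (rule prob_measures_eqI[OF distr_vol_prob[OF m] \<rho>])
    fix f assume f: "f \<in> C0_functions"
    have "continuous_on UNIV f" using f by (simp add: C0_functions_def)
    moreover have "bounded (range f)" using C0_functions_bounded[OF f] by (auto simp: bounded_iff)
    ultimately have "(LINT x:\<Omega>|lebesgue. f (grad \<Phi> x)) = (\<integral>y. f y \<partial>\<rho>)"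
      using B by (simp add: is_brenier_potential_def)
    then show "(\<integral>x. f x \<partial>distr vol borel (grad \<Phi>)) = (\<integral>y. f y \<partial>\<rho>)"
      using m C0_functions_measurable[OF f] by (simp add: integral_distr set_integral_domain)
  qed
  with c show "convex_on (convex hull \<Omega>) \<Phi> \<and> distr vol borel (grad \<Phi>) = \<rho>" by blast
next
  assume *: "convex_on (convex hull \<Omega>) \<Phi> \<and> distr vol borel (grad \<Phi>) = \<rho>"
  then have m: "grad \<Phi> \<in> borel_measurable vol" by (intro grad_vol_measurable) simp
  show "is_brenier_potential \<Omega> \<rho> \<Phi>"
    unfolding is_brenier_potential_def
  proof (intro conjI allI impI)
    fix f :: "real ^ 3 \<Rightarrow> real" assume "continuous_on UNIV f"
    then have "f \<in> borel_measurable borel" by (rule borel_measurable_continuous_onI)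
    then show "(LINT x:\<Omega>|lebesgue. f (grad \<Phi> x)) = (\<integral>y. f y \<partial>\<rho>)"
      using * m by (auto simp: integral_distr set_integral_domain)
  qed (use * in simp)
qed

text \<open>A nonempty open set is not negligible, so a set of full measure meets every ball around
  a point of \<open>\<Omega>\<close>.\<close>

lemma brenier_AE_dense:
  assumes "AE x in vol. x \<in> D" "z \<in> \<Omega>" "e > 0"
  shows "\<exists>x\<in>D \<inter> \<Omega>. dist z x < e"
proof (rule ccontr)
  assume neg: "\<not> ?thesis"
  have "AE x in lebesgue. x \<in> \<Omega> \<longrightarrow> x \<in> D" using assms(1) by (subst (asm) AE_restrict_space_iff) auto
  then have "AE x in lebesgue. x \<notin> ball z e \<inter> \<Omega>"
    by (rule eventually_mono) (use neg in auto)
  moreover have "ball z e \<inter> \<Omega> \<in> sets lebesgue" by (intro sets.Int domain_sets) auto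
  ultimately have "negligible (ball z e \<inter> \<Omega>)"
    unfolding negligible_iff_null_sets by (subst AE_iff_null_sets)
  moreover have "open (ball z e \<inter> \<Omega>)" "z \<in> ball z e \<inter> \<Omega>" using open_domain assms(2,3) by auto
  ultimately show False using open_not_negligible by (metis empty_iff)
qed

text \<open>\<open>c\<close> is the Legendre transform of \<open>\<Phi>\<close> restricted to the set \<open>D\<close> of good points; on \<open>D\<close> the
  potential is Lipschitz, although nothing is known about it near the boundary of the convex hull.\<close>

lemma brenier_duality:
  assumes \<rho>: "\<rho> \<in> ball_measures M" and c: "convex_on (convex hull \<Omega>) \<Phi>"
    and push: "distr vol borel (grad \<Phi>) = \<rho>"
    and T: "T \<in> borel_measurable vol" "distr vol borel T = \<rho>"
  shows "\<exists>h. integrable vol h \<and> (\<integral>x. h x \<partial>vol) = (\<integral>x. x \<bullet> grad \<Phi> x \<partial>vol) \<and>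
    (AE x in vol. x \<bullet> T x \<le> h x) \<and>
    (AE x in vol. x \<bullet> T x = h x \<longrightarrow> T x = grad \<Phi> x)"
proof -
  define D where "D = {x \<in> \<Omega>. (\<exists>D. GDERIV \<Phi> x :> D) \<and> norm (grad \<Phi> x) \<le> M}"
  note m = grad_vol_measurable[OF c]
  have gd: "GDERIV \<Phi> x :> grad \<Phi> x" if "x \<in> D" for x using that grad_eqI by (auto simp: D_def)
  have bound: "AE x in vol. norm (grad \<Phi> x) \<le> M"
    using ball_measuresD(2)[OF \<rho>] m unfolding push[symmetric] by (simp add: AE_distr_iff)
  have boundT: "AE x in vol. norm (T x) \<le> M"
    using ball_measuresD(2)[OF \<rho>] T(1) unfolding T(2)[symmetric] by (simp add: AE_distr_iff)
  have D: "AE x in vol. x \<in> D"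
    using AE_vol_gderiv[OF c] bound AE_space by eventually_elim (auto simp: D_def)
  have below: "\<Phi> x + (z - x) \<bullet> grad \<Phi> x \<le> \<Phi> z" if "x \<in> D" "z \<in> \<Omega>" for x z
    using that hull(2) by (intro convex_on_gderiv_le[OF c _ _ gd]) (auto simp: D_def)
  obtain z0 where z0: "z0 \<in> D" using brenier_AE_dense[OF D, of _ 1] domain_nonempty by fastforce
  have M0: "M \<ge> 0" using ball_measures_nonneg[OF \<rho>] .
  \<comment> \<open>Two gradient inequalities in opposite directions compare values even when the
    segment leaves \<open>\<Omega>\<close>, since \<open>\<Phi>\<close> is convex on the
    hull.\<close>
  have lip: "\<bar>\<Phi> x - \<Phi> z\<bar> \<le> 2 * r * M" if "x \<in> D" "z \<in> D" for x z
  proof -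
    have "(z - x) \<bullet> grad \<Phi> w \<ge> - (2 * r * M)" if "x \<in> D" "z \<in> D" "w \<in> D" for x z w
    proof -
      have "norm (z - x) \<le> 2 * r" using that domain_le[of x] domain_le[of z] norm_triangle_ineq4[of z x] by (auto simp: D_def)
      moreover have "norm (grad \<Phi> w) \<le> M" using that by (auto simp: D_def)
      ultimately have "norm (z - x) * norm (grad \<Phi> w) \<le> 2 * r * M" using M0 r_nonneg by (intro mult_mono) auto
      then show ?thesis using Cauchy_Schwarz_ineq2[of "z - x" "grad \<Phi> w"] by linarith
    qed
    from this[OF that that(1)] this[OF that(2,1) that(2)] below[of x z] below[of z x] that
    show ?thesis by (auto simp: D_def)
  qed
  define c where "c y = (SUP x\<in>D. x \<bullet> y - \<Phi> x)" for y
  have bdd: "bdd_above ((\<lambda>x. x \<bullet> y - \<Phi> x) ` D)" for y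
  proof (rule bdd_aboveI2)
    fix x assume x: "x \<in> D"
    have "x \<bullet> y \<le> r * norm y"
      using Cauchy_Schwarz_ineq2[of x y] domain_le[of x] x mult_right_mono[of "norm x" r "norm y"] by (auto simp: D_def)
    then show "x \<bullet> y - \<Phi> x \<le> r * norm y + 2 * r * M - \<Phi> z0" using lip[OF x z0] by linarith
  qed
  have c_ge: "x \<bullet> y - \<Phi> x \<le> c y" if "x \<in> D" for x y
    unfolding c_def using that by (intro cSUP_upper bdd)
  have c_eq: "c (grad \<Phi> x) = x \<bullet> grad \<Phi> x - \<Phi> x" if x: "x \<in> D" for x
  proof (rule antisym)
    show "c (grad \<Phi> x) \<le> x \<bullet> grad \<Phi> x - \<Phi> x"
      unfolding c_def
    proof (rule cSUP_least)
      fix z assume "z \<in> D"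
      then show "z \<bullet> grad \<Phi> x - \<Phi> z \<le> x \<bullet> grad \<Phi> x - \<Phi> x"
        using below[OF x, of z] by (auto simp: D_def inner_diff_left)
    qed (use z0 in auto)
  qed (rule c_ge[OF x])
  have c_le: "c y \<le> c y' + r * dist y y'" for y y'
    unfolding c_def[of y]
  proof (rule cSUP_least)
    fix x assume x: "x \<in> D"
    have "x \<bullet> (y - y') \<le> r * norm (y - y')"
      using Cauchy_Schwarz_ineq2[of x "y - y'"] domain_le[of x] x mult_right_mono[of "norm x" r "norm (y - y')"]
      by (auto simp: D_def)
    then show "x \<bullet> y - \<Phi> x \<le> c y' + r * dist y y'"
      using c_ge[OF x, of y'] by (simp add: dist_norm inner_diff_right)
  qed (use z0 in auto)
  have "r-lipschitz_on UNIV c"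
  proof (rule lipschitz_onI)
    fix y y' show "dist (c y) (c y') \<le> r * dist y y'"
      using c_le[of y y'] c_le[of y' y] by (simp add: dist_real_def abs_if dist_commute)
  qed (rule r_nonneg)
  then have c_cont: "continuous_on UNIV c" by (rule lipschitz_on_continuous_on)
  then have c_meas[measurable]: "c \<in> borel_measurable borel" by (rule borel_measurable_continuous_onI)
  obtain C where C: "\<And>y. norm y \<le> M \<Longrightarrow> \<bar>c y\<bar> \<le> C"
    using continuous_on_ball_bounded[OF c_cont, of M] by blast
  have \<Phi>_meas: "\<Phi> \<in> borel_measurable vol"
    using convex_on_continuous[OF hull(1) assms(2)] hull(2)
    by (intro continuous_imp_measurable_on_sets_lebesgue) (auto intro: continuous_on_subset)
  have \<Phi>_int: "integrable vol \<Phi>"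
  proof (rule vol_integrable[OF \<Phi>_meas, where B = "\<bar>\<Phi> z0\<bar> + 2 * r * M"])
    show "AE x in vol. \<bar>\<Phi> x\<bar> \<le> \<bar>\<Phi> z0\<bar> + 2 * r * M"
      using D by eventually_elim (use lip z0 in force)
  qed
  have cT_int: "integrable vol (\<lambda>x. c (T x))"
    by (rule vol_integrable[where B = C]) (use T(1) boundT C in \<open>auto elim: eventually_mono\<close>)
  have cg_int: "integrable vol (\<lambda>x. c (grad \<Phi> x))"
    by (rule vol_integrable[where B = C]) (use m bound C in \<open>auto elim: eventually_mono\<close>)
  \<comment> \<open>By definition of \<open>c\<close> this dominates \<open>x \<bullet> T x\<close>
    on \<open>D\<close>, and its integral sees \<open>T\<close> only through the law
    \<open>\<rho>\<close>. So \<open>T\<close> may be exchanged for \<open>grad \<Phi>\<close>,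
    where domination is equality.\<close>
  define h where "h x = \<Phi> x + c (T x)" for x
  have "(\<integral>x. h x \<partial>vol) = (\<integral>x. \<Phi> x \<partial>vol) + (\<integral>x. c (T x) \<partial>vol)"
    unfolding h_def using \<Phi>_int cT_int by simp
  also have "(\<integral>x. c (T x) \<partial>vol) = (\<integral>y. c y \<partial>\<rho>)"
    using T by (subst T(2)[symmetric], subst integral_distr) auto
  also have "\<dots> = (\<integral>x. c (grad \<Phi> x) \<partial>vol)"
    using m by (subst push[symmetric], subst integral_distr) auto
  also have "(\<integral>x. \<Phi> x \<partial>vol) + (\<integral>x. c (grad \<Phi> x) \<partial>vol)
      = (\<integral>x. \<Phi> x + c (grad \<Phi> x) \<partial>vol)" using \<Phi>_int cg_int by simp
  also have "\<dots> = (\<integral>x. x \<bullet> grad \<Phi> x \<partial>vol)"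
  proof (rule integral_cong_AE)
    show "AE x in vol. \<Phi> x + c (grad \<Phi> x) = x \<bullet> grad \<Phi> x"
      using D by eventually_elim (simp add: c_eq)
    show "(\<lambda>x. x \<bullet> grad \<Phi> x) \<in> borel_measurable vol"
      by (intro borel_measurable_inner m borel_vol[of "\<lambda>x. x"]) simp
  qed (use \<Phi>_int cg_int in auto)
  finally have "(\<integral>x. h x \<partial>vol) = (\<integral>x. x \<bullet> grad \<Phi> x \<partial>vol)" .
  moreover have "integrable vol h" unfolding h_def using \<Phi>_int cT_int by simp
  moreover have "AE x in vol. x \<bullet> T x \<le> h x"
    using D by eventually_elim (use c_ge in \<open>auto simp: h_def algebra_simps\<close>)
  moreover have "AE x in vol. x \<bullet> T x = h x \<longrightarrow> T x = grad \<Phi> x"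
    using D
  proof (eventually_elim, intro impI)
    fix x assume x: "x \<in> D" and eq: "x \<bullet> T x = h x"
    \<comment> \<open>Equality makes \<open>T x\<close> a subgradient along \<open>D\<close>;
      density of \<open>D\<close> and continuity of \<open>\<Phi>\<close> extend the inequality to
      all of \<open>\<Omega>\<close>.\<close>
    have onD: "\<Phi> x + (z - x) \<bullet> T x \<le> \<Phi> z" if "z \<in> D" for z
      using c_ge[OF that, of "T x"] eq by (simp add: h_def inner_diff_left)
    show "T x = grad \<Phi> x"
    proof (rule gderiv_eq_subgradient[OF gd[OF x] open_domain])
      show "x \<in> \<Omega>" using x by (simp add: D_def)
      fix z assume z: "z \<in> \<Omega>"
      have "\<exists>y. \<forall>n. y n \<in> D \<and> dist z (y n) < 1 / real (Suc n)"
      proof (rule choice, rule allI)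
        fix n :: nat
        have "1 / real (Suc n) > 0" by simp
        from brenier_AE_dense[OF D z this] show "\<exists>y. y \<in> D \<and> dist z y < 1 / real (Suc n)" by blast
      qed
      then obtain y where y: "\<And>n. y n \<in> D" "\<And>n. dist z (y n) < 1 / real (Suc n)" by blast
      have ylim: "y \<longlonglongrightarrow> z"
      proof (rule metric_LIMSEQ_I)
        fix e :: real assume "0 < e"
        then obtain N where N: "1 / real (Suc N) < e" using nat_approx_posE by blast
        have "dist (y n) z < e" if "n \<ge> N" for n
        proof -
          have "1 / real (Suc n) \<le> 1 / real (Suc N)" using that by (simp add: frac_le)
          then show ?thesis using y(2)[of n] N by (simp add: dist_commute)
        qed
        then show "\<exists>N. \<forall>n\<ge>N. dist (y n) z < e" by blast
      qed
      have "continuous_on \<Omega> \<Phi>" using convex_on_continuous[OF hull(1) assms(2)] hull(2) continuous_on_subset by blast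
      then have "isCont \<Phi> z" using z open_domain by (simp add: continuous_on_eq_continuous_at)
      then have "(\<lambda>n. \<Phi> (y n)) \<longlonglongrightarrow> \<Phi> z" using ylim by (rule isCont_tendsto_compose)
      moreover have "(\<lambda>n. \<Phi> x + (y n - x) \<bullet> T x) \<longlonglongrightarrow> \<Phi> x + (z - x) \<bullet> T x"
        by (intro tendsto_intros ylim)
      ultimately show "\<Phi> x + (z - x) \<bullet> T x \<le> \<Phi> z"
        using onD[OF y(1)] by (intro LIMSEQ_le) auto
    qed
  qed
  ultimately show ?thesis by blast
qed

text \<open>Applied in both directions, duality makes the correlations of \<open>x\<close> with the
  two gradients equal. The nonnegative gap \<open>h x - x \<bullet> grad \<Psi> x\<close> then
  integrates to \<open>0\<close>, and its vanishing is the equality case.\<close>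

theorem brenier_unique:
  assumes \<rho>: "\<rho> \<in> ball_measures M"
    and c1: "convex_on (convex hull \<Omega>) \<Phi>" "distr vol borel (grad \<Phi>) = \<rho>"
    and c2: "convex_on (convex hull \<Omega>) \<Psi>" "distr vol borel (grad \<Psi>) = \<rho>"
  shows "AE x in vol. grad \<Psi> x = grad \<Phi> x"
proof -
  note m1 = grad_vol_measurable[OF c1(1)] and m2 = grad_vol_measurable[OF c2(1)]
  have xm: "(\<lambda>x. x) \<in> borel_measurable vol" by (rule borel_vol) simp
  have int: "integrable vol (\<lambda>x. x \<bullet> T x)"
    if T: "T \<in> borel_measurable vol" "distr vol borel T = \<rho>" for T
  proof (rule vol_integrable[where B = "r * M"])
    have "AE x in vol. norm (T x) \<le> M"
      using ball_measuresD(2)[OF \<rho>] T(1) unfolding T(2)[symmetric] by (simp add: AE_distr_iff)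
    then show "AE x in vol. \<bar>x \<bullet> T x\<bar> \<le> r * M"
      using AE_vol_le
    proof eventually_elim
      fix x assume "norm (T x) \<le> M" "norm x \<le> r"
      then have "norm x * norm (T x) \<le> r * M" using r_nonneg by (intro mult_mono) auto
      then show "\<bar>x \<bullet> T x\<bar> \<le> r * M" using Cauchy_Schwarz_ineq2[of x "T x"] by linarith
    qed
  qed (intro borel_measurable_inner xm T)
  obtain h where h: "integrable vol h" "(\<integral>x. h x \<partial>vol) = (\<integral>x. x \<bullet> grad \<Phi> x \<partial>vol)"
    "AE x in vol. x \<bullet> grad \<Psi> x \<le> h x" "AE x in vol. x \<bullet> grad \<Psi> x = h x \<longrightarrow> grad \<Psi> x = grad \<Phi> x"
    using brenier_duality[OF \<rho> c1 m2 c2(2)] by blast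
  obtain k where k: "integrable vol k" "(\<integral>x. k x \<partial>vol) = (\<integral>x. x \<bullet> grad \<Psi> x \<partial>vol)"
    "AE x in vol. x \<bullet> grad \<Phi> x \<le> k x"
    using brenier_duality[OF \<rho> c2 m1 c1(2)] by blast
  note i1 = int[OF m1 c1(2)] and i2 = int[OF m2 c2(2)]
  have "(\<integral>x. x \<bullet> grad \<Phi> x \<partial>vol) \<le> (\<integral>x. x \<bullet> grad \<Psi> x \<partial>vol)"
    using integral_mono_AE[OF i1 k(1) k(3)] k(2) by simp
  moreover have "(\<integral>x. x \<bullet> grad \<Psi> x \<partial>vol) \<le> (\<integral>x. x \<bullet> grad \<Phi> x \<partial>vol)"
    using integral_mono_AE[OF i2 h(1) h(3)] h(2) by simp
  ultimately have zero: "(\<integral>x. h x - x \<bullet> grad \<Psi> x \<partial>vol) = 0"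
    using h(1,2) i2 by simp
  have "AE x in vol. h x - x \<bullet> grad \<Psi> x = 0"
    using zero h(1,3) i2 by (subst (asm) integral_nonneg_eq_0_iff_AE) auto
  then show ?thesis using h(4) by eventually_elim auto
qed

end

section \<open>Existence and stability of the Brenier map\<close>

text \<open>The normalisation at \<open>0\<close> turns the common Lipschitz constant into a uniform
  bound on each ball.\<close>

lemma lipschitz_Arzela_Ascoli:
  fixes F :: "nat \<Rightarrow> 'a::euclidean_space \<Rightarrow> real"
  assumes F: "\<And>n. L-lipschitz_on UNIV (F n)" "\<And>n. F n 0 = 0"
  shows "\<exists>g k. continuous_on (cball 0 R) g \<and> strict_mono (k :: nat \<Rightarrow> nat) \<and>
    (\<forall>e>0. \<exists>N. \<forall>n x. n \<ge> N \<and> x \<in> cball 0 R \<longrightarrow> norm (F (k n) x - g x) < e)"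
proof -
  have L: "L \<ge> 0" using F(1)[of 0] by (simp add: lipschitz_on_def)
  have bd: "norm (F n y) \<le> L * R" if "y \<in> cball 0 R" for n y
  proof -
    have "\<bar>F n y\<bar> \<le> L * norm y" using lipschitz_onD[OF F(1), of y 0] F(2) by simp
    also have "\<dots> \<le> L * R" using that L by (intro mult_left_mono) auto
    finally show ?thesis by simp
  qed
  have equi: "\<exists>d>0. \<forall>n y. y \<in> cball 0 R \<and> norm (x - y) < d \<longrightarrow> norm (F n x - F n y) < e"
    if "x \<in> cball 0 R" "0 < e" for x e
  proof (intro exI[of _ "e / (L + 1)"] conjI allI impI)
    show "0 < e / (L + 1)" using that L by simp
    fix n y assume y: "y \<in> cball 0 R \<and> norm (x - y) < e / (L + 1)"
    have "norm (F n x - F n y) \<le> L * norm (x - y)" using lipschitz_onD[OF F(1), of x y] by (simp add: dist_norm)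
    also have "\<dots> \<le> (L + 1) * norm (x - y)" by (intro mult_right_mono) auto
    also have "\<dots> < e" using y L by (simp add: less_divide_eq mult.commute)
    finally show "norm (F n x - F n y) < e" .
  qed
  show ?thesis by (rule Arzela_Ascoli[OF compact_cball bd equi]) blast+
qed

section \<open>Legendre transforms over a compact set\<close>

text \<open>This is the usual conjugate of \<open>\<theta>\<close> set to infinity off
  \<open>K\<close>. For compact nonempty \<open>K\<close> and continuous \<open>\<theta>\<close> the
  supremum is attained, so the transform is finite everywhere and its maximisers serve as
  subgradients.\<close>

definition legendre :: "'a::real_inner set \<Rightarrow> ('a \<Rightarrow> real) \<Rightarrow> 'a \<Rightarrow> real"
  where "legendre K \<theta> x = (SUP y\<in>K. x \<bullet> y - \<theta> y)"

lemma legendre_attained: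
  assumes K: "compact K" "K \<noteq> {}" and \<theta>: "continuous_on K \<theta>"
  obtains y where "y \<in> K" "legendre K \<theta> x = x \<bullet> y - \<theta> y" "\<And>z. z \<in> K \<Longrightarrow> x \<bullet> z - \<theta> z \<le> x \<bullet> y - \<theta> y"
proof -
  have "continuous_on K (\<lambda>y. x \<bullet> y - \<theta> y)" by (intro continuous_intros \<theta>)
  from continuous_attains_sup[OF K this] obtain y where
    y: "y \<in> K" "\<And>z. z \<in> K \<Longrightarrow> x \<bullet> z - \<theta> z \<le> x \<bullet> y - \<theta> y" by blast
  have "legendre K \<theta> x = x \<bullet> y - \<theta> y"
    unfolding legendre_def using y by (intro cSup_eq_maximum) auto
  then show ?thesis using that y by blast
qed

lemma legendre_ge:
  assumes K: "compact K" and \<theta>: "continuous_on K \<theta>" and y: "y \<in> K"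
  shows "x \<bullet> y - \<theta> y \<le> legendre K \<theta> x"
proof -
  have "K \<noteq> {}" using y by blast
  then show ?thesis using y by (elim legendre_attained[OF K _ \<theta>, of x]) auto
qed

text \<open>The maximiser at \<open>x\<close> also competes at \<open>z\<close>, and its norm is at
  most \<open>R\<close>.\<close>

lemma legendre_lipschitz:
  assumes K: "compact K" "K \<noteq> {}" and \<theta>: "continuous_on K \<theta>" and R: "\<And>y. y \<in> K \<Longrightarrow> norm y \<le> R"
  shows "R-lipschitz_on UNIV (legendre K \<theta>)"
proof (rule lipschitz_onI)
  show "R \<ge> 0" using K(2) R by (meson all_not_in_conv norm_ge_zero order_trans)
  have le: "legendre K \<theta> x \<le> legendre K \<theta> z + R * dist x z" for x z
  proof -
    obtain y where y: "y \<in> K" "legendre K \<theta> x = x \<bullet> y - \<theta> y"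
      using legendre_attained[OF K \<theta>, of x] by blast
    have "(x - z) \<bullet> y \<le> norm (x - z) * norm y" by (rule norm_cauchy_schwarz)
    also have "\<dots> \<le> norm (x - z) * R" using R[OF y(1)] by (intro mult_left_mono) auto
    finally show ?thesis using legendre_ge[OF K(1) \<theta> y(1), of z] y(2)
      by (simp add: inner_diff_left dist_norm mult.commute)
  qed
  fix x z show "dist (legendre K \<theta> x) (legendre K \<theta> z) \<le> R * dist x z"
    using le[of x z] le[of z x] by (simp add: dist_real_def abs_if dist_commute)
qed

lemma legendre_convex:
  assumes K: "compact K" "K \<noteq> {}" and \<theta>: "continuous_on K \<theta>"
  shows "convex_on UNIV (legendre K \<theta>)"
  unfolding convex_on_def
proof (intro conjI ballI allI impI)
  fix x z and u v :: real assume uv: "0 \<le> u" "0 \<le> v" "u + v = 1"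
  obtain y where y: "y \<in> K" "legendre K \<theta> (u *\<^sub>R x + v *\<^sub>R z) = (u *\<^sub>R x + v *\<^sub>R z) \<bullet> y - \<theta> y"
    using legendre_attained[OF K \<theta>, of "u *\<^sub>R x + v *\<^sub>R z"] by blast
  have "(u *\<^sub>R x + v *\<^sub>R z) \<bullet> y - \<theta> y = u * (x \<bullet> y - \<theta> y) + v * (z \<bullet> y - \<theta> y)"
  proof -
    have u: "u = 1 - v" using uv(3) by simp
    show ?thesis unfolding u by (simp add: inner_add_left inner_diff_left algebra_simps)
  qed
  also have "\<dots> \<le> u * legendre K \<theta> x + v * legendre K \<theta> z"
    using uv legendre_ge[OF K(1) \<theta> y(1)] by (intro add_mono mult_left_mono) auto
  finally show "legendre K \<theta> (u *\<^sub>R x + v *\<^sub>R z) \<le> u * legendre K \<theta> x + v * legendre K \<theta> z"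
    using y(2) by simp
qed simp

lemma legendre_le:
  assumes K: "compact K" "K \<noteq> {}" and \<theta>: "continuous_on K \<theta>" "continuous_on K \<eta>"
    and le: "\<And>y. y \<in> K \<Longrightarrow> \<eta> y \<le> \<theta> y + e"
  shows "legendre K \<theta> x \<le> legendre K \<eta> x + e"
proof -
  obtain y where y: "y \<in> K" "legendre K \<theta> x = x \<bullet> y - \<theta> y"
    using legendre_attained[OF K \<theta>(1), of x] by blast
  then show ?thesis using legendre_ge[OF K(1) \<theta>(2) y(1), of x] le[OF y(1)] by linarith
qed

text \<open>Every maximiser is a subgradient of the transform, so at a point of differentiability it
  is unique and equals the gradient.\<close>

lemma legendre_gderiv:
  fixes \<theta> :: "'a::euclidean_space \<Rightarrow> real"
  assumes K: "compact K" and \<theta>: "continuous_on K \<theta>" and D: "GDERIV (legendre K \<theta>) x :> D"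
    and y: "y \<in> K" "x \<bullet> y - \<theta> y \<ge> legendre K \<theta> x"
  shows "y = D"
proof (rule gderiv_eq_subgradient[OF D open_UNIV])
  fix z show "legendre K \<theta> x + (z - x) \<bullet> y \<le> legendre K \<theta> z"
    using legendre_ge[OF K \<theta> y(1), of z] y(2) by (simp add: inner_diff_left)
qed simp

context source_domain
begin

lemma vol_integrable_continuous:
  assumes "continuous_on UNIV f"
  shows "integrable vol (f :: real ^ 3 \<Rightarrow> real)"
proof -
  obtain B where "\<And>x. norm x \<le> r \<Longrightarrow> \<bar>f x\<bar> \<le> B" using continuous_on_ball_bounded[OF assms, of r] by blast
  then show ?thesis
    using assms AE_vol_le by (intro vol_integrable[where B = B] borel_vol borel_measurable_continuous_onI) (auto elim: eventually_mono)
qed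

section \<open>The dual problem and existence of the Brenier map\<close>

text \<open>The Kantorovich dual functional for maximising the correlation of \<open>x\<close> and
  \<open>y\<close>. For \<open>\<rho>\<close> carried by the ball of radius \<open>M\<close>, only
  the values of \<open>\<theta>\<close> on that ball count.\<close>

definition dual_cost :: "real \<Rightarrow> (real ^ 3) measure \<Rightarrow> (real ^ 3 \<Rightarrow> real) \<Rightarrow> real"
  where "dual_cost M \<rho> \<theta> = (\<integral>x. legendre (cball 0 M) \<theta> x \<partial>vol) + (\<integral>y. \<theta> y \<partial>\<rho>)"

context
  fixes M \<rho>
  assumes \<rho>: "\<rho> \<in> ball_measures M"
begin

interpretation \<rho>: prob_space \<rho> using \<rho> by (rule ball_measuresD)

lemma target_ball: "compact (cball (0 :: real ^ 3) M)" "cball (0 :: real ^ 3) M \<noteq> {}"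
  using ball_measures_nonneg[OF \<rho>] by auto

lemma legendre_target:
  assumes "continuous_on UNIV \<theta>"
  shows "M-lipschitz_on UNIV (legendre (cball 0 M) (\<theta> :: real ^ 3 \<Rightarrow> real))"
    "convex_on UNIV (legendre (cball 0 M) \<theta>)"
    "continuous_on UNIV (legendre (cball 0 M) \<theta>)"
    "integrable vol (legendre (cball 0 M) \<theta>)"
proof -
  have c: "continuous_on (cball 0 M) \<theta>" using assms continuous_on_subset by blast
  show l: "M-lipschitz_on UNIV (legendre (cball 0 M) \<theta>)"
    by (rule legendre_lipschitz[OF target_ball c]) auto
  show "convex_on UNIV (legendre (cball 0 M) \<theta>)" by (rule legendre_convex[OF target_ball c])
  show c': "continuous_on UNIV (legendre (cball 0 M) \<theta>)" using l by (rule lipschitz_on_continuous_on)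
  show "integrable vol (legendre (cball 0 M) \<theta>)" by (rule vol_integrable_continuous[OF c'])
qed

text \<open>One comparison with two uses: \<open>a\<close> and \<open>b\<close> cancel for the
  double transform, and both are small in the limit of a minimising sequence.\<close>

lemma dual_cost_mono:
  assumes \<theta>: "continuous_on UNIV \<theta>" "continuous_on UNIV \<eta>"
    and le1: "\<And>x. norm x \<le> r \<Longrightarrow> legendre (cball 0 M) \<theta> x \<le> legendre (cball 0 M) \<eta> x + a"
    and le2: "\<And>y. norm y \<le> M \<Longrightarrow> \<theta> y \<le> \<eta> y + b"
  shows "dual_cost M \<rho> \<theta> \<le> dual_cost M \<rho> \<eta> + a + b"
proof -
  have "(\<integral>x. legendre (cball 0 M) \<theta> x \<partial>vol) \<le> (\<integral>x. legendre (cball 0 M) \<eta> x + a \<partial>vol)"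
    using legendre_target[OF \<theta>(1)] legendre_target[OF \<theta>(2)] AE_vol_le le1
    by (intro integral_mono_AE) (auto elim: eventually_mono)
  also have "\<dots> = (\<integral>x. legendre (cball 0 M) \<eta> x \<partial>vol) + a"
    using legendre_target[OF \<theta>(2)] vol.prob_space by simp
  finally have 1: "(\<integral>x. legendre (cball 0 M) \<theta> x \<partial>vol) \<le> (\<integral>x. legendre (cball 0 M) \<eta> x \<partial>vol) + a" .
  have "(\<integral>y. \<theta> y \<partial>\<rho>) \<le> (\<integral>y. \<eta> y + b \<partial>\<rho>)"
    using ball_measures_integrable_continuous[OF \<rho>] \<theta> ball_measuresD(2)[OF \<rho>] le2
    by (intro integral_mono_AE) (auto elim: eventually_mono)
  also have "\<dots> = (\<integral>y. \<eta> y \<partial>\<rho>) + b"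
    using ball_measures_integrable_continuous[OF \<rho> \<theta>(2)] \<rho>.prob_space by simp
  finally show ?thesis using 1 by (simp add: dual_cost_def)
qed

text \<open>Transforming twice never raises the cost: the potential decreases on the target ball
  while its transform does not increase on the source ball. The result is \<open>r\<close>-Lipschitz
  because the second supremum runs over labels of norm at most \<open>r\<close>. Subtracting
  \<open>\<eta> 0\<close> is free since both measures have mass one.\<close>

lemma dual_cost_reduce:
  assumes \<theta>: "continuous_on UNIV \<theta>"
  obtains \<psi> where "r-lipschitz_on UNIV \<psi>" "\<psi> 0 = 0" "dual_cost M \<rho> \<psi> \<le> dual_cost M \<rho> \<theta>"
proof -
  define K where "K = cball (0 :: real ^ 3) M"
  define B where "B = cball (0 :: real ^ 3) r"
  define \<phi> where "\<phi> = legendre K \<theta>"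
  define \<eta> where "\<eta> = legendre B \<phi>"
  define \<psi> where "\<psi> y = \<eta> y - \<eta> 0" for y
  have K: "compact K" "K \<noteq> {}" using target_ball by (auto simp: K_def)
  have B: "compact B" "B \<noteq> {}" using r_nonneg by (auto simp: B_def)
  have c\<phi>: "continuous_on UNIV \<phi>" unfolding \<phi>_def K_def using legendre_target[OF \<theta>] by blast
  have c\<phi>B: "continuous_on B \<phi>" and c\<theta>K: "continuous_on K \<theta>" using c\<phi> \<theta> continuous_on_subset by blast+
  have lip: "r-lipschitz_on UNIV \<eta>" unfolding \<eta>_def by (rule legendre_lipschitz[OF B c\<phi>B]) (auto simp: B_def)
  have lip\<psi>: "r-lipschitz_on UNIV \<psi>"
    using lip unfolding \<psi>_def lipschitz_on_def by (simp add: dist_norm)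
  have c\<eta>: "continuous_on UNIV \<eta>" and c\<psi>: "continuous_on UNIV \<psi>"
    using lip lip\<psi> by (auto intro: lipschitz_on_continuous_on)
  have "dual_cost M \<rho> \<psi> \<le> dual_cost M \<rho> \<theta> + \<eta> 0 + (- \<eta> 0)"
  proof (rule dual_cost_mono[OF c\<psi> \<theta>])
    fix x :: "real ^ 3" assume "norm x \<le> r"
    then have x: "x \<in> B" by (simp add: B_def)
    obtain y where y: "y \<in> K" "legendre K \<psi> x = x \<bullet> y - \<psi> y"
      using legendre_attained[OF K continuous_on_subset[OF c\<psi> subset_UNIV], of x] by blast
    have "y \<bullet> x - \<phi> x \<le> \<eta> y" unfolding \<eta>_def by (rule legendre_ge[OF B(1) c\<phi>B x])
    then have "legendre K \<psi> x \<le> \<phi> x + \<eta> 0" using y(2) by (simp add: \<psi>_def inner_commute)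
    then show "legendre (cball 0 M) \<psi> x \<le> legendre (cball 0 M) \<theta> x + \<eta> 0" by (simp add: \<phi>_def K_def)
  next
    fix y :: "real ^ 3" assume "norm y \<le> M"
    then have y: "y \<in> K" by (simp add: K_def)
    obtain x where x: "x \<in> B" "\<eta> y = y \<bullet> x - \<phi> x"
      unfolding \<eta>_def using legendre_attained[OF B c\<phi>B, of y] by blast
    have "x \<bullet> y - \<theta> y \<le> \<phi> x" unfolding \<phi>_def by (rule legendre_ge[OF K(1) c\<theta>K y])
    then show "\<psi> y \<le> \<theta> y + - \<eta> 0" using x(2) by (simp add: \<psi>_def inner_commute)
  qed
  then show ?thesis using that[of \<psi>] lip\<psi> by (simp add: \<psi>_def)
qed

text \<open>With \<open>\<psi> 0 = 0\<close> the transform is nonnegative, as \<open>y = 0\<close>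
  competes in the supremum, and the Lipschitz bound controls \<open>\<psi>\<close> on the
  ball.\<close>

lemma dual_cost_lower:
  fixes \<psi> :: "real ^ 3 \<Rightarrow> real"
  assumes \<psi>: "r-lipschitz_on UNIV \<psi>" "\<psi> 0 = 0"
  shows "dual_cost M \<rho> \<psi> \<ge> - (r * M)"
proof -
  have c: "continuous_on UNIV \<psi>" using \<psi>(1) by (rule lipschitz_on_continuous_on)
  have M: "M \<ge> 0" by (rule ball_measures_nonneg[OF \<rho>])
  have "0 \<le> legendre (cball 0 M) \<psi> x" for x
    using legendre_ge[OF target_ball(1) continuous_on_subset[OF c subset_UNIV], of 0 x] \<psi>(2) M by simp
  then have "0 \<le> (\<integral>x. legendre (cball 0 M) \<psi> x \<partial>vol)" by simp
  moreover have "(\<integral>y. - (r * M) \<partial>\<rho>) \<le> (\<integral>y. \<psi> y \<partial>\<rho>)"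
  proof (rule integral_mono_AE)
    show "AE y in \<rho>. - (r * M) \<le> \<psi> y" using ball_measuresD(2)[OF \<rho>]
    proof eventually_elim
      fix y :: "real ^ 3" assume y: "norm y \<le> M"
      have "\<bar>\<psi> y\<bar> \<le> r * norm y" using lipschitz_onD[OF \<psi>(1), of y 0] \<psi>(2) by simp
      also have "\<dots> \<le> r * M" using y r_nonneg by (intro mult_left_mono)
      finally show "- (r * M) \<le> \<psi> y" by linarith
    qed
  qed (use ball_measures_integrable_continuous[OF \<rho> c] in auto)
  ultimately show ?thesis using \<rho>.prob_space by (simp add: dual_cost_def)
qed

text \<open>Direct method: \<open>dual_cost_reduce\<close> moves a minimising sequence into the
  family of normalised \<open>r\<close>-Lipschitz functions, which is compact for uniform
  convergence on the ball.\<close>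

lemma dual_cost_minimizer:
  obtains g where "continuous_on UNIV g" "\<And>\<theta>. continuous_on UNIV \<theta> \<Longrightarrow> dual_cost M \<rho> g \<le> dual_cost M \<rho> \<theta>"
proof -
  define V where "V = dual_cost M \<rho> ` {\<theta>. continuous_on UNIV \<theta>}"
  have M: "M \<ge> 0" by (rule ball_measures_nonneg[OF \<rho>])
  have lb: "- (r * M) \<le> dual_cost M \<rho> \<theta>" if "continuous_on UNIV \<theta>" for \<theta>
    using dual_cost_reduce[OF that] dual_cost_lower by (metis order_trans)
  have Vne: "V \<noteq> {}" unfolding V_def using continuous_on_const by blast
  have Vbd: "bdd_below V" unfolding V_def using lb by (intro bdd_belowI2) auto
  have "\<exists>\<psi>. r-lipschitz_on UNIV \<psi> \<and> \<psi> 0 = 0 \<and> dual_cost M \<rho> \<psi> < Inf V + 1 / real (Suc n)" for n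
  proof -
    have "Inf V < Inf V + 1 / real (Suc n)" by simp
    then obtain \<theta> where \<theta>: "continuous_on UNIV \<theta>" "dual_cost M \<rho> \<theta> < Inf V + 1 / real (Suc n)"
      using cInf_lessD[OF Vne] unfolding V_def by blast
    then show ?thesis using dual_cost_reduce[OF \<theta>(1)] by (metis le_less_trans)
  qed
  then obtain \<psi> where \<psi>: "\<And>n. r-lipschitz_on UNIV (\<psi> n)" "\<And>n. \<psi> n 0 = 0"
      "\<And>n. dual_cost M \<rho> (\<psi> n) < Inf V + 1 / real (Suc n)" by metis
  obtain g0 k where g0: "continuous_on (cball 0 M) g0" and k: "strict_mono (k :: nat \<Rightarrow> nat)"
    and conv: "\<And>e. 0 < e \<Longrightarrow> \<exists>N. \<forall>n x. n \<ge> N \<and> x \<in> cball 0 M \<longrightarrow> norm (\<psi> (k n) x - g0 x) < e"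
    using lipschitz_Arzela_Ascoli[of r \<psi> M, OF \<psi>(1,2)] by blast
  \<comment> \<open>The limit exists on the ball only. Composition with the projection makes it
    continuous everywhere, and the cost sees only the ball.\<close>
  define g where "g y = g0 (closest_point (cball 0 M) y)" for y
  have gg0: "g y = g0 y" if "y \<in> cball 0 M" for y using that by (simp add: g_def closest_point_self)
  have cg: "continuous_on UNIV g"
    unfolding g_def
  proof (rule continuous_on_compose2[OF g0])
    show "continuous_on UNIV (closest_point (cball (0 :: real ^ 3) M))"
      using M by (intro continuous_on_closest_point) auto
    show "range (closest_point (cball 0 M)) \<subseteq> cball (0 :: real ^ 3) M"
      using M closest_point_in_set[of "cball (0 :: real ^ 3) M"] by auto
  qed
  have le: "dual_cost M \<rho> g \<le> Inf V"
  proof (rule field_le_epsilon)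
    fix e :: real assume e: "0 < e"
    obtain N where N: "\<And>n x. n \<ge> N \<Longrightarrow> x \<in> cball 0 M \<Longrightarrow> norm (\<psi> (k n) x - g0 x) < e / 3"
      using conv[of "e / 3"] e by auto
    obtain N2 where N2: "1 / real (Suc N2) < e / 3" using nat_approx_posE[of "e / 3"] e by auto
    define n where "n = max N N2"
    have close: "\<bar>\<psi> (k n) y - g y\<bar> < e / 3" if "norm y \<le> M" for y
      using N[of n y] that gg0[of y] by (simp add: n_def)
    have close': "\<psi> (k n) y \<le> g y + e / 3" if "norm y \<le> M" for y using close[OF that] by linarith
    have c: "continuous_on UNIV (\<psi> (k n))" using \<psi>(1) by (rule lipschitz_on_continuous_on)
    have "dual_cost M \<rho> g \<le> dual_cost M \<rho> (\<psi> (k n)) + e / 3 + e / 3"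
    proof (rule dual_cost_mono[OF cg c])
      show "legendre (cball 0 M) g x \<le> legendre (cball 0 M) (\<psi> (k n)) x + e / 3" for x
        by (intro legendre_le[OF target_ball] continuous_on_subset[OF cg] continuous_on_subset[OF c])
          (auto intro: close')
      show "g y \<le> \<psi> (k n) y + e / 3" if "norm y \<le> M" for y using close[OF that] by linarith
    qed
    moreover have "1 / real (Suc (k n)) < e / 3"
    proof -
      have "N2 \<le> k n" using strict_mono_imp_increasing[OF k, of n] by (simp add: n_def)
      then have "1 / real (Suc (k n)) \<le> 1 / real (Suc N2)" by (simp add: frac_le)
      then show ?thesis using N2 by linarith
    qed
    ultimately show "dual_cost M \<rho> g \<le> Inf V + e" using \<psi>(3)[of "k n"] by linarith
  qed
  show ?thesis
  proof (rule that[OF cg])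
    fix \<theta> :: "real ^ 3 \<Rightarrow> real" assume "continuous_on UNIV \<theta>"
    then have "Inf V \<le> dual_cost M \<rho> \<theta>" unfolding V_def[symmetric] by (intro cInf_lower Vbd) (auto simp: V_def)
    then show "dual_cost M \<rho> g \<le> dual_cost M \<rho> \<theta>" using le by linarith
  qed
qed

text \<open>Envelope argument (Gangbo): the derivative of \<open>\<epsilon> \<mapsto> (g + \<epsilon> f)\<^sup>*(x)\<close> at \<open>0\<close> is
  \<open>- f(\<nabla> g\<^sup>*(x))\<close>.\<close>

lemma dual_cost_variation:
  fixes f g :: "real ^ 3 \<Rightarrow> real"
  assumes g: "continuous_on UNIV g" and min: "\<And>\<theta>. continuous_on UNIV \<theta> \<Longrightarrow> dual_cost M \<rho> g \<le> dual_cost M \<rho> \<theta>"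
    and f: "continuous_on UNIV f"
  shows "(\<integral>x. f (grad (legendre (cball 0 M) g) x) \<partial>vol) \<le> (\<integral>y. f y \<partial>\<rho>)"
proof -
  define K where "K = cball (0 :: real ^ 3) M"
  have K: "compact K" "K \<noteq> {}" using target_ball by (auto simp: K_def)
  define \<Phi> where "\<Phi> = legendre K g"
  define e where "e n = 1 / real (Suc n)" for n
  have e: "e n > 0" for n by (simp add: e_def)
  define \<theta> where "\<theta> n y = g y + e n * f y" for n y
  have c\<theta>: "continuous_on UNIV (\<theta> n)" for n unfolding \<theta>_def by (intro continuous_intros f g)
  have cK: "continuous_on K (\<theta> n)" "continuous_on K g" "continuous_on K f" for n
    using c\<theta> g f continuous_on_subset by blast+
  define q where "q n x = (legendre K (\<theta> n) x - \<Phi> x) / e n" for n x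
  obtain B where B: "B \<ge> 0" "\<And>y. norm y \<le> M \<Longrightarrow> \<bar>f y\<bar> \<le> B" using continuous_on_ball_bounded[OF f, of M] by blast
  have c\<Phi>: "convex_on UNIV \<Phi>" unfolding \<Phi>_def K_def using legendre_target[OF g] by blast
  have c\<Phi>': "convex_on (convex hull \<Omega>) \<Phi>" using c\<Phi> by (rule convex_on_subset) auto
  \<comment> \<open>The maximiser for \<open>g\<close> competes in the problem for
    \<open>\<theta> n\<close> and conversely, which traps the difference quotient between values of
    \<open>- f\<close> at the two maximisers.\<close>
  have q_low: "- f y \<le> q n x" if "y \<in> K" "\<Phi> x = x \<bullet> y - g y" for y n x
  proof -
    have "x \<bullet> y - \<theta> n y \<le> legendre K (\<theta> n) x" by (rule legendre_ge[OF K(1) cK(1) that(1)])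
    then have "- f y * e n \<le> legendre K (\<theta> n) x - \<Phi> x" by (simp add: \<theta>_def that(2) algebra_simps)
    then show ?thesis using e[of n] by (simp add: q_def le_divide_eq)
  qed
  have q_up: "q n x \<le> - f y" if "y \<in> K" "legendre K (\<theta> n) x = x \<bullet> y - \<theta> n y" for y n x
  proof -
    have "x \<bullet> y - g y \<le> \<Phi> x" unfolding \<Phi>_def by (rule legendre_ge[OF K(1) cK(2) that(1)])
    then have "legendre K (\<theta> n) x - \<Phi> x \<le> - f y * e n" by (simp add: \<theta>_def that(2) algebra_simps)
    then show ?thesis using e[of n] by (simp add: q_def divide_le_eq)
  qed
  have q_bound: "\<bar>q n x\<bar> \<le> B" for n x
  proof -
    obtain y where y: "y \<in> K" "\<Phi> x = x \<bullet> y - g y"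
      unfolding \<Phi>_def using legendre_attained[OF K cK(2), of x] by blast
    obtain z where z: "z \<in> K" "legendre K (\<theta> n) x = x \<bullet> z - \<theta> n z"
      using legendre_attained[OF K cK(1), of n x] by blast
    show ?thesis using q_low[OF y, of n] q_up[OF z] B(2)[of y] B(2)[of z] y(1) z(1) by (auto simp: K_def)
  qed
  have q_int: "integrable vol (q n)" for n
    unfolding q_def[abs_def] \<Phi>_def K_def using legendre_target[OF c\<theta>] legendre_target[OF g] by simp
  have pos: "0 \<le> (\<integral>x. q n x \<partial>vol) + (\<integral>y. f y \<partial>\<rho>)" for n
  proof -
    have fi: "integrable \<rho> f" "integrable \<rho> g" using ball_measures_integrable_continuous[OF \<rho>] f g by auto
    have "(\<integral>x. q n x \<partial>vol)
        = ((\<integral>x. legendre K (\<theta> n) x \<partial>vol) - (\<integral>x. \<Phi> x \<partial>vol)) / e n"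
      unfolding q_def[abs_def] \<Phi>_def K_def using legendre_target[OF c\<theta>] legendre_target[OF g] by simp
    moreover have "(\<integral>y. \<theta> n y \<partial>\<rho>) = (\<integral>y. g y \<partial>\<rho>) + e n * (\<integral>y. f y \<partial>\<rho>)"
      unfolding \<theta>_def[abs_def] using fi by simp
    moreover have "dual_cost M \<rho> g \<le> dual_cost M \<rho> (\<theta> n)" by (rule min[OF c\<theta>])
    ultimately have "0 \<le> (\<integral>x. q n x \<partial>vol) * e n + e n * (\<integral>y. f y \<partial>\<rho>)"
      using e[of n] by (simp add: dual_cost_def K_def \<Phi>_def)
    then have "0 \<le> e n * ((\<integral>x. q n x \<partial>vol) + (\<integral>y. f y \<partial>\<rho>))" by (simp add: algebra_simps)
    then show ?thesis using e[of n] by (simp add: zero_le_mult_iff)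
  qed
  have e0: "e \<longlonglongrightarrow> 0" unfolding e_def by (intro LIMSEQ_Suc[OF lim_1_over_n])
  have lim: "(\<lambda>n. q n x) \<longlonglongrightarrow> - f D" if D: "GDERIV \<Phi> x :> D" for x D
  proof -
    have "\<exists>z. \<forall>n. z n \<in> K \<and> legendre K (\<theta> n) x = x \<bullet> z n - \<theta> n (z n)"
      by (rule choice) (use legendre_attained[OF K cK(1)] in metis)
    then obtain z where z: "\<And>n. z n \<in> K" "\<And>n. legendre K (\<theta> n) x = x \<bullet> z n - \<theta> n (z n)" by blast
    obtain y where y: "y \<in> K" "\<Phi> x = x \<bullet> y - g y"
      unfolding \<Phi>_def using legendre_attained[OF K cK(2), of x] by blast
    have yD: "y = D" using legendre_gderiv[OF K(1) cK(2) D[unfolded \<Phi>_def] y(1)] y(2) by (simp add: \<Phi>_def)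
    have isc: "isCont f u" "isCont g u" for u using f g by (auto simp: continuous_on_eq_continuous_at)
    \<comment> \<open>Maximisers of the perturbed problems accumulate only at maximisers of the
      unperturbed one, and at a point of differentiability there is just one.\<close>
    have zlim: "z \<longlonglongrightarrow> D"
    proof (rule tendsto_subseqI)
      fix a :: "nat \<Rightarrow> nat" assume a: "strict_mono a"
      obtain p s where p: "p \<in> K" and s: "strict_mono (s :: nat \<Rightarrow> nat)" "((\<lambda>n. z (a n)) \<circ> s) \<longlonglongrightarrow> p"
        using seq_compactE[OF compact_imp_seq_compact[OF K(1)], of "\<lambda>n. z (a n)"] z(1) by blast
      have pl: "(\<lambda>n. z (a (s n))) \<longlonglongrightarrow> p" using s(2) by (simp add: o_def)
      have as: "strict_mono (\<lambda>n. a (s n))" using strict_mono_o[OF a s(1)] by (simp add: o_def)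
      have el: "(\<lambda>n. e (a (s n))) \<longlonglongrightarrow> 0" using LIMSEQ_subseq_LIMSEQ[OF e0 as] by (simp add: o_def)
      have fl: "(\<lambda>n. f (z (a (s n)))) \<longlonglongrightarrow> f p" and gl: "(\<lambda>n. g (z (a (s n)))) \<longlonglongrightarrow> g p"
        using isCont_tendsto_compose[OF isc(1) pl] isCont_tendsto_compose[OF isc(2) pl] by auto
      have "(\<lambda>n. x \<bullet> z (a (s n)) - (g (z (a (s n))) + e (a (s n)) * f (z (a (s n))))) \<longlonglongrightarrow> x \<bullet> p - (g p + 0 * f p)"
        by (intro tendsto_intros pl el fl gl)
      moreover have "(\<lambda>n. \<Phi> x - e (a (s n)) * B) \<longlonglongrightarrow> \<Phi> x - 0 * B" by (intro tendsto_intros el)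
      moreover have "\<Phi> x - e m * B \<le> x \<bullet> z m - (g (z m) + e m * f (z m))" for m
      proof -
        have "- B \<le> q m x" using q_bound[of m x] by linarith
        then have "- B * e m \<le> legendre K (\<theta> m) x - \<Phi> x" using e[of m] by (simp add: q_def le_divide_eq)
        then show ?thesis using z(2)[of m] by (simp add: \<theta>_def algebra_simps)
      qed
      ultimately have "\<Phi> x \<le> x \<bullet> p - g p" using LIMSEQ_le by fastforce
      then have "p = D" using legendre_gderiv[OF K(1) cK(2) D[unfolded \<Phi>_def] p] by (simp add: \<Phi>_def)
      then show "\<exists>s. strict_mono (s :: nat \<Rightarrow> nat) \<and> (\<lambda>n. z (a (s n))) \<longlonglongrightarrow> D" using s(1) pl by blast
    qed
    show ?thesis
    proof (rule tendsto_sandwich[where f = "\<lambda>_. - f D" and h = "\<lambda>n. - f (z n)"])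
      show "(\<lambda>n. - f (z n)) \<longlonglongrightarrow> - f D" by (intro tendsto_minus isCont_tendsto_compose[OF isc(1) zlim])
    qed (use q_low[OF y] q_up[OF z(1,2)] yD in auto)
  qed
  have gm: "grad \<Phi> \<in> borel_measurable vol" by (rule grad_vol_measurable[OF c\<Phi>'])
  have fm: "f \<in> borel_measurable borel" using f by (rule borel_measurable_continuous_onI)
  have "(\<lambda>n. \<integral>x. q n x \<partial>vol) \<longlonglongrightarrow> (\<integral>x. - f (grad \<Phi> x) \<partial>vol)"
  proof (rule integral_dominated_convergence[where w = "\<lambda>_. B"])
    show "AE x in vol. (\<lambda>n. q n x) \<longlonglongrightarrow> - f (grad \<Phi> x)"
      using AE_vol_gderiv[OF c\<Phi>'] by eventually_elim (use lim grad_eqI in blast)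
    show "(\<lambda>x. - f (grad \<Phi> x)) \<in> borel_measurable vol"
      using measurable_compose[OF gm fm] by simp
  qed (use q_int q_bound in auto)
  then have "(\<lambda>n. (\<integral>x. q n x \<partial>vol) + (\<integral>y. f y \<partial>\<rho>)) \<longlonglongrightarrow> (\<integral>x. - f (grad \<Phi> x) \<partial>vol) + (\<integral>y. f y \<partial>\<rho>)"
    by (intro tendsto_intros)
  then have "0 \<le> (\<integral>x. - f (grad \<Phi> x) \<partial>vol) + (\<integral>y. f y \<partial>\<rho>)"
    by (rule LIMSEQ_le_const) (use pos in auto)
  then show ?thesis by (simp add: \<Phi>_def K_def)
qed

theorem brenier_existence:
  obtains \<Phi> where "convex_on UNIV \<Phi>" "M-lipschitz_on UNIV \<Phi>" "\<Phi> 0 = 0"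
    "distr vol borel (grad \<Phi>) = \<rho>"
proof -
  obtain g where g: "continuous_on UNIV g" "\<And>\<theta>. continuous_on UNIV \<theta> \<Longrightarrow> dual_cost M \<rho> g \<le> dual_cost M \<rho> \<theta>"
    using dual_cost_minimizer by blast
  define \<Psi> where "\<Psi> = legendre (cball 0 M) g"
  \<comment> \<open>Normalised at \<open>0\<close> so that families of such potentials fall under
    \<open>lipschitz_Arzela_Ascoli\<close>.\<close>
  define \<Phi> where "\<Phi> x = \<Psi> x + (- \<Psi> 0)" for x
  have \<Psi>: "convex_on UNIV \<Psi>" "M-lipschitz_on UNIV \<Psi>" unfolding \<Psi>_def using legendre_target[OF g(1)] by auto
  have c: "convex_on UNIV \<Phi>" unfolding \<Phi>_def[abs_def] using \<Psi>(1) by (intro convex_on_add) (auto simp: convex_on_const)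
  have l: "M-lipschitz_on UNIV \<Phi>" using \<Psi>(2) unfolding \<Phi>_def[abs_def] lipschitz_on_def by (simp add: dist_norm)
  have "GDERIV \<Phi> x :> D \<longleftrightarrow> GDERIV \<Psi> x :> D" for x D
  proof -
    have "GDERIV \<Phi> x :> D" if "GDERIV \<Psi> x :> D" using GDERIV_add[OF that GDERIV_const[of "- \<Psi> 0"]] by (simp add: \<Phi>_def[abs_def])
    moreover have "GDERIV \<Psi> x :> D" if "GDERIV \<Phi> x :> D"
      using GDERIV_add[OF that GDERIV_const[of "\<Psi> 0"]] by (simp add: \<Phi>_def[abs_def])
    ultimately show ?thesis by blast
  qed
  then have gr: "grad \<Phi> = grad \<Psi>" by (simp add: grad_def fun_eq_iff)
  have c': "convex_on (convex hull \<Omega>) \<Psi>" using \<Psi>(1) by (rule convex_on_subset) auto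
  have gm: "grad \<Psi> \<in> borel_measurable vol" by (rule grad_vol_measurable[OF c'])
  have "distr vol borel (grad \<Psi>) = \<rho>"
  proof (rule prob_measures_eqI[OF distr_vol_prob[OF gm] ball_measuresD(1)[OF \<rho>]])
    fix f assume f: "f \<in> C0_functions"
    then have fc: "continuous_on UNIV f" by (simp add: C0_functions_def)
    \<comment> \<open>Minimality gives one inequality; used for \<open>f\<close> and for
      \<open>- f\<close> it becomes an equality.\<close>
    have var: "(\<integral>x. h (grad \<Psi> x) \<partial>vol) \<le> (\<integral>y. h y \<partial>\<rho>)" if "continuous_on UNIV h" for h :: "real ^ 3 \<Rightarrow> real"
      unfolding \<Psi>_def by (rule dual_cost_variation[OF g(1)]) (use g(2) that in auto)
    have "(\<integral>x. f (grad \<Psi> x) \<partial>vol) \<le> (\<integral>y. f y \<partial>\<rho>)" by (rule var[OF fc])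
    moreover have "(\<integral>x. - f (grad \<Psi> x) \<partial>vol) \<le> (\<integral>y. - f y \<partial>\<rho>)"
      by (rule var) (intro continuous_intros fc)
    ultimately have "(\<integral>x. f (grad \<Psi> x) \<partial>vol) = (\<integral>y. f y \<partial>\<rho>)" by simp
    then show "(\<integral>x. f x \<partial>distr vol borel (grad \<Psi>)) = (\<integral>y. f y \<partial>\<rho>)"
      using gm C0_functions_measurable[OF f] by (simp add: integral_distr)
  qed
  then show ?thesis using that[OF c l] gr by (simp add: \<Phi>_def)
qed

end

section \<open>The Brenier map and its compactness\<close>

definition brenier_map :: "(real ^ 3) measure \<Rightarrow> real ^ 3 \<Rightarrow> real ^ 3"
  where "brenier_map \<mu> = grad (brenier_potential \<Omega> \<mu>)"

text \<open>Existence makes the choice behind \<open>brenier_potential\<close> effective. Uniqueness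
  identifies the chosen gradient, almost everywhere, with that of any convex potential transporting
  \<open>\<Omega>\<close> to the same measure.\<close>

lemma brenier_map:
  assumes \<mu>: "\<mu> \<in> ball_measures M"
  shows "brenier_map \<mu> \<in> borel_measurable vol"
    "distr vol borel (brenier_map \<mu>) = \<mu>"
    "AE x in vol. norm (brenier_map \<mu> x) \<le> M"
    "\<And>\<Phi>. convex_on (convex hull \<Omega>) \<Phi> \<Longrightarrow> distr vol borel (grad \<Phi>) = \<mu> \<Longrightarrow>
      AE x in vol. brenier_map \<mu> x = grad \<Phi> x"
proof -
  note P = is_brenier_potential_iff[OF ball_measuresD(1)[OF \<mu>]]
  obtain \<Psi> where \<Psi>: "convex_on UNIV \<Psi>" "distr vol borel (grad \<Psi>) = \<mu>"
    using brenier_existence[OF \<mu>] by blast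
  then have "is_brenier_potential \<Omega> \<mu> \<Psi>" unfolding P by (auto intro: convex_on_subset)
  then have "is_brenier_potential \<Omega> \<mu> (brenier_potential \<Omega> \<mu>)"
    unfolding brenier_potential_def by (rule someI[of "is_brenier_potential \<Omega> \<mu>"])
  then have *: "convex_on (convex hull \<Omega>) (brenier_potential \<Omega> \<mu>)"
    "distr vol borel (brenier_map \<mu>) = \<mu>" unfolding P by (auto simp: brenier_map_def)
  show m: "brenier_map \<mu> \<in> borel_measurable vol"
    unfolding brenier_map_def by (rule grad_vol_measurable[OF *(1)])
  show "distr vol borel (brenier_map \<mu>) = \<mu>" by fact
  have "AE y in distr vol borel (brenier_map \<mu>). norm y \<le> M"
    using ball_measuresD(2)[OF \<mu>] by (subst *(2))
  then show "AE x in vol. norm (brenier_map \<mu> x) \<le> M"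
    using m by (simp add: AE_distr_iff)
  show "AE x in vol. brenier_map \<mu> x = grad \<Phi> x"
    if "convex_on (convex hull \<Omega>) \<Phi>" "distr vol borel (grad \<Phi>) = \<mu>" for \<Phi>
    unfolding brenier_map_def using brenier_unique[OF \<mu> that *(1)] *(2) by (simp add: brenier_map_def)
qed

text \<open>The limit measure is defined as the law of the gradient of the limit potential, which
  makes that gradient its Brenier map. Compactness of the measures thus arrives together with
  convergence of the maps.\<close>

theorem ball_measures_compact:
  assumes \<mu>: "\<And>n. \<mu> n \<in> ball_measures M"
  shows "\<exists>(k :: nat \<Rightarrow> nat) \<nu>. strict_mono k \<and> \<nu> \<in> ball_measures M \<and>
    (AE x in vol. (\<lambda>n. brenier_map (\<mu> (k n)) x) \<longlonglongrightarrow> brenier_map \<nu> x)"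
proof -
  have "\<exists>\<Phi>. convex_on UNIV \<Phi> \<and> M-lipschitz_on UNIV \<Phi> \<and> \<Phi> 0 = 0 \<and>
      distr vol borel (grad \<Phi>) = \<mu> n" for n
    using brenier_existence[OF \<mu>[of n]] by blast
  then obtain \<Phi> where \<Phi>: "\<And>n. convex_on UNIV (\<Phi> n)" "\<And>n. M-lipschitz_on UNIV (\<Phi> n)" "\<And>n. \<Phi> n 0 = 0"
      "\<And>n. distr vol borel (grad (\<Phi> n)) = \<mu> n" by metis
  have M: "M \<ge> 0" using ball_measures_nonneg[OF \<mu>] .
  define K where "K = cball (0 :: real ^ 3) r"
  obtain g k where "continuous_on K g" and k: "strict_mono (k :: nat \<Rightarrow> nat)"
    and conv: "\<And>e. 0 < e \<Longrightarrow> \<exists>N. \<forall>n x. n \<ge> N \<and> x \<in> K \<longrightarrow> norm (\<Phi> (k n) x - g x) < e"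
    using lipschitz_Arzela_Ascoli[of M \<Phi> r, OF \<Phi>(2,3)] unfolding K_def by blast
  have lim: "(\<lambda>n. \<Phi> (k n) x) \<longlonglongrightarrow> g x" if "x \<in> K" for x
  proof (rule LIMSEQ_I)
    fix e :: real assume "0 < e"
    then obtain N where "\<And>n x. n \<ge> N \<Longrightarrow> x \<in> K \<Longrightarrow> norm (\<Phi> (k n) x - g x) < e" using conv by blast
    then show "\<exists>N. \<forall>n\<ge>N. norm (\<Phi> (k n) x - g x) < e" using that by blast
  qed
  \<comment> \<open>The limit potential is controlled on the ball only; the hull of
    \<open>\<Omega>\<close>, where convexity is required, lies inside it.\<close>
  have hullK: "convex hull \<Omega> \<subseteq> K"
    using domain_le by (intro hull_minimal) (auto simp: K_def)
  have cg: "convex_on (convex hull \<Omega>) g"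
    unfolding convex_on_def
  proof (intro conjI ballI allI impI convex_convex_hull)
    fix x z and u v :: real assume h: "x \<in> convex hull \<Omega>" "z \<in> convex hull \<Omega>" and uv: "0 \<le> u" "0 \<le> v" "u + v = 1"
    have mem: "x \<in> K" "z \<in> K" "u *\<^sub>R x + v *\<^sub>R z \<in> K"
      using h hullK convexD[OF convex_convex_hull h uv] by auto
    show "g (u *\<^sub>R x + v *\<^sub>R z) \<le> u * g x + v * g z"
    proof (rule LIMSEQ_le[OF lim[OF mem(3)]])
      show "(\<lambda>n. u * \<Phi> (k n) x + v * \<Phi> (k n) z) \<longlonglongrightarrow> u * g x + v * g z"
        by (intro tendsto_intros lim mem)
    qed (use \<Phi>(1) uv in \<open>auto simp: convex_on_def\<close>)
  qed
  have conv_hull: "convex_on (convex hull \<Omega>) (\<Phi> n)" for n using \<Phi>(1) by (rule convex_on_subset) auto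
  have "AE x in vol. \<forall>n. \<exists>D. GDERIV (\<Phi> n) x :> D"
    using AE_vol_gderiv[OF conv_hull] by (simp add: AE_all_countable)
  then have grads: "AE x in vol. (\<lambda>n. grad (\<Phi> (k n)) x) \<longlonglongrightarrow> grad g x \<and> norm (grad g x) \<le> M"
    using AE_vol_gderiv[OF cg] AE_space
  proof eventually_elim
    fix x assume "\<forall>n. \<exists>D. GDERIV (\<Phi> n) x :> D" and "\<exists>D. GDERIV g x :> D" and x: "x \<in> space vol"
    then have D: "\<And>n. GDERIV (\<Phi> n) x :> grad (\<Phi> n) x" and E: "GDERIV g x :> grad g x"
      using grad_eqI by metis+
    have b: "norm (grad (\<Phi> n) x) \<le> M" for n by (rule gderiv_norm_le[OF \<Phi>(1,2) D])
    have "x \<in> \<Omega>" using x by simp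
    then have l: "(\<lambda>n. grad (\<Phi> (k n)) x) \<longlonglongrightarrow> grad g x"
      using hull hullK by (intro convex_gderiv_tendsto[OF hull(1) _ conv_hull lim D b E]) auto
    moreover have "norm (grad g x) \<le> M"
      using tendsto_norm[OF l] b by (intro LIMSEQ_le_const2) auto
    ultimately show "(\<lambda>n. grad (\<Phi> (k n)) x) \<longlonglongrightarrow> grad g x \<and> norm (grad g x) \<le> M" by blast
  qed
  define \<nu> where "\<nu> = distr vol borel (grad g)"
  have \<nu>: "\<nu> \<in> ball_measures M"
    unfolding \<nu>_def using grads by (intro distr_vol_ball grad_vol_measurable[OF cg]) (auto elim: eventually_mono)
  have "AE x in vol. \<forall>n. brenier_map (\<mu> n) x = grad (\<Phi> n) x"
    using brenier_map(4)[OF \<mu> conv_hull \<Phi>(4)] by (simp add: AE_all_countable)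
  moreover have "AE x in vol. brenier_map \<nu> x = grad g x"
    by (rule brenier_map(4)[OF \<nu> cg]) (simp add: \<nu>_def)
  ultimately have "AE x in vol. (\<lambda>n. brenier_map (\<mu> (k n)) x) \<longlonglongrightarrow> brenier_map \<nu> x"
    using grads by eventually_elim simp
  then show ?thesis using k \<nu> by blast
qed

end

section \<open>Smooth functions and a transport distance\<close>

lemma C_k_continuous: "C_k k f \<Longrightarrow> continuous_on UNIV f"
  by (cases k) (auto intro: differentiable_imp_continuous_on)

lemma C_k_differentiable: "C_k (Suc k) f \<Longrightarrow> f differentiable (at x)"
  by (simp add: differentiable_on_def)

lemma C_k_SucI:
  assumes "\<And>x. (f has_derivative f' x) (at x)" "\<And>b. b \<in> Basis \<Longrightarrow> C_k k (\<lambda>x. f' x b)"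
  shows "C_k (Suc k) f"
proof -
  have "frechet_derivative f (at x) = f' x" for x
    using frechet_derivative_at[OF assms(1)] by simp
  then show ?thesis using assms by (auto simp: differentiable_on_def differentiable_def)
qed

lemma C_k_SucD:
  assumes "C_k (Suc k) f"
  shows "(f has_derivative frechet_derivative f (at x)) (at x)"
    "b \<in> Basis \<Longrightarrow> C_k k (\<lambda>x. frechet_derivative f (at x) b)"
  using assms C_k_differentiable[OF assms] by (auto simp: frechet_derivative_works)

lemma C_k_Suc: "C_k (Suc k) f \<Longrightarrow> C_k k f"
proof (induction k arbitrary: f)
  case 0
  then show ?case using C_k_continuous[OF 0] by simp
next
  case (Suc k)
  show ?case
    by (rule C_k_SucI[OF C_k_SucD(1)[OF Suc.prems]]) (rule Suc.IH[OF C_k_SucD(2)[OF Suc.prems]])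
qed

lemma C_k_const: "C_k k (\<lambda>x. c)"
proof (induction k arbitrary: c)
  case (Suc k)
  show ?case by (rule C_k_SucI[where f' = "\<lambda>x h. 0"]) (auto intro: Suc)
qed simp

lemma C_k_bounded_linear: assumes "bounded_linear f" shows "C_k k f"
proof (cases k)
  case 0
  then show ?thesis using assms by (simp add: linear_continuous_on)
next
  case (Suc j)
  then show ?thesis
    unfolding Suc by (intro C_k_SucI[where f' = "\<lambda>x. f"] bounded_linear_imp_has_derivative assms C_k_const)
qed

lemma C_k_add: "C_k k f \<Longrightarrow> C_k k g \<Longrightarrow> C_k k (\<lambda>x. f x + g x)"
proof (induction k arbitrary: f g)
  case 0
  then show ?case by (simp add: continuous_on_add)
next
  case (Suc k)
  show ?case
    by (rule C_k_SucI, rule has_derivative_add, (rule C_k_SucD(1)[OF Suc.prems(1)] C_k_SucD(1)[OF Suc.prems(2)])+)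
       (intro Suc.IH C_k_SucD(2)[OF Suc.prems(1)] C_k_SucD(2)[OF Suc.prems(2)])
qed

lemma C_k_mult: "C_k k f \<Longrightarrow> C_k k g \<Longrightarrow> C_k k (\<lambda>x. f x * g x)"
proof (induction k arbitrary: f g)
  case 0
  then show ?case by (simp add: continuous_on_mult)
next
  case (Suc k)
  show ?case
    by (rule C_k_SucI, rule has_derivative_mult, (rule C_k_SucD(1)[OF Suc.prems(1)] C_k_SucD(1)[OF Suc.prems(2)])+)
       (intro C_k_add Suc.IH C_k_Suc[OF Suc.prems(1)] C_k_Suc[OF Suc.prems(2)]
          C_k_SucD(2)[OF Suc.prems(1)] C_k_SucD(2)[OF Suc.prems(2)])
qed

lemma C_k_cmult: "C_k k f \<Longrightarrow> C_k k (\<lambda>x. c * f x)"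
  by (intro C_k_mult C_k_const)

lemma C_k_diff: "C_k k f \<Longrightarrow> C_k k g \<Longrightarrow> C_k k (\<lambda>x. f x - g x)"
  using C_k_add[of k f "\<lambda>x. (- 1) * g x"] C_k_cmult[of k g "- 1"] by simp

lemma C_k_sum: "(\<And>i. i \<in> I \<Longrightarrow> C_k k (f i)) \<Longrightarrow> C_k k (\<lambda>x. \<Sum>i\<in>I. f i x)"
  by (induction I rule: infinite_finite_induct) (auto intro: C_k_const C_k_add)

lemma C_k_inverse:
  assumes "\<And>x. f x \<noteq> 0" shows "C_k k f \<Longrightarrow> C_k k (\<lambda>x. inverse (f x))"
proof (induction k)
  case 0
  then show ?case using assms by (simp add: continuous_on_inverse)
next
  case (Suc k)
  have i: "C_k k (\<lambda>x. inverse (f x))" by (intro Suc.IH C_k_Suc[OF Suc.prems])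
  have "((\<lambda>x. inverse (f x)) has_derivative
      (\<lambda>h. - (inverse (f x) * frechet_derivative f (at x) h * inverse (f x)))) (at x)" for x
    by (rule Deriv.has_derivative_inverse[OF assms C_k_SucD(1)[OF Suc.prems]])
  then have "((\<lambda>x. inverse (f x)) has_derivative
      (\<lambda>h. (- 1) * (inverse (f x) * frechet_derivative f (at x) h * inverse (f x)))) (at x)" for x by simp
  then show ?case
    by (rule C_k_SucI) (intro C_k_cmult C_k_mult i C_k_SucD(2)[OF Suc.prems])
qed

lemma C_k_DERIV:
  assumes "\<And>x. (f has_real_derivative f' x) (at x)" "C_k k f'"
  shows "C_k (Suc k) f"
  using assms by (intro C_k_SucI[where f' = "\<lambda>x h. f' x * h"]) (auto simp: has_field_derivative_def)

text \<open>As \<open>h\<close> depends on one real variable, its derivative acts by multiplication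
  with \<open>h'\<close>, so the chain rule yields a product of scalar functions and the induction
  closes.\<close>

lemma C_k_compose:
  fixes h :: "real \<Rightarrow> real"
  shows "C_k k h \<Longrightarrow> C_k k f \<Longrightarrow> C_k k (\<lambda>x. h (f x))"
proof (induction k arbitrary: h f)
  case 0
  then show ?case by (auto intro: continuous_on_compose2)
next
  case (Suc k)
  define h' where "h' y = frechet_derivative h (at y) 1" for y
  have lin: "frechet_derivative h (at y) s = h' y * s" for y s
  proof -
    have "linear (frechet_derivative h (at y))"
      using C_k_SucD(1)[OF Suc.prems(1)] by (rule has_derivative_linear)
    then have "frechet_derivative h (at y) (s *\<^sub>R 1) = s *\<^sub>R h' y" unfolding h'_def by (rule linear_cmul)
    then show ?thesis by (simp add: mult.commute)
  qed
  have "C_k k h'" unfolding h'_def using C_k_SucD(2)[OF Suc.prems(1), of 1] by simp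
  then have c: "C_k k (\<lambda>x. h' (f x))" by (rule Suc.IH) (rule C_k_Suc[OF Suc.prems(2)])
  have "((\<lambda>x. h (f x)) has_derivative (\<lambda>s. frechet_derivative h (at (f x)) (frechet_derivative f (at x) s))) (at x)" for x
    by (rule has_derivative_compose[OF C_k_SucD(1)[OF Suc.prems(2)] C_k_SucD(1)[OF Suc.prems(1)]])
  then show ?case
    unfolding lin by (rule C_k_SucI) (intro C_k_mult c C_k_SucD(2)[OF Suc.prems(2)])
qed

lemma C_k_real_polynomial_function:
  fixes p :: "'a::euclidean_space \<Rightarrow> real"
  shows "real_polynomial_function p \<Longrightarrow> C_k k p"
  by (induction rule: real_polynomial_function.induct) (auto intro: C_k_bounded_linear C_k_const C_k_add C_k_mult)

lemma C_k_inner_self: "C_k k (\<lambda>x::'a::euclidean_space. x \<bullet> x)"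
proof -
  have "(\<lambda>x::'a. x \<bullet> x) = (\<lambda>x. \<Sum>b\<in>Basis. (x \<bullet> b) * (x \<bullet> b))" by (rule ext, rule euclidean_inner)
  moreover have "C_k k (\<lambda>x::'a. \<Sum>b\<in>Basis. (x \<bullet> b) * (x \<bullet> b))"
    by (intro C_k_sum C_k_mult C_k_bounded_linear bounded_linear_inner_left)
  ultimately show ?thesis by simp
qed

text \<open>Polynomial factors make the family closed under differentiation.\<close>

definition flat :: "real poly \<Rightarrow> real \<Rightarrow> real"
  where "flat p x = (if x > 0 then poly p (1 / x) * exp (- 1 / x) else 0)"

lemma poly_exp_decay: "((\<lambda>x. poly p x * exp (- x)) \<longlongrightarrow> (0::real)) at_top"
proof -
  have "((\<lambda>x. \<Sum>i\<le>degree p. coeff p i * (x ^ i / exp x)) \<longlongrightarrow> (\<Sum>i\<le>degree p. coeff p i * 0)) at_top"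
    by (intro tendsto_sum tendsto_mult tendsto_const tendsto_power_div_exp_0)
  then show ?thesis by (simp add: poly_altdef sum_distrib_right sum_divide_distrib exp_minus field_simps)
qed

text \<open>In the variable \<open>1 / x\<close> differentiation replaces \<open>p\<close> by
  \<open>p - pderiv p\<close> and multiplies by the square of the variable, which is
  \<open>[:0, 0, 1:]\<close>. At \<open>0\<close> the right difference quotient is
  \<open>poly ([:0, 1:] * p) (1 / h) * exp (- 1 / h)\<close>, killed by exponential decay.\<close>

lemma flat_deriv: "(flat p has_real_derivative flat ([:0, 0, 1:] * (p - pderiv p)) x) (at x)"
proof -
  consider "x > 0" | "x < 0" | "x = 0" by linarith
  then show ?thesis
  proof cases
    case 1
    have "((\<lambda>x. poly p (1 / x) * exp (- 1 / x)) has_real_derivative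
        (poly (pderiv p) (1 / x) * (- 1 / x\<^sup>2) * exp (- 1 / x) + poly p (1 / x) * (exp (- 1 / x) * (1 / x\<^sup>2)))) (at x)"
      using 1 by (auto intro!: derivative_eq_intros poly_DERIV[THEN DERIV_chain2] simp: power2_eq_square field_simps)
    moreover have "poly (pderiv p) (1 / x) * (- 1 / x\<^sup>2) * exp (- 1 / x) + poly p (1 / x) * (exp (- 1 / x) * (1 / x\<^sup>2))
        = flat ([:0, 0, 1:] * (p - pderiv p)) x"
      using 1 by (simp add: flat_def power2_eq_square field_simps)
    ultimately have "((\<lambda>x. poly p (1 / x) * exp (- 1 / x)) has_real_derivative flat ([:0, 0, 1:] * (p - pderiv p)) x) (at x)"
      by simp
    then show ?thesis
      by (rule has_field_derivative_transform_within_open[where S = "{0<..}"]) (use 1 in \<open>auto simp: flat_def\<close>)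
  next
    case 2
    have "((\<lambda>x. 0) has_real_derivative flat ([:0, 0, 1:] * (p - pderiv p)) x) (at x)"
      using 2 by (simp add: flat_def)
    then show ?thesis
      by (rule has_field_derivative_transform_within_open[where S = "{..<0}"]) (use 2 in \<open>auto simp: flat_def\<close>)
  next
    case 3
    have "((\<lambda>h. poly ([:0, 1:] * p) h * exp (- h)) \<longlongrightarrow> 0) at_top" by (rule poly_exp_decay)
    then have "((\<lambda>h. poly ([:0, 1:] * p) (inverse h) * exp (- inverse h)) \<longlongrightarrow> 0) (at_right 0)"
      by (rule filterlim_compose) (rule filterlim_inverse_at_top_right)
    moreover have "eventually (\<lambda>h::real. poly ([:0, 1:] * p) (inverse h) * exp (- inverse h) = flat p h / h) (at_right 0)"
      using eventually_at_right_less[of "0::real"] by eventually_elim (auto simp: flat_def field_simps)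
    ultimately have r: "((\<lambda>h. flat p h / h) \<longlongrightarrow> 0) (at_right 0)" by (rule Lim_transform_eventually)
    have "eventually (\<lambda>h::real. flat p h / h = 0) (at_left 0)"
      by (auto simp: eventually_at_filter flat_def)
    then have l: "((\<lambda>h. flat p h / h) \<longlongrightarrow> 0) (at_left 0)" by (rule tendsto_eventually)
    have "((\<lambda>h. flat p h / h) \<longlongrightarrow> 0) (at 0)" using l r by (simp add: filterlim_at_split)
    then show ?thesis using 3 by (simp add: has_field_derivative_iff flat_def)
  qed
qed

lemma C_k_flat: "C_k k (flat p)"
proof (induction k arbitrary: p)
  case 0
  have "isCont (flat p) x" for x using flat_deriv DERIV_isCont by blast
  then show ?case by (simp add: continuous_on_eq_continuous_at)
next
  case (Suc k)
  show ?case by (rule C_k_DERIV[OF flat_deriv Suc])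
qed

section \<open>Cutoff functions\<close>

text \<open>\<open>flat 1\<close> is \<open>exp (- 1 / x)\<close> on positive arguments and
  \<open>0\<close> elsewhere. One of \<open>x\<close> and \<open>1 - x\<close> is positive, so the
  denominator never vanishes.\<close>

definition smooth_step :: "real \<Rightarrow> real"
  where "smooth_step x = flat 1 x * inverse (flat 1 x + flat 1 (1 - x))"

lemma flat_1: "flat 1 x \<ge> 0" "x \<le> 0 \<Longrightarrow> flat 1 x = 0" "x > 0 \<Longrightarrow> flat 1 x > 0"
  by (auto simp: flat_def)

lemma C_k_smooth_step: "C_k k smooth_step"
proof -
  have pos: "flat 1 x + flat 1 (1 - x) \<noteq> 0" for x :: real
    using flat_1(1)[of x] flat_1(1)[of "1 - x"] flat_1(3)[of x] flat_1(3)[of "1 - x"]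
    by (cases "x > 0") auto
  have "C_k k (\<lambda>x::real. 1 - x)"
    by (intro C_k_diff C_k_const C_k_bounded_linear bounded_linear_ident)
  then have "C_k k (\<lambda>x::real. flat 1 (1 - x))" by (rule C_k_compose[OF C_k_flat])
  then have "C_k k (\<lambda>x::real. flat 1 x + flat 1 (1 - x))" by (rule C_k_add[OF C_k_flat])
  then have "C_k k (\<lambda>x::real. inverse (flat 1 x + flat 1 (1 - x)))" by (rule C_k_inverse[OF pos])
  then show ?thesis unfolding smooth_step_def[abs_def] by (rule C_k_mult[OF C_k_flat])
qed

lemma smooth_step_simps: "x \<le> 0 \<Longrightarrow> smooth_step x = 0" "x \<ge> 1 \<Longrightarrow> smooth_step x = 1"
  using flat_1(3)[of x] flat_1(2)[of "1 - x"] by (auto simp: smooth_step_def flat_1(2))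

text \<open>The squared norm keeps smoothness at the origin. The argument of the step is at least
  \<open>1\<close> for norm at most \<open>M\<close>, and nonpositive once the squared norm reaches
  \<open>M\<^sup>2 + 1\<close>; for \<open>M \<ge> 0\<close> this includes all norms above
  \<open>M + 1\<close>.\<close>

definition cutoff :: "real \<Rightarrow> 'a::euclidean_space \<Rightarrow> real"
  where "cutoff M z = smooth_step (M\<^sup>2 + 1 - z \<bullet> z)"

lemma C_k_cutoff: "C_k k (cutoff M)"
  unfolding cutoff_def[abs_def]
  by (intro C_k_compose[OF C_k_smooth_step] C_k_diff C_k_const C_k_inner_self)

lemma cutoff_eq_1: "norm z \<le> M \<Longrightarrow> cutoff M z = 1"
  using power_mono[of "norm z" M 2] by (simp add: cutoff_def smooth_step_simps power2_norm_eq_inner)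

lemma cutoff_eq_0: assumes "norm z > M + 1" "M \<ge> 0" shows "cutoff M z = 0"
proof -
  have "(M + 1)\<^sup>2 \<le> (norm z)\<^sup>2" using assms by (intro power_mono) auto
  moreover have "M\<^sup>2 + 1 \<le> (M + 1)\<^sup>2" using assms by (simp add: power2_eq_square algebra_simps)
  ultimately show ?thesis by (simp add: cutoff_def smooth_step_simps power2_norm_eq_inner)
qed

text \<open>The partial derivatives are continuous and vanish outside a ball, hence are bounded; the
  sum of their bounds controls the operator norm.\<close>

lemma C_k_bounded_support_lipschitz:
  fixes f :: "'a::euclidean_space \<Rightarrow> real"
  assumes f: "C_k (Suc 0) f" and supp: "\<And>x. norm x > R \<Longrightarrow> f x = 0"
  obtains L where "L > 0" "L-lipschitz_on UNIV f"
proof -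
  define D where "D x b = frechet_derivative f (at x) b" for x b
  have der: "(f has_derivative D x) (at x)" for x unfolding D_def by (rule C_k_SucD(1)[OF f])
  have "\<exists>B. B \<ge> 0 \<and> (\<forall>x. \<bar>D x b\<bar> \<le> B)" if b: "b \<in> Basis" for b
  proof -
    have c: "continuous_on UNIV (\<lambda>x. D x b)" using C_k_SucD(2)[OF f b] by (simp add: D_def)
    obtain B where B: "B \<ge> 0" "\<And>x. norm x \<le> R \<Longrightarrow> \<bar>D x b\<bar> \<le> B" using continuous_on_ball_bounded[OF c, of R] by blast
    have "D x b = 0" if "norm x > R" for x
    proof -
      have "((\<lambda>x. 0) has_derivative (\<lambda>h. 0)) (at x)" by simp
      then have "(f has_derivative (\<lambda>h. 0)) (at x)"
        by (rule has_derivative_transform_within_open[where s = "- cball 0 R"]) (use that supp in auto)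
      then have "D x = (\<lambda>h. 0)" using der has_derivative_unique by blast
      then show ?thesis by simp
    qed
    then show ?thesis using B by (metis abs_0 not_le_imp_less)
  qed
  then obtain B where B: "\<And>b. b \<in> Basis \<Longrightarrow> B b \<ge> 0 \<and> (\<forall>x. \<bar>D x b\<bar> \<le> B b)" by metis
  \<comment> \<open>The added \<open>1\<close> makes the constant positive, so that it can be
    divided by.\<close>
  define L where "L = (\<Sum>b\<in>(Basis::'a set). B b) + 1"
  have L: "L > 0" unfolding L_def using B by (smt (verit) sum_nonneg)
  have bd: "norm (D x h) \<le> L * norm h" for x h
  proof -
    have lin: "linear (D x)" using der has_derivative_linear by blast
    have "D x h = D x (\<Sum>b\<in>Basis. (h \<bullet> b) *\<^sub>R b)" by (simp add: euclidean_representation)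
    also have "\<dots> = (\<Sum>b\<in>Basis. (h \<bullet> b) * D x b)" using lin by (simp add: linear_sum linear_cmul)
    finally have "norm (D x h) \<le> (\<Sum>b\<in>Basis. norm ((h \<bullet> b) * D x b))" using norm_sum by (simp only:)
    also have "\<dots> \<le> (\<Sum>b\<in>Basis. norm h * B b)"
      using B Basis_le_norm by (intro sum_mono) (auto simp: abs_mult intro!: mult_mono)
    also have "\<dots> = (L - 1) * norm h" by (simp add: L_def sum_distrib_right mult.commute sum_distrib_left)
    also have "\<dots> \<le> L * norm h" by (simp add: left_diff_distrib)
    finally show ?thesis .
  qed
  have "L-lipschitz_on UNIV f"
  proof (rule bounded_derivative_imp_lipschitz)
    show "(f has_derivative D x) (at x within UNIV)" for x using der by simp
    show "onorm (D x) \<le> L" for x using L bd by (intro onorm_bound) auto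
  qed (use L in auto)
  then show ?thesis using that L by blast
qed

section \<open>A transport distance\<close>

definition smooth_nonexpansive :: "(real ^ 3 \<Rightarrow> real) set"
  where "smooth_nonexpansive = {f. (\<forall>k. C_k k f) \<and> 1-lipschitz_on UNIV f}"

lemma smooth_nonexpansive_cont: "f \<in> smooth_nonexpansive \<Longrightarrow> continuous_on UNIV f"
  by (auto simp: smooth_nonexpansive_def lipschitz_on_continuous_on)

text \<open>A Weierstrass polynomial times a cutoff is smooth with bounded support, hence Lipschitz;
  dividing by its Lipschitz constant \<open>c\<close> lands in the test class. In this way smooth
  1-Lipschitz functions control all continuous ones on a ball.\<close>

lemma smooth_nonexpansive_approx:
  fixes g :: "real ^ 3 \<Rightarrow> real"
  assumes g: "continuous_on UNIV g" and e: "e > 0" and M: "M \<ge> 0"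
  obtains f c where "f \<in> smooth_nonexpansive" "c > 0" "\<And>y. norm y \<le> M \<Longrightarrow> \<bar>g y - c * f y\<bar> \<le> e"
proof -
  obtain p where p: "real_polynomial_function p" "\<And>x. x \<in> cball 0 M \<Longrightarrow> \<bar>g x - p x\<bar> < e"
    using Stone_Weierstrass_real_polynomial_function[OF compact_cball continuous_on_subset[OF g subset_UNIV] e, of 0 M] by blast
  define f0 where "f0 x = p x * cutoff M x" for x
  have s: "C_k k f0" for k unfolding f0_def[abs_def] by (intro C_k_mult C_k_real_polynomial_function p C_k_cutoff)
  obtain L where L: "L > 0" "L-lipschitz_on UNIV f0"
    using C_k_bounded_support_lipschitz[OF s, of "M + 1"] cutoff_eq_0[OF _ M] by (auto simp: f0_def)
  define f where "f x = (1 / L) * f0 x" for x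
  have "1-lipschitz_on UNIV f"
  proof (rule lipschitz_onI)
    fix x y :: "real ^ 3"
    have "\<bar>f0 x - f0 y\<bar> \<le> L * dist x y" using lipschitz_onD[OF L(2), of x y] by (simp add: dist_real_def)
    then have "(1 / L) * \<bar>f0 x - f0 y\<bar> \<le> (1 / L) * (L * dist x y)" using L by (intro mult_left_mono) auto
    moreover have "\<bar>f x - f y\<bar> = (1 / L) * \<bar>f0 x - f0 y\<bar>"
      using L by (simp add: f_def abs_divide flip: diff_divide_distrib)
    ultimately show "dist (f x) (f y) \<le> 1 * dist x y" using L by (simp add: dist_real_def)
  qed simp
  moreover have "C_k k f" for k unfolding f_def[abs_def] by (intro C_k_cmult s)
  ultimately have "f \<in> smooth_nonexpansive" by (simp add: smooth_nonexpansive_def)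
  moreover have "\<bar>g y - L * f y\<bar> \<le> e" if "norm y \<le> M" for y
    using p(2)[of y] that L by (simp add: f_def f0_def cutoff_eq_1)
  ultimately show ?thesis using that L(1) by blast
qed

text \<open>A version of the transport distance for which the weak formulation directly bounds the speed of a curve,
  since only smooth functions are tested.\<close>

definition wdist :: "(real ^ 3) measure \<Rightarrow> (real ^ 3) measure \<Rightarrow> real"
  where "wdist \<mu> \<nu> = (SUP f\<in>smooth_nonexpansive. \<bar>(\<integral>x. f x \<partial>\<mu>) - (\<integral>x. f x \<partial>\<nu>)\<bar>)"

lemma zero_smooth_nonexpansive: "(\<lambda>x. 0) \<in> smooth_nonexpansive"
  by (auto simp: smooth_nonexpansive_def C_k_const lipschitz_on_def)

text \<open>Subtracting \<open>f 0\<close> removes the free additive constant of the class. The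
  resulting bound keeps the supremum in \<open>wdist\<close> finite.\<close>

lemma smooth_nonexpansive_integral_bound:
  assumes \<mu>: "\<mu> \<in> ball_measures M" and f: "f \<in> smooth_nonexpansive"
  shows "\<bar>(\<integral>x. f x \<partial>\<mu>) - f 0\<bar> \<le> M"
proof -
  interpret prob_space \<mu> using \<mu> by (rule ball_measuresD)
  note i = ball_measures_integrable_continuous[OF \<mu> smooth_nonexpansive_cont[OF f]]
  have "(\<integral>x. f x \<partial>\<mu>) - f 0 = (\<integral>x. f x - f 0 \<partial>\<mu>)" using i prob_space by simp
  also have "\<bar>\<dots>\<bar> \<le> (\<integral>x. \<bar>f x - f 0\<bar> \<partial>\<mu>)" by (rule integral_abs_bound)
  also have "\<dots> \<le> (\<integral>x. M \<partial>\<mu>)"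
  proof (rule integral_mono_AE)
    show "AE x in \<mu>. \<bar>f x - f 0\<bar> \<le> M" using ball_measuresD(2)[OF \<mu>]
    proof eventually_elim
      fix x :: "real ^ 3" assume "norm x \<le> M"
      moreover have "dist (f x) (f 0) \<le> 1 * dist x 0"
        using f by (intro lipschitz_onD[of _ UNIV]) (auto simp: smooth_nonexpansive_def)
      ultimately show "\<bar>f x - f 0\<bar> \<le> M" by (simp add: dist_real_def)
    qed
  qed (use i in auto)
  also have "\<dots> = M" using prob_space by simp
  finally show ?thesis .
qed

lemma wdist_bdd:
  assumes "\<mu> \<in> ball_measures M" "\<nu> \<in> ball_measures N" "f \<in> smooth_nonexpansive"
  shows "\<bar>(\<integral>x. f x \<partial>\<mu>) - (\<integral>x. f x \<partial>\<nu>)\<bar> \<le> M + N"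
  using smooth_nonexpansive_integral_bound[OF assms(1,3)] smooth_nonexpansive_integral_bound[OF assms(2,3)] by linarith

lemma wdist_ge:
  assumes "\<mu> \<in> ball_measures M" "\<nu> \<in> ball_measures N" "f \<in> smooth_nonexpansive"
  shows "\<bar>(\<integral>x. f x \<partial>\<mu>) - (\<integral>x. f x \<partial>\<nu>)\<bar> \<le> wdist \<mu> \<nu>"
  unfolding wdist_def using assms wdist_bdd[OF assms(1,2)] by (intro cSUP_upper bdd_aboveI2) auto

lemma wdist_le: "(\<And>f. f \<in> smooth_nonexpansive \<Longrightarrow> \<bar>(\<integral>x. f x \<partial>\<mu>) - (\<integral>x. f x \<partial>\<nu>)\<bar> \<le> e) \<Longrightarrow> wdist \<mu> \<nu> \<le> e"
  unfolding wdist_def using zero_smooth_nonexpansive by (intro cSUP_least) auto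

lemma wdist_nonneg:
  assumes "\<mu> \<in> ball_measures M" "\<nu> \<in> ball_measures N" shows "0 \<le> wdist \<mu> \<nu>"
  using wdist_ge[OF assms zero_smooth_nonexpansive] by simp

lemma wdist_sym: "wdist \<mu> \<nu> = wdist \<nu> \<mu>"
  unfolding wdist_def by (simp add: abs_minus_commute)

lemma wdist_self: "wdist \<mu> \<mu> = 0"
  unfolding wdist_def using zero_smooth_nonexpansive by (auto intro!: cSup_eq_maximum)

lemma wdist_triangle:
  assumes "\<mu> \<in> ball_measures M" "\<nu> \<in> ball_measures N" "\<xi> \<in> ball_measures K"
  shows "wdist \<mu> \<xi> \<le> wdist \<mu> \<nu> + wdist \<nu> \<xi>"
proof (rule wdist_le)
  fix f assume f: "f \<in> smooth_nonexpansive"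
  show "\<bar>(\<integral>x. f x \<partial>\<mu>) - (\<integral>x. f x \<partial>\<xi>)\<bar> \<le> wdist \<mu> \<nu> + wdist \<nu> \<xi>"
    using wdist_ge[OF assms(1,2) f] wdist_ge[OF assms(2,3) f] by linarith
qed

lemma wdist_integral_le:
  assumes \<mu>: "\<mu> \<in> ball_measures M" and \<nu>: "\<nu> \<in> ball_measures M" and f: "f \<in> smooth_nonexpansive" and c: "c > 0"
    and g: "continuous_on UNIV g" and a: "\<And>y. norm y \<le> M \<Longrightarrow> \<bar>g y - c * f y\<bar> \<le> e"
  shows "\<bar>(\<integral>x. g x \<partial>\<mu>) - (\<integral>x. g x \<partial>\<nu>)\<bar> \<le> 2 * e + c * wdist \<mu> \<nu>"
proof -
  have one: "\<bar>(\<integral>x. g x \<partial>\<xi>) - c * (\<integral>x. f x \<partial>\<xi>)\<bar> \<le> e" if \<xi>: "\<xi> \<in> ball_measures M" for \<xi>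
  proof -
    interpret prob_space \<xi> using \<xi> by (rule ball_measuresD)
    note i = ball_measures_integrable_continuous[OF \<xi> smooth_nonexpansive_cont[OF f]] ball_measures_integrable_continuous[OF \<xi> g]
    have "(\<integral>x. g x \<partial>\<xi>) - c * (\<integral>x. f x \<partial>\<xi>) = (\<integral>x. g x - c * f x \<partial>\<xi>)" using i by simp
    also have "\<bar>\<dots>\<bar> \<le> (\<integral>x. \<bar>g x - c * f x\<bar> \<partial>\<xi>)" by (rule integral_abs_bound)
    also have "\<dots> \<le> (\<integral>x. e \<partial>\<xi>)"
      using ball_measuresD(2)[OF \<xi>] i a by (intro integral_mono_AE) (auto elim: eventually_mono)
    also have "\<dots> = e" using prob_space by simp
    finally show ?thesis .
  qed
  have "c * \<bar>(\<integral>x. f x \<partial>\<mu>) - (\<integral>x. f x \<partial>\<nu>)\<bar> \<le> c * wdist \<mu> \<nu>"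
    using wdist_ge[OF \<mu> \<nu> f] c by simp
  then have "\<bar>c * (\<integral>x. f x \<partial>\<mu>) - c * (\<integral>x. f x \<partial>\<nu>)\<bar> \<le> c * wdist \<mu> \<nu>"
    using c by (simp add: abs_mult flip: right_diff_distrib)
  then show ?thesis using one[OF \<mu>] one[OF \<nu>] by linarith
qed

text \<open>On a fixed ball \<open>wdist\<close> controls integrals of arbitrary continuous
  functions: approximate within \<open>e / 3\<close>, then let the distance beat the now fixed
  constant \<open>c\<close>.\<close>

lemma wdist_tendsto_integral:
  assumes \<mu>: "\<And>n. \<mu> n \<in> ball_measures M" and \<nu>: "\<nu> \<in> ball_measures M"
    and lim: "(\<lambda>n. wdist (\<mu> n) \<nu>) \<longlonglongrightarrow> 0" and g: "continuous_on UNIV (g :: real ^ 3 \<Rightarrow> real)"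
  shows "(\<lambda>n. \<integral>x. g x \<partial>\<mu> n) \<longlonglongrightarrow> (\<integral>x. g x \<partial>\<nu>)"
proof (rule metric_LIMSEQ_I)
  fix e :: real assume e: "0 < e"
  then have "e / 3 > 0" by simp
  then obtain f c where f: "f \<in> smooth_nonexpansive" "c > 0" "\<And>y. norm y \<le> M \<Longrightarrow> \<bar>g y - c * f y\<bar> \<le> e / 3"
    using smooth_nonexpansive_approx[OF g _ ball_measures_nonneg[OF \<nu>]] by blast
  have "e / (3 * c) > 0" using e f by simp
  then obtain N where N: "\<And>n. n \<ge> N \<Longrightarrow> \<bar>wdist (\<mu> n) \<nu>\<bar> < e / (3 * c)"
    using LIMSEQ_D[OF lim] by (metis diff_zero real_norm_def)
  have "dist (\<integral>x. g x \<partial>\<mu> n) (\<integral>x. g x \<partial>\<nu>) < e" if "n \<ge> N" for n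
  proof -
    have "c * wdist (\<mu> n) \<nu> < e / 3"
    proof -
      have "c * wdist (\<mu> n) \<nu> \<le> c * \<bar>wdist (\<mu> n) \<nu>\<bar>" using f(2) by (intro mult_left_mono) auto
      also have "\<dots> < c * (e / (3 * c))" using N[OF that] f(2) by (intro mult_strict_left_mono)
      also have "\<dots> = e / 3" using f(2) by simp
      finally show ?thesis .
    qed
    then show ?thesis
      using wdist_integral_le[OF \<mu> \<nu> f(1,2) g f(3), of n] by (simp add: dist_real_def)
  qed
  then show "\<exists>N. \<forall>n\<ge>N. dist (\<integral>x. g x \<partial>\<mu> n) (\<integral>x. g x \<partial>\<nu>) < e" by blast
qed

lemma wdist_eq_0:
  assumes \<mu>: "\<mu> \<in> ball_measures M" and \<nu>: "\<nu> \<in> ball_measures N" and eq: "wdist \<mu> \<nu> = 0"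
  shows "\<mu> = \<nu>"
proof (rule prob_measures_eqI)
  fix g assume g: "g \<in> C0_functions"
  have "(\<lambda>n::nat. \<integral>x. g x \<partial>\<mu>) \<longlonglongrightarrow> (\<integral>x. g x \<partial>\<nu>)"
    using \<mu> \<nu> ball_measures_mono[of M "max M N"] ball_measures_mono[of N "max M N"] g eq
    by (intro wdist_tendsto_integral[of "\<lambda>_. \<mu>" "max M N"]) (auto simp: C0_functions_def)
  then show "(\<integral>x. g x \<partial>\<mu>) = (\<integral>x. g x \<partial>\<nu>)" by (simp add: LIMSEQ_const_iff)
qed (use ball_measuresD[OF \<mu>] ball_measuresD[OF \<nu>] in auto)

context source_domain
begin

lemma brenier_map_integral:
  fixes f :: "real ^ 3 \<Rightarrow> real"
  assumes \<mu>: "\<mu> \<in> ball_measures M" and f: "f \<in> borel_measurable borel"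
  shows "(\<integral>y. f y \<partial>\<mu>) = (\<integral>x. f (brenier_map \<mu> x) \<partial>vol)"
  using brenier_map(1)[OF \<mu>] f by (subst brenier_map(2)[OF \<mu>, symmetric], subst integral_distr) auto

text \<open>Both laws are images of the same label \<open>x\<close>, and this coupling bounds the
  distance by the mean displacement.\<close>

lemma wdist_distr_le:
  assumes S: "S \<in> borel_measurable vol" "AE x in vol. norm (S x) \<le> M"
    and T: "T \<in> borel_measurable vol" "AE x in vol. norm (T x) \<le> M"
  shows "wdist (distr vol borel S) (distr vol borel T) \<le> (\<integral>x. norm (S x - T x) \<partial>vol)"
proof (rule wdist_le)
  fix f assume f: "f \<in> smooth_nonexpansive"
  have fm: "f \<in> borel_measurable borel" using smooth_nonexpansive_cont[OF f] by (rule borel_measurable_continuous_onI)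
  obtain B where B: "\<And>y. norm y \<le> M \<Longrightarrow> \<bar>f y\<bar> \<le> B" using continuous_on_ball_bounded[OF smooth_nonexpansive_cont[OF f], of M] by blast
  have i1: "integrable vol (\<lambda>x. f (S x))" and i2: "integrable vol (\<lambda>x. f (T x))"
    using S T B measurable_compose[OF S(1) fm] measurable_compose[OF T(1) fm]
    by (auto intro!: vol_integrable[where B = B] elim: eventually_mono)
  have "(\<integral>x. f x \<partial>distr vol borel S) - (\<integral>x. f x \<partial>distr vol borel T)
      = (\<integral>x. f (S x) - f (T x) \<partial>vol)"
    using i1 i2 S T fm by (simp add: integral_distr)
  also have "\<bar>\<dots>\<bar> \<le> (\<integral>x. \<bar>f (S x) - f (T x)\<bar> \<partial>vol)" by (rule integral_abs_bound)
  also have "\<dots> \<le> (\<integral>x. norm (S x - T x) \<partial>vol)"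
  proof (rule integral_mono)
    show "integrable vol (\<lambda>x. norm (S x - T x))"
    proof (rule vol_integrable[where B = "M + M"])
      show "AE x in vol. \<bar>norm (S x - T x)\<bar> \<le> M + M"
        using S(2) T(2)
      proof eventually_elim
        fix x assume "norm (S x) \<le> M" "norm (T x) \<le> M"
        then show "\<bar>norm (S x - T x)\<bar> \<le> M + M" using norm_triangle_ineq4[of "S x" "T x"] by simp
      qed
    qed (use S T in simp)
    show "\<bar>f (S x) - f (T x)\<bar> \<le> norm (S x - T x)" for x
      using f lipschitz_onD[of 1 UNIV f "S x" "T x"] by (simp add: smooth_nonexpansive_def dist_norm)
  qed (use i1 i2 in auto)
  finally show "\<bar>(\<integral>x. f x \<partial>distr vol borel S) - (\<integral>x. f x \<partial>distr vol borel T)\<bar>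
      \<le> (\<integral>x. norm (S x - T x) \<partial>vol)" .
qed

lemma brenier_map_AE_imp_wdist:
  assumes \<mu>: "\<And>n. \<mu> n \<in> ball_measures M" and \<nu>: "\<nu> \<in> ball_measures M"
    and lim: "AE x in vol. (\<lambda>n. brenier_map (\<mu> n) x) \<longlonglongrightarrow> brenier_map \<nu> x"
  shows "(\<lambda>n. wdist (\<mu> n) \<nu>) \<longlonglongrightarrow> 0"
proof -
  note b = brenier_map[OF \<nu>] and bn = brenier_map[OF \<mu>]
  have "(\<lambda>n. \<integral>x. norm (brenier_map (\<mu> n) x - brenier_map \<nu> x) \<partial>vol) \<longlonglongrightarrow> (\<integral>x. 0 \<partial>vol)"
  proof (rule integral_dominated_convergence[where w = "\<lambda>_. M + M"])
    show "AE x in vol. (\<lambda>n. norm (brenier_map (\<mu> n) x - brenier_map \<nu> x)) \<longlonglongrightarrow> 0"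
      using lim by eventually_elim (simp add: LIM_zero tendsto_norm_zero)
    show "AE x in vol. norm (norm (brenier_map (\<mu> n) x - brenier_map \<nu> x)) \<le> M + M" for n
      using b(3) bn(3)[of n]
    proof eventually_elim
      fix x assume "norm (brenier_map \<nu> x) \<le> M" "norm (brenier_map (\<mu> n) x) \<le> M"
      then show "norm (norm (brenier_map (\<mu> n) x - brenier_map \<nu> x)) \<le> M + M"
        using norm_triangle_ineq4[of "brenier_map (\<mu> n) x" "brenier_map \<nu> x"] by simp
    qed
    show "(\<lambda>x. norm (brenier_map (\<mu> n) x - brenier_map \<nu> x)) \<in> borel_measurable vol" for n
      using b(1) bn(1)[of n] by simp
  qed auto
  then have l: "(\<lambda>n. \<integral>x. norm (brenier_map (\<mu> n) x - brenier_map \<nu> x) \<partial>vol) \<longlonglongrightarrow> 0" by simp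
  have le: "wdist (\<mu> n) \<nu> \<le> (\<integral>x. norm (brenier_map (\<mu> n) x - brenier_map \<nu> x) \<partial>vol)" for n
    using wdist_distr_le[OF bn(1,3) b(1,3), of n] by (simp add: b(2) bn(2))
  show ?thesis
    by (rule tendsto_sandwich[OF _ _ tendsto_const l]) (use le wdist_nonneg[OF \<mu> \<nu>] in auto)
qed

lemma ball_measures_wdist_compact:
  assumes \<mu>: "\<And>n. \<mu> n \<in> ball_measures M"
  obtains k \<nu> where "strict_mono (k :: nat \<Rightarrow> nat)" "\<nu> \<in> ball_measures M"
    "AE x in vol. (\<lambda>n. brenier_map (\<mu> (k n)) x) \<longlonglongrightarrow> brenier_map \<nu> x"
    "(\<lambda>n. wdist (\<mu> (k n)) \<nu>) \<longlonglongrightarrow> 0"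
proof -
  obtain k :: "nat \<Rightarrow> nat" and \<nu> where k: "strict_mono k" "\<nu> \<in> ball_measures M"
    "AE x in vol. (\<lambda>n. brenier_map (\<mu> (k n)) x) \<longlonglongrightarrow> brenier_map \<nu> x"
    using ball_measures_compact[of \<mu> M] \<mu> by blast
  have "(\<lambda>n. wdist (\<mu> (k n)) \<nu>) \<longlonglongrightarrow> 0" by (rule brenier_map_AE_imp_wdist[OF \<mu> k(2,3)])
  then show ?thesis using that k by blast
qed

text \<open>Any subsequence has a further one converging in \<open>wdist\<close> to a measure on the
  ball, which the integrals of \<open>C0_functions\<close> identify with \<open>\<nu>\<close>. That
  \<open>\<nu>\<close> is carried by the same ball is a by-product.\<close>

lemma ball_measures_C0_imp_wdist:
  assumes \<mu>: "\<And>n. \<mu> n \<in> ball_measures M" and \<nu>: "\<nu> \<in> prob_measures"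
    and lim: "\<And>f. f \<in> C0_functions \<Longrightarrow> (\<lambda>n. \<integral>x. f x \<partial>\<mu> n) \<longlonglongrightarrow> (\<integral>x. f x \<partial>\<nu>)"
  shows "\<nu> \<in> ball_measures M" "(\<lambda>n. wdist (\<mu> n) \<nu>) \<longlonglongrightarrow> 0"
proof -
  have key: "\<exists>s. strict_mono (s :: nat \<Rightarrow> nat) \<and> (\<lambda>n. wdist (\<mu> (a (s n))) \<nu>) \<longlonglongrightarrow> 0 \<and> \<nu> \<in> ball_measures M"
    if a: "strict_mono a" for a :: "nat \<Rightarrow> nat"
  proof -
    obtain k \<xi> where k: "strict_mono (k :: nat \<Rightarrow> nat)" "\<xi> \<in> ball_measures M" "(\<lambda>n. wdist (\<mu> (a (k n))) \<xi>) \<longlonglongrightarrow> 0"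
      using ball_measures_wdist_compact[where \<mu> = "\<lambda>n. \<mu> (a n)" and M = M] \<mu> by blast
    have ak: "strict_mono (\<lambda>n. a (k n))" using strict_mono_o[OF a k(1)] by (simp add: o_def)
    have "\<xi> = \<nu>"
    proof (rule prob_measures_eqI[OF ball_measuresD(1)[OF k(2)] \<nu>])
      fix f assume f: "f \<in> C0_functions"
      then have "continuous_on UNIV f" by (simp add: C0_functions_def)
      then have "(\<lambda>n. \<integral>x. f x \<partial>\<mu> (a (k n))) \<longlonglongrightarrow> (\<integral>x. f x \<partial>\<xi>)"
        using \<mu> k by (intro wdist_tendsto_integral[where M = M]) auto
      moreover have "(\<lambda>n. \<integral>x. f x \<partial>\<mu> (a (k n))) \<longlonglongrightarrow> (\<integral>x. f x \<partial>\<nu>)"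
        using LIMSEQ_subseq_LIMSEQ[OF lim[OF f] ak] by (simp add: o_def)
      ultimately show "(\<integral>x. f x \<partial>\<xi>) = (\<integral>x. f x \<partial>\<nu>)" by (rule LIMSEQ_unique)
    qed
    then show ?thesis using k by blast
  qed
  show "\<nu> \<in> ball_measures M" using key[OF strict_mono_id] by blast
  show "(\<lambda>n. wdist (\<mu> n) \<nu>) \<longlonglongrightarrow> 0" by (rule tendsto_subseqI) (use key in blast)
qed

text \<open>Compactness supplies some limit \<open>\<xi>\<close> together with convergence of the
  maps; the triangle inequality forces \<open>\<xi> = \<nu>\<close>.\<close>

lemma wdist_imp_brenier_map_AE:
  assumes \<mu>: "\<And>n. \<mu> n \<in> ball_measures M" and \<nu>: "\<nu> \<in> ball_measures M" and lim: "(\<lambda>n. wdist (\<mu> n) \<nu>) \<longlonglongrightarrow> 0"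
  obtains k where "strict_mono (k :: nat \<Rightarrow> nat)"
    "AE x in vol. (\<lambda>n. brenier_map (\<mu> (k n)) x) \<longlonglongrightarrow> brenier_map \<nu> x"
proof -
  obtain k \<xi> where k: "strict_mono (k :: nat \<Rightarrow> nat)" "\<xi> \<in> ball_measures M"
    "AE x in vol. (\<lambda>n. brenier_map (\<mu> (k n)) x) \<longlonglongrightarrow> brenier_map \<xi> x"
    "(\<lambda>n. wdist (\<mu> (k n)) \<xi>) \<longlonglongrightarrow> 0"
    using ball_measures_wdist_compact[where \<mu> = \<mu> and M = M] \<mu> by blast
  have "(\<lambda>n. wdist (\<mu> (k n)) \<nu>) \<longlonglongrightarrow> 0" using LIMSEQ_subseq_LIMSEQ[OF lim k(1)] by (simp add: o_def)
  from tendsto_add[OF this k(4)] have l: "(\<lambda>n. wdist (\<mu> (k n)) \<nu> + wdist (\<mu> (k n)) \<xi>) \<longlonglongrightarrow> 0" by simp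
  have "wdist \<nu> \<xi> \<le> wdist (\<mu> (k n)) \<nu> + wdist (\<mu> (k n)) \<xi>" for n
    using wdist_triangle[OF \<nu> \<mu> k(2), of "k n"] by (simp add: wdist_sym)
  then have "wdist \<nu> \<xi> \<le> 0" by (intro LIMSEQ_le_const[OF l]) auto
  then have "\<nu> = \<xi>" using wdist_nonneg[OF \<nu> k(2)] wdist_eq_0[OF \<nu> k(2)] by simp
  then show ?thesis using that k by blast
qed

end

section \<open>The weak formulation\<close>

text \<open>The complement of the support is a union of null open sets, and Lindelof reduces it to
  countably many.\<close>

lemma msupport_imp_ball_measures:
  assumes \<mu>: "\<mu> \<in> prob_measures" and supp: "msupport \<mu> \<subseteq> cball 0 R"
  shows "\<mu> \<in> ball_measures R"
proof -
  define \<B> where "\<B> = {U :: (real ^ 3) set. open U \<and> emeasure \<mu> U = 0}"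
  have "\<And>U. U \<in> \<B> \<Longrightarrow> open U" by (simp add: \<B>_def)
  then obtain \<C> where \<C>: "\<C> \<subseteq> \<B>" "countable \<C>" "\<Union>\<C> = \<Union>\<B>" using Lindelof by metis
  have "AE y in \<mu>. y \<notin> U" if "U \<in> \<C>" for U
  proof (rule AE_not_in)
    have "open U" "emeasure \<mu> U = 0" using that \<C>(1) by (auto simp: \<B>_def)
    then show "U \<in> null_sets \<mu>" using prob_measuresD(2)[OF \<mu>] by (auto simp: null_sets_def)
  qed
  then have "AE y in \<mu>. \<forall>U\<in>\<C>. y \<notin> U" using \<C>(2) by (simp add: AE_ball_countable)
  then have "AE y in \<mu>. y \<in> cball 0 R"
  proof eventually_elim
    fix y assume "\<forall>U\<in>\<C>. y \<notin> U"
    then have "y \<notin> \<Union>\<B>" using \<C>(3) by blast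
    then have "y \<in> msupport \<mu>" by (auto simp: msupport_def \<B>_def zero_less_iff_neq_zero)
    then show "y \<in> cball 0 R" using supp by blast
  qed
  then show ?thesis using \<mu> by (simp add: ball_measures_def)
qed

lemma ball_measures_msupport:
  assumes \<mu>: "\<mu> \<in> ball_measures M"
  shows "msupport \<mu> \<subseteq> cball 0 M"
proof
  fix x assume x: "x \<in> msupport \<mu>"
  show "x \<in> cball 0 M"
  proof (rule ccontr)
    assume "x \<notin> cball 0 M"
    moreover have "open (- cball (0 :: real ^ 3) M)" by (simp add: open_Compl)
    ultimately have "emeasure \<mu> (- cball 0 M) > 0" using x by (auto simp: msupport_def)
    moreover have "emeasure \<mu> (- cball 0 M) = 0"
    proof -
      have "- cball 0 M \<in> sets \<mu>" using ball_measuresD(4)[OF \<mu>] by auto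
      moreover have "AE y in \<mu>. y \<notin> - cball 0 M" using ball_measuresD(2)[OF \<mu>] by eventually_elim simp
      ultimately have "- cball 0 M \<in> null_sets \<mu>" by (simp add: AE_iff_null_sets)
      then show ?thesis by (rule null_setsD1)
    qed
    ultimately show False by simp
  qed
qed

lemma perp_linear: "linear perp"
  by (rule linearI) (simp_all add: perp_def vec_eq_iff forall_3 vector_3)

lemma perp_bounded_linear: "bounded_linear perp"
  using perp_linear by (simp add: linear_conv_bounded_linear)

lemmas perp_continuous[continuous_intros] = bounded_linear.continuous_on[OF perp_bounded_linear]

lemma perp_diff: "perp (x - y) = perp x - perp y"
  by (rule linear_diff[OF perp_linear])

lemma inner_perp_self: "y \<bullet> perp y = 0"
  by (simp add: perp_def inner_vec_def sum_3 vector_3)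

lemma norm_perp_le: "norm (perp x) \<le> norm x"
proof -
  have "(norm (perp x))\<^sup>2 \<le> (norm x)\<^sup>2"
    unfolding power2_norm_eq_inner by (simp add: perp_def inner_vec_def sum_3 vector_3)
  then show ?thesis by (rule power2_le_imp_le) simp
qed

section \<open>Partial derivatives of test functions\<close>

text \<open>Reading both partial derivatives off the full derivative gives joint continuity from
  \<open>C_k\<close>. The \<open>deriv\<close> and \<open>grad\<close> of the weak formulation are
  matched to them afterwards.\<close>

definition time_derivative :: "(real \<times> (real ^ 3) \<Rightarrow> real) \<Rightarrow> real \<times> (real ^ 3) \<Rightarrow> real"
  where "time_derivative \<phi> z = frechet_derivative \<phi> (at z) (1, 0)"

definition space_gradient :: "(real \<times> (real ^ 3) \<Rightarrow> real) \<Rightarrow> real \<times> (real ^ 3) \<Rightarrow> real ^ 3"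
  where "space_gradient \<phi> z = (\<Sum>b\<in>Basis. frechet_derivative \<phi> (at z) (0, b) *\<^sub>R b)"

lemma partial_continuous:
  assumes "C_k (Suc 0) \<phi>"
  shows "continuous_on UNIV (time_derivative \<phi>)" "continuous_on UNIV (space_gradient \<phi>)"
proof -
  have "(1, 0) \<in> (Basis :: (real \<times> (real ^ 3)) set)" by (simp add: Basis_prod_def)
  then show "continuous_on UNIV (time_derivative \<phi>)"
    unfolding time_derivative_def[abs_def] using C_k_SucD(2)[OF assms] by simp
  have "(0, b) \<in> (Basis :: (real \<times> (real ^ 3)) set)" if "b \<in> Basis" for b using that by (auto simp: Basis_prod_def)
  then show "continuous_on UNIV (space_gradient \<phi>)"
    unfolding space_gradient_def[abs_def] using C_k_SucD(2)[OF assms] by (intro continuous_intros) simp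
qed

lemma partial_has_derivative:
  assumes "C_k (Suc 0) \<phi>"
  shows "(\<phi> has_derivative (\<lambda>(s, h). s * time_derivative \<phi> z + h \<bullet> space_gradient \<phi> z)) (at z)"
proof -
  note D = C_k_SucD(1)[OF assms, of z]
  then have lin: "linear (frechet_derivative \<phi> (at z))" by (rule has_derivative_linear)
  have "frechet_derivative \<phi> (at z) (s, h) = s * time_derivative \<phi> z + h \<bullet> space_gradient \<phi> z" for s h
  proof -
    have "h = (\<Sum>b\<in>Basis. (h \<bullet> b) *\<^sub>R b)" by (simp add: euclidean_representation)
    then have "(s, h) = s *\<^sub>R (1, 0) + (\<Sum>b\<in>Basis. (h \<bullet> b) *\<^sub>R (0, b))"
      by (auto simp: prod_eq_iff fst_sum snd_sum)
    then have "frechet_derivative \<phi> (at z) (s, h)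
      = frechet_derivative \<phi> (at z) (s *\<^sub>R (1, 0) + (\<Sum>b\<in>Basis. (h \<bullet> b) *\<^sub>R (0, b)))" by simp
    also have "\<dots> = s * time_derivative \<phi> z + (\<Sum>b\<in>Basis. (h \<bullet> b) * frechet_derivative \<phi> (at z) (0, b))"
      using lin by (simp only: linear_add linear_sum linear_cmul time_derivative_def real_scaleR_def)
    also have "(\<Sum>b\<in>Basis. (h \<bullet> b) * frechet_derivative \<phi> (at z) (0, b)) = h \<bullet> space_gradient \<phi> z"
      by (simp add: space_gradient_def inner_sum_right mult.commute)
    finally show ?thesis .
  qed
  then have "frechet_derivative \<phi> (at z) = (\<lambda>(s, h). s * time_derivative \<phi> z + h \<bullet> space_gradient \<phi> z)" by auto
  then show ?thesis using D by simp
qed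

lemma time_derivative_eq:
  assumes "C_k (Suc 0) \<phi>"
  shows "((\<lambda>s. \<phi> (s, x)) has_real_derivative time_derivative \<phi> (t, x)) (at t)"
    "deriv (\<lambda>s. \<phi> (s, x)) t = time_derivative \<phi> (t, x)"
proof -
  have "((\<lambda>s. (s, x)) has_derivative (\<lambda>s. (s, 0))) (at t)" by (auto intro!: derivative_eq_intros)
  from has_derivative_compose[OF this partial_has_derivative[OF assms]]
  show *: "((\<lambda>s. \<phi> (s, x)) has_real_derivative time_derivative \<phi> (t, x)) (at t)"
    by (simp add: has_field_derivative_def mult.commute[of _ "time_derivative \<phi> (t, x)"])
  then show "deriv (\<lambda>s. \<phi> (s, x)) t = time_derivative \<phi> (t, x)" by (rule DERIV_imp_deriv)
qed

lemma space_gradient_eq: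
  assumes "C_k (Suc 0) \<phi>"
  shows "GDERIV (\<lambda>y. \<phi> (t, y)) x :> space_gradient \<phi> (t, x)" "grad (\<lambda>y. \<phi> (t, y)) x = space_gradient \<phi> (t, x)"
proof -
  have "((\<lambda>y. (t, y)) has_derivative (\<lambda>h. (0, h))) (at x)" by (auto intro!: derivative_eq_intros)
  from has_derivative_compose[OF this partial_has_derivative[OF assms]]
  show "GDERIV (\<lambda>y. \<phi> (t, y)) x :> space_gradient \<phi> (t, x)" by (simp add: gderiv_def)
  then show "grad (\<lambda>y. \<phi> (t, y)) x = space_gradient \<phi> (t, x)" by (rule grad_eqI)
qed

context source_domain
begin

section \<open>Integrals against the optimal plan\<close>

text \<open>Integration against the image of the uniform measure under
  \<open>x \<mapsto> (x, brenier_map \<mu> x)\<close>. Integrals against \<open>\<mu>\<close> are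
  the case where \<open>G\<close> ignores \<open>x\<close>, so one continuity result covers every
  term of the weak formulation.\<close>

definition plan_integral :: "(real \<Rightarrow> real ^ 3 \<Rightarrow> real ^ 3 \<Rightarrow> real) \<Rightarrow> real \<Rightarrow> (real ^ 3) measure \<Rightarrow> real"
  where "plan_integral G t \<mu> = (\<integral>x. G t x (brenier_map \<mu> x) \<partial>vol)"

abbreviation "jointly_continuous G \<equiv> continuous_on UNIV (\<lambda>(t :: real, x :: real ^ 3, y :: real ^ 3). G t x y :: real)"

lemma jointly_continuous_tendsto:
  assumes "jointly_continuous G" "(t \<longlongrightarrow> t') F" "(x \<longlongrightarrow> x') F" "(y \<longlongrightarrow> y') F"
  shows "((\<lambda>n. G (t n) (x n) (y n)) \<longlongrightarrow> G t' x' y') F"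
proof -
  have "isCont (\<lambda>(t, x, y). G t x y) (t', x', y')" using assms(1) by (simp add: continuous_on_eq_continuous_at)
  then have "((\<lambda>n. (\<lambda>(t, x, y). G t x y) (t n, x n, y n)) \<longlongrightarrow> (\<lambda>(t, x, y). G t x y) (t', x', y')) F"
    by (rule isCont_tendsto_compose) (intro tendsto_Pair assms)
  then show ?thesis by simp
qed

lemma jointly_continuous_bound:
  assumes "jointly_continuous G"
  shows "\<exists>B\<ge>0. \<forall>t x y. \<bar>t\<bar> \<le> \<tau> \<longrightarrow> norm x \<le> r \<longrightarrow> norm y \<le> M \<longrightarrow> \<bar>G t x y\<bar> \<le> B"
proof -
  have "compact ({-\<tau>..\<tau>} \<times> cball (0 :: real ^ 3) r \<times> cball (0 :: real ^ 3) M)"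
    by (intro compact_Times compact_Icc compact_cball)
  from continuous_on_compact_bounded[OF this continuous_on_subset[OF assms subset_UNIV]]
  obtain B where B: "\<forall>z\<in>{-\<tau>..\<tau>} \<times> cball 0 r \<times> cball 0 M. \<bar>(\<lambda>(t, x, y). G t x y) z\<bar> \<le> B"
    by blast
  show ?thesis
  proof (intro exI[of _ "max 0 B"] conjI allI impI)
    fix t and x y :: "real ^ 3" assume "\<bar>t\<bar> \<le> \<tau>" "norm x \<le> r" "norm y \<le> M"
    then have "(t, x, y) \<in> {-\<tau>..\<tau>} \<times> cball 0 r \<times> cball 0 M" by auto
    then have "\<bar>(\<lambda>(t, x, y). G t x y) (t, x, y)\<bar> \<le> B" using B by blast
    then show "\<bar>G t x y\<bar> \<le> max 0 B" by simp
  qed simp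
qed

lemma jointly_continuous_measurable:
  assumes G: "jointly_continuous G" and T: "T \<in> borel_measurable vol"
  shows "(\<lambda>x. G t x (T x)) \<in> borel_measurable vol"
proof -
  have "(\<lambda>(t, x, y). G t x y) \<in> borel_measurable borel" by (rule borel_measurable_continuous_onI[OF G])
  then have "(\<lambda>(t, x, y). G t x y) \<in> borel_measurable (borel \<Otimes>\<^sub>M borel \<Otimes>\<^sub>M borel)"
    by (simp only: borel_prod)
  moreover have "(\<lambda>x. (t, x, T x)) \<in> vol \<rightarrow>\<^sub>M borel \<Otimes>\<^sub>M borel \<Otimes>\<^sub>M borel"
    by (intro measurable_Pair measurable_const T borel_vol[of "\<lambda>x. x"]) simp_all
  ultimately have "(\<lambda>x. (\<lambda>(t, x, y). G t x y) (t, x, T x)) \<in> borel_measurable vol"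
    by (rule measurable_compose[rotated])
  then show ?thesis by simp
qed

lemma plan_integrable:
  assumes G: "jointly_continuous G" and \<mu>: "\<mu> \<in> ball_measures M"
  shows "integrable vol (\<lambda>x. G t x (brenier_map \<mu> x))"
proof -
  obtain B where B: "\<forall>s x y. \<bar>s\<bar> \<le> \<bar>t\<bar> \<longrightarrow> norm x \<le> r \<longrightarrow> norm y \<le> M \<longrightarrow> \<bar>G s x y\<bar> \<le> B"
    using jointly_continuous_bound[OF G, of "\<bar>t\<bar>" M] by blast
  show ?thesis
  proof (rule vol_integrable[OF jointly_continuous_measurable[OF G brenier_map(1)[OF \<mu>]]])
    show "AE x in vol. \<bar>G t x (brenier_map \<mu> x)\<bar> \<le> B"
      using brenier_map(3)[OF \<mu>] AE_vol_le by eventually_elim (use B in auto)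
  qed
qed

lemma plan_integral_bound:
  assumes G: "jointly_continuous G"
  shows "\<exists>B\<ge>0. \<forall>t. \<forall>\<mu>\<in>ball_measures M. \<bar>t\<bar> \<le> \<tau> \<longrightarrow> \<bar>plan_integral G t \<mu>\<bar> \<le> B"
proof -
  obtain B where B: "B \<ge> 0" "\<forall>s x y. \<bar>s\<bar> \<le> \<tau> \<longrightarrow> norm x \<le> r \<longrightarrow> norm y \<le> M \<longrightarrow> \<bar>G s x y\<bar> \<le> B"
    using jointly_continuous_bound[OF G, of \<tau> M] by blast
  show ?thesis
  proof (intro exI[of _ B] conjI B(1) allI ballI impI)
    fix t \<mu> assume \<mu>: "\<mu> \<in> ball_measures M" and t: "\<bar>t\<bar> \<le> \<tau>"
    have "\<bar>plan_integral G t \<mu>\<bar> \<le> (\<integral>x. \<bar>G t x (brenier_map \<mu> x)\<bar> \<partial>vol)"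
      unfolding plan_integral_def by (rule integral_abs_bound)
    also have "\<dots> \<le> (\<integral>x. B \<partial>vol)"
    proof (rule integral_mono_AE)
      show "AE x in vol. \<bar>G t x (brenier_map \<mu> x)\<bar> \<le> B"
        using brenier_map(3)[OF \<mu>] AE_vol_le by eventually_elim (use B t in auto)
    qed (use plan_integrable[OF G \<mu>] in auto)
    also have "\<dots> = B" using vol.prob_space by simp
    finally show "\<bar>plan_integral G t \<mu>\<bar> \<le> B" .
  qed
qed

text \<open>Almost everywhere convergence of the maps is available along subsequences, always with
  the same limit, so dominated convergence and \<open>tendsto_subseqI\<close> settle the whole
  sequence. The time may vary with \<open>n\<close>, as grid times of the Euler scheme do.\<close>

lemma plan_integral_tendsto:
  assumes G: "jointly_continuous G" and t: "t \<longlonglongrightarrow> t'"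
    and \<mu>: "\<And>n. \<mu> n \<in> ball_measures M" and \<nu>: "\<nu> \<in> ball_measures M" and lim: "(\<lambda>n. wdist (\<mu> n) \<nu>) \<longlonglongrightarrow> 0"
  shows "(\<lambda>n. plan_integral G (t n) (\<mu> n)) \<longlonglongrightarrow> plan_integral G t' \<nu>"
proof (rule tendsto_subseqI)
  fix a :: "nat \<Rightarrow> nat" assume a: "strict_mono a"
  have "(\<lambda>n. wdist (\<mu> (a n)) \<nu>) \<longlonglongrightarrow> 0" using LIMSEQ_subseq_LIMSEQ[OF lim a] by (simp add: o_def)
  from wdist_imp_brenier_map_AE[OF \<mu> \<nu> this]
  obtain k where k: "strict_mono (k :: nat \<Rightarrow> nat)"
    "AE x in vol. (\<lambda>n. brenier_map (\<mu> (a (k n))) x) \<longlonglongrightarrow> brenier_map \<nu> x"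
    by blast
  have ak: "strict_mono (\<lambda>n. a (k n))" using strict_mono_o[OF a k(1)] by (simp add: o_def)
  have tl: "(\<lambda>n. t (a (k n))) \<longlonglongrightarrow> t'" using LIMSEQ_subseq_LIMSEQ[OF t ak] by (simp add: o_def)
  obtain \<tau> where \<tau>: "\<And>n. \<bar>t n\<bar> \<le> \<tau>" using convergent_imp_Bseq[OF convergentI[OF t]] by (auto simp: Bseq_def)
  obtain B where B: "\<forall>s x y. \<bar>s\<bar> \<le> \<tau> \<longrightarrow> norm x \<le> r \<longrightarrow> norm y \<le> M \<longrightarrow> \<bar>G s x y\<bar> \<le> B"
    using jointly_continuous_bound[OF G, of \<tau> M] by blast
  have "(\<lambda>n. plan_integral G (t (a (k n))) (\<mu> (a (k n)))) \<longlonglongrightarrow> plan_integral G t' \<nu>"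
    unfolding plan_integral_def
  proof (rule integral_dominated_convergence[where w = "\<lambda>_. B"])
    show "AE x in vol. (\<lambda>n. G (t (a (k n))) x (brenier_map (\<mu> (a (k n))) x)) \<longlonglongrightarrow> G t' x (brenier_map \<nu> x)"
      using k(2) by eventually_elim (intro jointly_continuous_tendsto[OF G] tl tendsto_const)
    show "AE x in vol. norm (G (t (a (k n))) x (brenier_map (\<mu> (a (k n))) x)) \<le> B" for n
      using brenier_map(3)[OF \<mu>[of "a (k n)"]] AE_vol_le by eventually_elim (use B \<tau> in auto)
  qed (use plan_integrable[OF G \<nu>] plan_integrable[OF G \<mu>] in auto)
  then show "\<exists>s. strict_mono (s :: nat \<Rightarrow> nat) \<and> (\<lambda>n. plan_integral G (t (a (s n))) (\<mu> (a (s n)))) \<longlonglongrightarrow> plan_integral G t' \<nu>"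
    using k(1) by blast
qed

text \<open>The rate of change of \<open>\<phi>\<close> along the particle with label
  \<open>x\<close> and position \<open>y\<close>, moving with velocity
  \<open>perp (x - y)\<close>.\<close>

definition flux :: "(real \<times> (real ^ 3) \<Rightarrow> real) \<Rightarrow> real \<Rightarrow> real ^ 3 \<Rightarrow> real ^ 3 \<Rightarrow> real"
  where "flux \<phi> t x y = time_derivative \<phi> (t, y) + space_gradient \<phi> (t, y) \<bullet> perp (x - y)"

lemma continuous_on_snd_pair:
  assumes "continuous_on UNIV g" shows "continuous_on UNIV (\<lambda>(t :: real, x :: real ^ 3, y :: real ^ 3). g (t, y))"
proof -
  have "continuous_on UNIV (\<lambda>z :: real \<times> (real ^ 3) \<times> (real ^ 3). g (fst z, snd (snd z)))"
    by (rule continuous_on_compose2[OF assms]) (auto intro!: continuous_intros)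
  then show ?thesis by (simp add: case_prod_beta')
qed

lemma flux_parts_continuous:
  assumes \<phi>: "C_k (Suc 0) \<phi>"
  shows "jointly_continuous (\<lambda>t x y. time_derivative \<phi> (t, y))"
    "jointly_continuous (\<lambda>t x y. space_gradient \<phi> (t, y) \<bullet> perp x)"
    "jointly_continuous (\<lambda>t x y. space_gradient \<phi> (t, y) \<bullet> perp y)"
    "jointly_continuous (flux \<phi>)"
proof -
  note a = continuous_on_snd_pair[OF partial_continuous(1)[OF \<phi>]]
    and b = continuous_on_snd_pair[OF partial_continuous(2)[OF \<phi>]]
  show "jointly_continuous (\<lambda>t x y. time_derivative \<phi> (t, y))" by (rule a)
  show "jointly_continuous (\<lambda>t x y. space_gradient \<phi> (t, y) \<bullet> perp x)"
    using b unfolding case_prod_beta' by (intro continuous_intros)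
  show "jointly_continuous (\<lambda>t x y. space_gradient \<phi> (t, y) \<bullet> perp y)"
    using b unfolding case_prod_beta' by (intro continuous_intros)
  show "jointly_continuous (flux \<phi>)"
    using a b unfolding flux_def[abs_def] case_prod_beta' by (intro continuous_intros)
qed

section \<open>Weakly continuous curves of measures\<close>

text \<open>Sequential continuity together with a single ball for the whole interval; the ball
  supplies the domination needed for limits under the integral.\<close>

definition wcurve :: "real \<Rightarrow> real \<Rightarrow> (real \<Rightarrow> (real ^ 3) measure) \<Rightarrow> bool"
  where "wcurve M T \<rho> \<longleftrightarrow> (\<forall>t\<in>{0..T}. \<rho> t \<in> ball_measures M) \<and>
    (\<forall>s t. (\<forall>n. s n \<in> {0..T}) \<longrightarrow> t \<in> {0..T} \<longrightarrow> s \<longlonglongrightarrow> t \<longrightarrow> (\<lambda>n. wdist (\<rho> (s n)) (\<rho> t)) \<longlonglongrightarrow> 0)"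

lemma wcurveD: "wcurve M T \<rho> \<Longrightarrow> t \<in> {0..T} \<Longrightarrow> \<rho> t \<in> ball_measures M"
  by (simp add: wcurve_def)

lemma wcurve_plan_continuous:
  assumes \<rho>: "wcurve M T \<rho>" and G: "jointly_continuous G"
  shows "continuous_on {0..T} (\<lambda>t. plan_integral G t (\<rho> t))"
  unfolding continuous_on_sequentially
proof (intro allI ballI impI)
  fix s t assume t: "t \<in> {0..T}" and s: "(\<forall>n. s n \<in> {0..T}) \<and> s \<longlonglongrightarrow> t"
  then have "(\<lambda>n. plan_integral G (s n) (\<rho> (s n))) \<longlonglongrightarrow> plan_integral G t (\<rho> t)"
    using \<rho> by (intro plan_integral_tendsto[OF G, where M = M]) (auto simp: wcurve_def)
  then show "((\<lambda>t. plan_integral G t (\<rho> t)) \<circ> s) \<longlonglongrightarrow> plan_integral G t (\<rho> t)" by (simp add: o_def)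
qed

lemma wcurve_integral_continuous:
  fixes f :: "real \<times> (real ^ 3) \<Rightarrow> real"
  assumes \<rho>: "wcurve M T \<rho>" and f: "continuous_on UNIV f"
  shows "continuous_on {0..T} (\<lambda>t. \<integral>y. f (t, y) \<partial>\<rho> t)"
proof -
  have "continuous_on {0..T} (\<lambda>t. plan_integral (\<lambda>t x y. f (t, y)) t (\<rho> t))"
    by (rule wcurve_plan_continuous[OF \<rho> continuous_on_snd_pair[OF f]])
  moreover have "(\<integral>y. f (t, y) \<partial>\<rho> t) = plan_integral (\<lambda>t x y. f (t, y)) t (\<rho> t)" if "t \<in> {0..T}" for t
    unfolding plan_integral_def
    by (intro brenier_map_integral[OF wcurveD[OF \<rho> that]] borel_measurable_continuous_onI
        continuous_on_compose2[OF f]) (auto intro!: continuous_intros)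
  ultimately show ?thesis
    by (subst continuous_on_cong[OF refl, where g = "\<lambda>t. plan_integral (\<lambda>t x y. f (t, y)) t (\<rho> t)"]) auto
qed

lemma wcurve_imp_weak_star:
  assumes \<rho>: "wcurve M T \<rho>"
  shows "continuous_map (top_of_set {0..T}) weak_star \<rho>"
  unfolding weak_star_def
proof (rule continuous_map_pullback')
  show "topspace (top_of_set {0..T}) \<subseteq> \<rho> -` prob_measures"
    using ball_measuresD(1)[OF wcurveD[OF \<rho>]] by auto
  have "continuous_on {0..T} (\<lambda>t. \<integral>x. f x \<partial>\<rho> t)" if f: "f \<in> C0_functions" for f
  proof -
    have "continuous_on UNIV (\<lambda>z :: real \<times> (real ^ 3). f (snd z))"
      using f by (auto simp: C0_functions_def intro!: continuous_on_compose2[of UNIV f] continuous_intros)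
    from wcurve_integral_continuous[OF \<rho> this] show ?thesis by simp
  qed
  then show "continuous_map (top_of_set {0..T}) (powertop_real C0_functions) ((\<lambda>\<mu>. \<lambda>f\<in>C0_functions. \<integral>x. f x \<partial>\<mu>) \<circ> \<rho>)"
    by (auto simp: continuous_map_componentwise)
qed

lemma weak_star_integral_continuous:
  assumes "continuous_map (top_of_set {0..T}) weak_star \<rho>" and f: "f \<in> C0_functions"
  shows "continuous_on {0..T} (\<lambda>t. \<integral>x. f x \<partial>\<rho> t)"
proof -
  have "continuous_map weak_star (powertop_real C0_functions) (id \<circ> (\<lambda>\<mu>. \<lambda>f\<in>C0_functions. \<integral>x. f x \<partial>\<mu>))"
    unfolding weak_star_def by (rule continuous_map_pullback) auto
  then have "continuous_map (top_of_set {0..T}) (powertop_real C0_functions) (\<lambda>t. \<lambda>f\<in>C0_functions. \<integral>x. f x \<partial>\<rho> t)"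
    using assms(1) by (auto dest: continuous_map_compose simp: o_def)
  then show ?thesis using f by (auto simp: continuous_map_componentwise)
qed

text \<open>Weak-* continuity tests only \<open>C0_functions\<close>; the common ball upgrades it to
  continuity for \<open>wdist\<close>.\<close>

lemma weak_star_imp_wcurve:
  assumes c: "continuous_map (top_of_set {0..T}) weak_star \<rho>" and b: "\<And>t. t \<in> {0..T} \<Longrightarrow> \<rho> t \<in> ball_measures M"
  shows "wcurve M T \<rho>"
  unfolding wcurve_def
proof (intro conjI allI impI ballI b)
  fix s t assume s: "\<forall>n. s n \<in> {0..T}" "s \<longlonglongrightarrow> t" and t: "t \<in> {0..T}"
  show "(\<lambda>n. wdist (\<rho> (s n)) (\<rho> t)) \<longlonglongrightarrow> 0"
  proof (rule ball_measures_C0_imp_wdist(2))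
    show "\<rho> (s n) \<in> ball_measures M" for n using b s by blast
    show "\<rho> t \<in> prob_measures" using b[OF t] by (rule ball_measuresD)
    fix f assume "f \<in> C0_functions"
    from weak_star_integral_continuous[OF c this] show "(\<lambda>n. \<integral>x. f x \<partial>\<rho> (s n)) \<longlonglongrightarrow> (\<integral>x. f x \<partial>\<rho> t)"
      using s t unfolding continuous_on_sequentially by (auto simp: o_def)
  qed
qed

text \<open>Combining the three time integrals requires each to be integrable, which follows from
  continuity of the plan integrals in \<open>t\<close>. The formulation becomes a single balance of
  \<open>flux\<close>.\<close>

lemma weak_form_iff:
  assumes \<rho>: "wcurve M T \<rho>" and \<phi>: "\<phi> \<in> test_functions"
  shows "(LINT t:{0..T}|lebesgue. \<integral>x. deriv (\<lambda>s. \<phi> (s, x)) t \<partial>\<rho> t)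
      + (LINT t:{0..T}|lebesgue. LINT x:\<Omega>|lebesgue. grad (\<lambda>y. \<phi> (t, y)) (grad (brenier_potential \<Omega> (\<rho> t)) x) \<bullet> perp x)
      - (LINT t:{0..T}|lebesgue. \<integral>x. grad (\<lambda>y. \<phi> (t, y)) x \<bullet> perp x \<partial>\<rho> t)
    = (\<integral>t. plan_integral (flux \<phi>) t (\<rho> t) \<partial>lebesgue_on {0..T})"
proof -
  have c: "C_k (Suc 0) \<phi>" using \<phi> unfolding test_functions_def by blast
  note G = flux_parts_continuous[OF c]
  define A where "A t = plan_integral (\<lambda>t x y. time_derivative \<phi> (t, y)) t (\<rho> t)" for t
  define B where "B t = plan_integral (\<lambda>t x y. space_gradient \<phi> (t, y) \<bullet> perp x) t (\<rho> t)" for t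
  define D where "D t = plan_integral (\<lambda>t x y. space_gradient \<phi> (t, y) \<bullet> perp y) t (\<rho> t)" for t
  have iA: "integrable (lebesgue_on {0..T}) A" and iB: "integrable (lebesgue_on {0..T}) B" and iD: "integrable (lebesgue_on {0..T}) D"
    unfolding A_def[abs_def] B_def[abs_def] D_def[abs_def]
    by (intro continuous_imp_integrable_real wcurve_plan_continuous[OF \<rho>] G)+
  have set_int: "(LINT t:{0..T}|lebesgue. f t) = (\<integral>t. g t \<partial>lebesgue_on {0..T})"
    if "\<And>t. t \<in> {0..T} \<Longrightarrow> f t = g t" for f g :: "real \<Rightarrow> real"
  proof -
    have "(LINT t:{0..T}|lebesgue. f t) = (\<integral>t. f t \<partial>lebesgue_on {0..T})"
      by (simp add: set_lebesgue_integral_def integral_restrict_space)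
    also have "\<dots> = (\<integral>t. g t \<partial>lebesgue_on {0..T})" using that by (intro Bochner_Integration.integral_cong) auto
    finally show ?thesis .
  qed
  have cy: "continuous_on UNIV (\<lambda>y. (t, y))" for t :: real by (intro continuous_intros)
  have 1: "(LINT t:{0..T}|lebesgue. \<integral>x. deriv (\<lambda>s. \<phi> (s, x)) t \<partial>\<rho> t) = (\<integral>t. A t \<partial>lebesgue_on {0..T})"
  proof (rule set_int)
    fix t assume t: "t \<in> {0..T}"
    have "(\<lambda>y. time_derivative \<phi> (t, y)) \<in> borel_measurable borel"
      by (intro borel_measurable_continuous_onI continuous_on_compose2[OF partial_continuous(1)[OF c] cy]) auto
    from brenier_map_integral[OF wcurveD[OF \<rho> t] this]
    show "(\<integral>x. deriv (\<lambda>s. \<phi> (s, x)) t \<partial>\<rho> t) = A t"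
      by (simp add: A_def plan_integral_def time_derivative_eq(2)[OF c])
  qed
  have 2: "(LINT t:{0..T}|lebesgue. LINT x:\<Omega>|lebesgue. grad (\<lambda>y. \<phi> (t, y)) (grad (brenier_potential \<Omega> (\<rho> t)) x) \<bullet> perp x)
      = (\<integral>t. B t \<partial>lebesgue_on {0..T})"
    by (rule set_int) (simp add: B_def plan_integral_def space_gradient_eq(2)[OF c] set_integral_domain brenier_map_def)
  have 3: "(LINT t:{0..T}|lebesgue. \<integral>x. grad (\<lambda>y. \<phi> (t, y)) x \<bullet> perp x \<partial>\<rho> t) = (\<integral>t. D t \<partial>lebesgue_on {0..T})"
  proof (rule set_int)
    fix t assume t: "t \<in> {0..T}"
    have "(\<lambda>y. space_gradient \<phi> (t, y) \<bullet> perp y) \<in> borel_measurable borel"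
      by (intro borel_measurable_continuous_onI continuous_intros continuous_on_compose2[OF partial_continuous(2)[OF c] cy]) auto
    from brenier_map_integral[OF wcurveD[OF \<rho> t] this]
    show "(\<integral>x. grad (\<lambda>y. \<phi> (t, y)) x \<bullet> perp x \<partial>\<rho> t) = D t"
      by (simp add: D_def plan_integral_def space_gradient_eq(2)[OF c])
  qed
  have "A t + B t - D t = plan_integral (flux \<phi>) t (\<rho> t)" if "t \<in> {0..T}" for t
  proof -
    note i = plan_integrable[OF G(1) wcurveD[OF \<rho> that], of t] plan_integrable[OF G(2) wcurveD[OF \<rho> that], of t]
      plan_integrable[OF G(3) wcurveD[OF \<rho> that], of t]
    show ?thesis
      using i unfolding A_def B_def D_def plan_integral_def flux_def
      by (simp add: perp_diff inner_diff_right algebra_simps)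
  qed
  then have "(\<integral>t. plan_integral (flux \<phi>) t (\<rho> t) \<partial>lebesgue_on {0..T}) = (\<integral>t. A t + B t - D t \<partial>lebesgue_on {0..T})"
    by (intro Bochner_Integration.integral_cong) auto
  also have "\<dots> = (\<integral>t. A t \<partial>lebesgue_on {0..T}) + (\<integral>t. B t \<partial>lebesgue_on {0..T}) - (\<integral>t. D t \<partial>lebesgue_on {0..T})"
    using iA iB iD by simp
  finally show ?thesis unfolding 1 2 3 by simp
qed

section \<open>Compactness of families of curves\<close>

lemma ball_measures_seq_compact:
  assumes "\<And>n. \<mu> n \<in> ball_measures M"
  shows "\<exists>k \<nu>. strict_mono (k :: nat \<Rightarrow> nat) \<and> \<nu> \<in> ball_measures M \<and> (\<lambda>n. wdist (\<mu> (k n)) \<nu>) \<longlonglongrightarrow> 0"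
  by (rule ball_measures_wdist_compact[of \<mu> M, OF assms]) blast

text \<open>Arzela-Ascoli on the half-line. The error \<open>e n\<close> admits curves that are
  equicontinuous only approximately, such as the step functions of the Euler scheme, and the radius
  \<open>M t\<close> varying with time lets one subsequence serve all horizons.\<close>

lemma curve_compactness:
  assumes \<nu>: "\<And>n t. 0 \<le> t \<Longrightarrow> \<nu> n t \<in> ball_measures (M t)"
    and e: "e \<longlonglongrightarrow> 0"
    and equi: "\<And>T. \<exists>C\<ge>0. \<forall>n. \<forall>s\<in>{0..T}. \<forall>t\<in>{0..T}. wdist (\<nu> n s) (\<nu> n t) \<le> C * (\<bar>s - t\<bar> + e n)"
  obtains k \<sigma> where "strict_mono (k :: nat \<Rightarrow> nat)" "\<And>t. 0 \<le> t \<Longrightarrow> \<sigma> t \<in> ball_measures (M t)"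
    "\<And>t. 0 \<le> t \<Longrightarrow> (\<lambda>n. wdist (\<nu> (k n) t) (\<sigma> t)) \<longlonglongrightarrow> 0"
proof -
  \<comment> \<open>An enumeration, with repetitions, of the nonnegative rationals.\<close>
  define q where "q i = real (fst (prod_decode i)) / real (Suc (snd (prod_decode i)))" for i
  have q0: "0 \<le> q i" for i by (simp add: q_def)
  have dense: "\<exists>i. \<bar>q i - t\<bar> < d" if t: "0 \<le> t" and d: "0 < d" for t d
  proof -
    obtain N where N: "1 / real (Suc N) < d" using nat_approx_posE[OF d] by blast
    define m where "m = nat \<lfloor>t * real (Suc N)\<rfloor>"
    have m: "real m \<le> t * real (Suc N)" "t * real (Suc N) < real m + 1"
    proof -
      have "real m = real_of_int \<lfloor>t * real (Suc N)\<rfloor>" using t by (simp add: m_def)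
      then show "real m \<le> t * real (Suc N)" "t * real (Suc N) < real m + 1"
        using floor_correct[of "t * real (Suc N)"] by linarith+
    qed
    have "real m / real (Suc N) \<le> t" using m(1) by (simp add: divide_le_eq)
    moreover have "t < real m / real (Suc N) + 1 / real (Suc N)"
      using m(2) by (simp add: less_divide_eq flip: add_divide_distrib)
    ultimately have "\<bar>real m / real (Suc N) - t\<bar> < d" using N by linarith
    then have "\<bar>q (prod_encode (m, N)) - t\<bar> < d" by (simp add: q_def)
    then show ?thesis by blast
  qed
  define P where "P i s \<longleftrightarrow> (\<exists>\<mu>\<in>ball_measures (M (q i)). (\<lambda>n. wdist (\<nu> (s n) (q i)) \<mu>) \<longlonglongrightarrow> 0)" for i and s :: "nat \<Rightarrow> nat"
  interpret subseqs P
  proof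
    fix i and s :: "nat \<Rightarrow> nat" assume "strict_mono s"
    obtain k \<mu> where "strict_mono (k :: nat \<Rightarrow> nat)" "\<mu> \<in> ball_measures (M (q i))"
      "(\<lambda>n. wdist (\<nu> (s (k n)) (q i)) \<mu>) \<longlonglongrightarrow> 0"
      using ball_measures_seq_compact[of "\<lambda>n. \<nu> (s n) (q i)", OF \<nu>[OF q0]] by blast
    then show "\<exists>r'. strict_mono r' \<and> P i (s \<circ> r')" unfolding P_def o_def by blast
  qed
  define k where "k = diagseq"
  have k: "strict_mono k" unfolding k_def by (rule subseq_diagseq)
  have "P i (k \<circ> (+) (Suc i))" for i
    unfolding k_def
  proof (rule diagseq_holds)
    fix a s n assume "strict_mono (a :: nat \<Rightarrow> nat)" "P n s"
    then obtain \<mu> where "\<mu> \<in> ball_measures (M (q n))" "(\<lambda>m. wdist (\<nu> (s m) (q n)) \<mu>) \<longlonglongrightarrow> 0"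
      unfolding P_def by blast
    moreover from this(2) have "(\<lambda>m. wdist (\<nu> (s (a m)) (q n)) \<mu>) \<longlonglongrightarrow> 0"
      using LIMSEQ_subseq_LIMSEQ[OF _ \<open>strict_mono a\<close>] by (auto simp: o_def)
    ultimately show "P n (s \<circ> a)" unfolding P_def by auto
  qed
  then have "\<exists>\<mu>. \<mu> \<in> ball_measures (M (q i)) \<and> (\<lambda>n. wdist (\<nu> (k n) (q i)) \<mu>) \<longlonglongrightarrow> 0" for i
  proof -
    have "P i (k \<circ> (+) (Suc i))" by fact
    then obtain \<mu> where "\<mu> \<in> ball_measures (M (q i))" "(\<lambda>n. wdist (\<nu> (k (n + Suc i)) (q i)) \<mu>) \<longlonglongrightarrow> 0"
      unfolding P_def by (auto simp: o_def add.commute)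
    then show ?thesis using LIMSEQ_offset[of "\<lambda>n. wdist (\<nu> (k n) (q i)) \<mu>" "Suc i"] by blast
  qed
  then obtain \<mu> where \<mu>: "\<And>i. \<mu> i \<in> ball_measures (M (q i))" "\<And>i. (\<lambda>n. wdist (\<nu> (k n) (q i)) (\<mu> i)) \<longlonglongrightarrow> 0"
    by metis
  have cauchy: "\<exists>N. \<forall>m\<ge>N. \<forall>n\<ge>N. wdist (\<nu> (k m) t) (\<nu> (k n) t) < d" if t: "0 \<le> t" and d: "0 < d" for t d
  proof -
    \<comment> \<open>The horizon \<open>t + 1\<close> leaves room for a rational to the right of
      \<open>t\<close>, at distance below \<open>\<delta> \<le> 1\<close>.\<close>
    obtain C where C: "C \<ge> 0" "\<And>n s s'. s \<in> {0..t+1} \<Longrightarrow> s' \<in> {0..t+1} \<Longrightarrow> wdist (\<nu> n s) (\<nu> n s') \<le> C * (\<bar>s - s'\<bar> + e n)"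
      using equi[of "t + 1"] by blast
    \<comment> \<open>On each side three errors of at most \<open>d / 8\<close> occur: the time
      shift, the curve error and the convergence at \<open>q i\<close>. The six add up to less than
      \<open>d\<close>.\<close>
    define \<delta> where "\<delta> = min 1 (d / (8 * (C + 1)))"
    have \<delta>: "\<delta> > 0" "\<delta> \<le> 1" "C * \<delta> \<le> d / 8"
    proof -
      show "\<delta> > 0" "\<delta> \<le> 1" using d C(1) by (auto simp: \<delta>_def)
      have "C * \<delta> \<le> (C + 1) * (d / (8 * (C + 1)))" using C(1) d by (intro mult_mono) (auto simp: \<delta>_def)
      also have "\<dots> = d / 8" using C(1) by (auto simp: field_simps)
      finally show "C * \<delta> \<le> d / 8" .
    qed
    obtain i where i: "\<bar>q i - t\<bar> < \<delta>" using dense[OF t \<delta>(1)] by blast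
    have qi: "q i \<in> {0..t+1}" using q0[of i] i \<delta>(2) by auto
    have "(\<lambda>n. C * e (k n)) \<longlonglongrightarrow> C * 0" using LIMSEQ_subseq_LIMSEQ[OF e k] by (intro tendsto_intros) (simp add: o_def)
    then have "eventually (\<lambda>n. C * e (k n) < d / 8) sequentially" using d by (intro order_tendstoD(2)[of _ "C * 0"]) auto
    moreover have "eventually (\<lambda>n. wdist (\<nu> (k n) (q i)) (\<mu> i) < d / 8) sequentially"
      using d by (intro order_tendstoD(2)[OF \<mu>(2)]) auto
    ultimately have "eventually (\<lambda>n. C * e (k n) < d / 8 \<and> wdist (\<nu> (k n) (q i)) (\<mu> i) < d / 8) sequentially"
      by (rule eventually_conj)
    then obtain N where N: "\<And>n. n \<ge> N \<Longrightarrow> C * e (k n) < d / 8 \<and> wdist (\<nu> (k n) (q i)) (\<mu> i) < d / 8"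
      by (auto simp: eventually_sequentially)
    have near: "wdist (\<nu> (k n) t) (\<mu> i) < 3 * d / 8" if "n \<ge> N" for n
    proof -
      have "wdist (\<nu> (k n) t) (\<nu> (k n) (q i)) \<le> C * (\<bar>t - q i\<bar> + e (k n))" using C(2) qi t by auto
      also have "\<dots> \<le> C * \<delta> + C * e (k n)" using i C(1) by (simp add: distrib_left mult_left_mono abs_minus_commute)
      finally have "wdist (\<nu> (k n) t) (\<nu> (k n) (q i)) < 2 * d / 8" using \<delta>(3) N[OF that] by linarith
      then show ?thesis using wdist_triangle[OF \<nu>[OF t, of "k n"] \<nu>[OF q0[of i], of "k n"] \<mu>(1)[of i]] N[OF that] by linarith
    qed
    have "wdist (\<nu> (k m) t) (\<nu> (k n) t) < d" if "m \<ge> N" "n \<ge> N" for m n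
      using wdist_triangle[OF \<nu>[OF t, of "k m"] \<mu>(1)[of i] \<nu>[OF t, of "k n"]] near[OF that(1)] near[OF that(2)] d
      by (simp add: wdist_sym[of "\<mu> i"])
    then show ?thesis by blast
  qed
  \<comment> \<open>Compactness stands in for completeness: a Cauchy sequence converges once a
    subsequence does.\<close>
  have "\<exists>\<sigma>. \<sigma> \<in> ball_measures (M t) \<and> (\<lambda>n. wdist (\<nu> (k n) t) \<sigma>) \<longlonglongrightarrow> 0" if t: "0 \<le> t" for t
  proof -
    obtain j \<sigma> where j: "strict_mono (j :: nat \<Rightarrow> nat)" "\<sigma> \<in> ball_measures (M t)" "(\<lambda>n. wdist (\<nu> (k (j n)) t) \<sigma>) \<longlonglongrightarrow> 0"
      using ball_measures_seq_compact[of "\<lambda>n. \<nu> (k n) t", OF \<nu>[OF t]] by blast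
    have "(\<lambda>n. wdist (\<nu> (k n) t) \<sigma>) \<longlonglongrightarrow> 0"
    proof (rule LIMSEQ_I)
      fix d :: real assume d: "0 < d"
      obtain N where N: "\<And>m n. m \<ge> N \<Longrightarrow> n \<ge> N \<Longrightarrow> wdist (\<nu> (k m) t) (\<nu> (k n) t) < d / 2"
        using cauchy[OF t, of "d / 2"] d by auto
      have "eventually (\<lambda>n. wdist (\<nu> (k (j n)) t) \<sigma> < d / 2) sequentially"
        using d by (intro order_tendstoD(2)[OF j(3)]) auto
      then obtain N' where N': "\<And>n. n \<ge> N' \<Longrightarrow> wdist (\<nu> (k (j n)) t) \<sigma> < d / 2" by (auto simp: eventually_sequentially)
      have "norm (wdist (\<nu> (k n) t) \<sigma> - 0) < d" if "n \<ge> N" for n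
      proof -
        define m where "m = max N N'"
        have "j m \<ge> N" using strict_mono_imp_increasing[OF j(1), of m] by (simp add: m_def)
        then have "wdist (\<nu> (k n) t) (\<nu> (k (j m)) t) < d / 2" using N that by blast
        moreover have "wdist (\<nu> (k (j m)) t) \<sigma> < d / 2" by (rule N') (simp add: m_def)
        ultimately show ?thesis
          using wdist_triangle[OF \<nu>[OF t, of "k n"] \<nu>[OF t, of "k (j m)"] j(2)] wdist_nonneg[OF \<nu>[OF t, of "k n"] j(2)]
          by simp
      qed
      then show "\<exists>N. \<forall>n\<ge>N. norm (wdist (\<nu> (k n) t) \<sigma> - 0) < d" by blast
    qed
    then show ?thesis using j(2) by blast
  qed
  then obtain \<sigma> where "\<And>t. 0 \<le> t \<Longrightarrow> \<sigma> t \<in> ball_measures (M t) \<and> (\<lambda>n. wdist (\<nu> (k n) t) (\<sigma> t)) \<longlonglongrightarrow> 0"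
    by metis
  then show ?thesis using that k by blast
qed

end

section \<open>Euler scheme\<close>

context source_domain
begin

text \<open>Carries the Lipschitz bounds of approximating curves, with their vanishing errors, over
  to the limit curve.\<close>

lemma wdist_limit_le:
  assumes "\<And>n. \<mu> n \<in> ball_measures M" "\<And>n. \<nu> n \<in> ball_measures N" "\<mu>' \<in> ball_measures M" "\<nu>' \<in> ball_measures N"
    and lim: "(\<lambda>n. wdist (\<mu> n) \<mu>') \<longlonglongrightarrow> 0" "(\<lambda>n. wdist (\<nu> n) \<nu>') \<longlonglongrightarrow> 0"
    and le: "\<And>n. wdist (\<mu> n) (\<nu> n) \<le> c n" "c \<longlonglongrightarrow> c'"
  shows "wdist \<mu>' \<nu>' \<le> c'"
proof -
  have "(\<lambda>n. wdist (\<mu> n) \<mu>' + c n + wdist (\<nu> n) \<nu>') \<longlonglongrightarrow> 0 + c' + 0" by (intro tendsto_add lim le)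
  moreover have "wdist \<mu>' \<nu>' \<le> wdist (\<mu> n) \<mu>' + c n + wdist (\<nu> n) \<nu>'" for n
    using wdist_triangle[OF assms(3,1,4), of n] wdist_triangle[OF assms(1,2,4), of n n] le(1)[of n]
    by (simp add: wdist_sym[of \<mu>'])
  ultimately show ?thesis by (intro LIMSEQ_le_const) auto
qed

lemma wcurveI_lipschitz:
  assumes b: "\<And>t. t \<in> {0..T} \<Longrightarrow> \<rho> t \<in> ball_measures M"
    and l: "\<And>s t. s \<in> {0..T} \<Longrightarrow> t \<in> {0..T} \<Longrightarrow> wdist (\<rho> s) (\<rho> t) \<le> C * \<bar>s - t\<bar>"
  shows "wcurve M T \<rho>"
  unfolding wcurve_def
proof (intro conjI allI impI ballI b)
  fix s t assume s: "\<forall>n. s n \<in> {0..T}" "s \<longlonglongrightarrow> t" and t: "t \<in> {0..T}"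
  have "(\<lambda>n. C * \<bar>s n - t\<bar>) \<longlonglongrightarrow> C * \<bar>t - t\<bar>" by (intro tendsto_intros s)
  then have c: "(\<lambda>n. C * \<bar>s n - t\<bar>) \<longlonglongrightarrow> 0" by simp
  show "(\<lambda>n. wdist (\<rho> (s n)) (\<rho> t)) \<longlonglongrightarrow> 0"
    by (rule tendsto_sandwich[OF _ _ tendsto_const c]) (use s t l wdist_nonneg[OF b b] in auto)
qed

section \<open>The scheme and its bounds\<close>

text \<open>A map on labels \<open>x\<close>, not on positions: labels sharing a position
  \<open>y\<close> may leave it in different directions.\<close>

definition drift :: "real \<Rightarrow> (real ^ 3) measure \<Rightarrow> real ^ 3 \<Rightarrow> real ^ 3"
  where "drift h \<mu> x = brenier_map \<mu> x + h *\<^sub>R perp (x - brenier_map \<mu> x)"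

primrec euler :: "real \<Rightarrow> (real ^ 3) measure \<Rightarrow> nat \<Rightarrow> (real ^ 3) measure"
  where
    "euler h \<rho>0 0 = \<rho>0"
  | "euler h \<rho>0 (Suc k) = distr vol borel (drift h (euler h \<rho>0 k))"

text \<open>Labels have norm at most \<open>r\<close> and positions at most \<open>M\<close>, so the
  speed is at most \<open>M + r\<close>; the last three claims are this bound measured in different
  ways.\<close>

lemma drift:
  assumes \<mu>: "\<mu> \<in> ball_measures M" and h: "h \<ge> 0"
  shows "drift h \<mu> \<in> borel_measurable vol"
    "AE x in vol. norm (drift h \<mu> x - brenier_map \<mu> x) \<le> h * (M + r)"
    "distr vol borel (drift h \<mu>) \<in> ball_measures (M + h * (M + r))"
    "wdist (distr vol borel (drift h \<mu>)) \<mu> \<le> h * (M + r)"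
proof -
  note b = brenier_map[OF \<mu>]
  have "perp \<in> borel_measurable borel" by (intro borel_measurable_continuous_onI perp_continuous continuous_intros)
  moreover have "(\<lambda>x. x - brenier_map \<mu> x) \<in> borel_measurable vol"
    by (intro borel_measurable_diff b(1) borel_vol[of "\<lambda>x. x"]) simp
  ultimately have "(\<lambda>x. perp (x - brenier_map \<mu> x)) \<in> borel_measurable vol" by (rule measurable_compose[rotated])
  then show m: "drift h \<mu> \<in> borel_measurable vol" unfolding drift_def[abs_def] using b(1) by simp
  have M: "M \<ge> 0" by (rule ball_measures_nonneg[OF \<mu>])
  show d: "AE x in vol. norm (drift h \<mu> x - brenier_map \<mu> x) \<le> h * (M + r)"
    using b(3) AE_vol_le
  proof eventually_elim
    fix x assume "norm (brenier_map \<mu> x) \<le> M" "norm x \<le> r"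
    then have "norm (x - brenier_map \<mu> x) \<le> M + r" using norm_triangle_ineq4[of x "brenier_map \<mu> x"] by linarith
    then have "norm (perp (x - brenier_map \<mu> x)) \<le> M + r" using norm_perp_le order_trans by blast
    then have "h * norm (perp (x - brenier_map \<mu> x)) \<le> h * (M + r)" using h by (intro mult_left_mono)
    then show "norm (drift h \<mu> x - brenier_map \<mu> x) \<le> h * (M + r)" using h by (simp add: drift_def)
  qed
  have n: "AE x in vol. norm (drift h \<mu> x) \<le> M + h * (M + r)"
    using b(3) d
  proof eventually_elim
    fix x assume "norm (brenier_map \<mu> x) \<le> M" "norm (drift h \<mu> x - brenier_map \<mu> x) \<le> h * (M + r)"
    then show "norm (drift h \<mu> x) \<le> M + h * (M + r)"
      using norm_triangle_ineq[of "brenier_map \<mu> x" "drift h \<mu> x - brenier_map \<mu> x"] by simp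
  qed
  show "distr vol borel (drift h \<mu>) \<in> ball_measures (M + h * (M + r))" by (rule distr_vol_ball[OF m n])
  have n': "AE x in vol. norm (brenier_map \<mu> x) \<le> M + h * (M + r)"
    using b(3) by eventually_elim (use h M r_nonneg in \<open>simp add: add_increasing2\<close>)
  have "wdist (distr vol borel (drift h \<mu>)) \<mu>
      \<le> (\<integral>x. norm (drift h \<mu> x - brenier_map \<mu> x) \<partial>vol)"
    using wdist_distr_le[OF m n b(1) n'] by (simp add: b(2))
  also have "\<dots> \<le> (\<integral>x. h * (M + r) \<partial>vol)"
  proof (rule integral_mono_AE)
    show "integrable vol (\<lambda>x. norm (drift h \<mu> x - brenier_map \<mu> x))"
      using d m b(1) by (intro vol_integrable[where B = "h * (M + r)"]) auto
  qed (use d in auto)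
  also have "\<dots> = h * (M + r)" using vol.prob_space by simp
  finally show "wdist (distr vol borel (drift h \<mu>)) \<mu> \<le> h * (M + r)" .
qed

text \<open>Discrete Gronwall: the radius plus \<open>r\<close> grows by the factor
  \<open>1 + h \<le> exp h\<close> in each step.\<close>

lemma euler_ball:
  assumes \<rho>0: "\<rho>0 \<in> ball_measures M0" and h: "h \<ge> 0"
  shows "euler h \<rho>0 k \<in> ball_measures ((M0 + r) * exp (real k * h) - r)"
proof (induction k)
  case 0
  show ?case using \<rho>0 by simp
next
  case (Suc k)
  define M where "M = (M0 + r) * exp (real k * h) - r"
  have M0: "M0 + r \<ge> 0" using ball_measures_nonneg[OF \<rho>0] r_nonneg by simp
  have "M + h * (M + r) = (M0 + r) * exp (real k * h) * (1 + h) - r" by (simp add: M_def algebra_simps)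
  also have "\<dots> \<le> (M0 + r) * exp (real k * h) * exp h - r"
    using M0 by (intro diff_right_mono mult_left_mono exp_ge_add_one_self mult_nonneg_nonneg) auto
  also have "\<dots> = (M0 + r) * exp (real (Suc k) * h) - r"
  proof -
    have "exp (real (Suc k) * h) = exp (real k * h) * exp h" by (simp add: algebra_simps flip: exp_add)
    then show ?thesis by (simp only: mult.assoc)
  qed
  finally have "ball_measures (M + h * (M + r)) \<subseteq> ball_measures ((M0 + r) * exp (real (Suc k) * h) - r)"
    by (rule ball_measures_mono)
  then show ?case using drift(3)[OF Suc.IH h] by (auto simp: M_def)
qed

text \<open>The solution of \<open>M' = M + r\<close> with \<open>M = M0\<close> at time
  \<open>0\<close>, the continuous counterpart of the radius recursion.\<close>

definition growth :: "real \<Rightarrow> real \<Rightarrow> real"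
  where "growth M0 t = (M0 + r) * exp t - r"

lemma growth_mono: "M0 \<ge> 0 \<Longrightarrow> s \<le> t \<Longrightarrow> growth M0 s \<le> growth M0 t"
  using r_nonneg by (simp add: growth_def mult_left_mono)

lemma euler_ball_le:
  assumes \<rho>0: "\<rho>0 \<in> ball_measures M0" and h: "h \<ge> 0" and k: "real k * h \<le> T"
  shows "euler h \<rho>0 k \<in> ball_measures (growth M0 T)"
  using euler_ball[OF \<rho>0 h, of k] ball_measures_mono[OF growth_mono[OF ball_measures_nonneg[OF \<rho>0] k]]
  by (auto simp: growth_def)

lemma euler_wdist:
  assumes \<rho>0: "\<rho>0 \<in> ball_measures M0" and h: "h \<ge> 0"
  shows "real (j + i) * h \<le> T \<Longrightarrow> wdist (euler h \<rho>0 (j + i)) (euler h \<rho>0 j) \<le> real i * h * (growth M0 T + r)"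
proof (induction i)
  case (Suc i)
  have le: "real (j + i) * h \<le> real (j + Suc i) * h" using h by (intro mult_right_mono) auto
  then have b: "real (j + i) * h \<le> T" "real j * h \<le> T"
    using Suc.prems mult_right_mono[of "real j" "real (j + Suc i)" h] h by auto
  have "wdist (euler h \<rho>0 (Suc (j + i))) (euler h \<rho>0 (j + i)) \<le> h * (growth M0 T + r)"
    using drift(4)[OF euler_ball_le[OF \<rho>0 h b(1)] h] by simp
  moreover have "wdist (euler h \<rho>0 (Suc (j + i))) (euler h \<rho>0 j)
      \<le> wdist (euler h \<rho>0 (Suc (j + i))) (euler h \<rho>0 (j + i)) + wdist (euler h \<rho>0 (j + i)) (euler h \<rho>0 j)"
  proof -
    have "euler h \<rho>0 (Suc (j + i)) \<in> ball_measures (growth M0 T)"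
      using Suc.prems by (intro euler_ball_le[OF \<rho>0 h]) simp
    then show ?thesis by (rule wdist_triangle[OF _ euler_ball_le[OF \<rho>0 h b(1)] euler_ball_le[OF \<rho>0 h b(2)]])
  qed
  ultimately show ?case using Suc.IH[OF b(1)] by (simp add: algebra_simps)
qed (simp add: wdist_self)

definition step_index :: "real \<Rightarrow> real \<Rightarrow> nat"
  where "step_index h t = nat \<lfloor>t / h\<rfloor>"

lemma step_index:
  assumes "h > 0" "t \<ge> 0"
  shows "real (step_index h t) * h \<le> t" "t < (real (step_index h t) + 1) * h"
proof -
  have "real (step_index h t) = real_of_int \<lfloor>t / h\<rfloor>" using assms by (simp add: step_index_def)
  then have "real (step_index h t) \<le> t / h" "t / h < real (step_index h t) + 1" by linarith+
  then show "real (step_index h t) * h \<le> t" "t < (real (step_index h t) + 1) * h"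
    using assms by (simp_all add: le_divide_eq divide_less_eq)
qed

text \<open>A piecewise constant curve jumps, so the Lipschitz bound holds up to one extra step: the
  steps between two times cover at most the elapsed time plus \<open>h\<close>.\<close>

lemma euler_curve_equi:
  assumes \<rho>0: "\<rho>0 \<in> ball_measures M0" and h: "h > 0" and s: "s \<in> {0..T}" and t: "t \<in> {0..T}"
  shows "wdist (euler h \<rho>0 (step_index h s)) (euler h \<rho>0 (step_index h t)) \<le> (growth M0 T + r) * (\<bar>s - t\<bar> + h)"
proof -
  have C: "growth M0 T + r \<ge> 0" using ball_measures_nonneg[OF \<rho>0] r_nonneg by (simp add: growth_def)
  have *: "wdist (euler h \<rho>0 (step_index h s)) (euler h \<rho>0 (step_index h t)) \<le> (growth M0 T + r) * (\<bar>s - t\<bar> + h)"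
    if s: "s \<in> {0..T}" and t: "t \<in> {0..T}" and le: "step_index h t \<le> step_index h s" for s t
  proof -
    define i where "i = step_index h s - step_index h t"
    have eq: "step_index h s = step_index h t + i" using le by (simp add: i_def)
    have "real (step_index h t + i) * h \<le> T" using step_index(1)[OF h, of s] s eq by simp
    then have "wdist (euler h \<rho>0 (step_index h s)) (euler h \<rho>0 (step_index h t)) \<le> real i * h * (growth M0 T + r)"
      unfolding eq using h by (intro euler_wdist[OF \<rho>0]) auto
    also have "real i * h \<le> \<bar>s - t\<bar> + h"
    proof -
      have "real i * h = real (step_index h s) * h - real (step_index h t) * h" by (simp add: eq algebra_simps)
      also have "\<dots> \<le> s - (t - h)"
        using step_index(1)[OF h, of s] step_index(2)[OF h, of t] s t by (simp add: algebra_simps)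
      finally show ?thesis by linarith
    qed
    then have "real i * h * (growth M0 T + r) \<le> (\<bar>s - t\<bar> + h) * (growth M0 T + r)" using C by (intro mult_right_mono)
    finally show ?thesis by (simp add: mult.commute)
  qed
  show ?thesis
  proof (cases "step_index h t \<le> step_index h s")
    case True
    then show ?thesis using *[OF s t] by simp
  next
    case False
    then show ?thesis using *[OF t s] by (simp add: wdist_sym[of "euler h \<rho>0 (step_index h s)"] abs_minus_commute)
  qed
qed

section \<open>Consistency of the scheme\<close>

text \<open>A first-order expansion with remainder uniform in measure and time. For a fixed label
  and position the step follows a straight line in space-time, and the derivative of
  \<open>\<phi>\<close> along such lines is uniformly continuous on a compact parameter set.\<close>

lemma drift_expansion:
  assumes \<phi>: "C_k (Suc 0) \<phi>" and \<epsilon>: "\<epsilon> > 0"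
  shows "\<exists>\<delta>>0. \<forall>h t. \<forall>\<mu>\<in>ball_measures M. 0 < h \<longrightarrow> h < \<delta> \<longrightarrow> 0 \<le> t \<longrightarrow> t \<le> T \<longrightarrow>
    \<bar>(\<integral>y. \<phi> (t + h, y) \<partial>distr vol borel (drift h \<mu>)) - (\<integral>y. \<phi> (t, y) \<partial>\<mu>)
      - h * plan_integral (flux \<phi>) t \<mu>\<bar> \<le> h * \<epsilon>"
proof -
  \<comment> \<open>The derivative in \<open>s\<close> of
    \<open>\<phi> (t + s, y + s *\<^sub>R perp (x - y))\<close>; at \<open>s = 0\<close> it is
    \<open>flux \<phi> t x y\<close>.\<close>
  define w where "w = (\<lambda>(s :: real, t :: real, x :: real ^ 3, y :: real ^ 3).
    time_derivative \<phi> (t + s, y + s *\<^sub>R perp (x - y)) + space_gradient \<phi> (t + s, y + s *\<^sub>R perp (x - y)) \<bullet> perp (x - y))"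
  note pc = partial_continuous[OF \<phi>]
  have cz: "continuous_on UNIV (\<lambda>z :: real \<times> real \<times> (real ^ 3) \<times> (real ^ 3). (fst (snd z) + fst z,
      snd (snd (snd z)) + fst z *\<^sub>R perp (fst (snd (snd z)) - snd (snd (snd z)))))"
    by (intro continuous_intros)
  have cw: "continuous_on UNIV w"
    unfolding w_def case_prod_beta'
    by (intro continuous_on_add continuous_on_inner continuous_on_compose2[OF pc(1) cz] continuous_on_compose2[OF pc(2) cz]
        continuous_intros) auto
  \<comment> \<open>The factor \<open>{0..1}\<close> is the reason for the threshold
    \<open>min 1 d\<close> on the step.\<close>
  define K where "K = {0..1 :: real} \<times> {0..T} \<times> cball (0 :: real ^ 3) r \<times> cball (0 :: real ^ 3) M"
  have "compact K" unfolding K_def by (intro compact_Times compact_Icc compact_cball)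
  then have "uniformly_continuous_on K w" by (intro compact_uniformly_continuous continuous_on_subset[OF cw]) auto
  then obtain d where d: "d > 0" "\<And>z z'. z \<in> K \<Longrightarrow> z' \<in> K \<Longrightarrow> dist z' z < d \<Longrightarrow> dist (w z') (w z) < \<epsilon>"
    using \<epsilon> unfolding uniformly_continuous_on_def by blast
  have "\<bar>(\<integral>y. \<phi> (t + h, y) \<partial>distr vol borel (drift h \<mu>)) - (\<integral>y. \<phi> (t, y) \<partial>\<mu>)
      - h * plan_integral (flux \<phi>) t \<mu>\<bar> \<le> h * \<epsilon>"
    if \<mu>: "\<mu> \<in> ball_measures M" and h: "0 < h" "h < min 1 d" and t: "0 \<le> t" "t \<le> T" for h t \<mu>
  proof -
    note b = brenier_map[OF \<mu>] and G = flux_parts_continuous(4)[OF \<phi>]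
    have c\<phi>: "continuous_on UNIV (\<lambda>y. \<phi> (t, y))" for t
      by (rule continuous_on_compose2[OF C_k_continuous[OF \<phi>]]) (auto intro!: continuous_intros)
    then have m\<phi>: "(\<lambda>y. \<phi> (t, y)) \<in> borel_measurable borel" for t by (rule borel_measurable_continuous_onI)
    define M' where "M' = M + h * (M + r)"
    have \<mu>': "distr vol borel (drift h \<mu>) \<in> ball_measures M'"
      unfolding M'_def using h by (intro drift(3)[OF \<mu>]) auto
    have dm: "drift h \<mu> \<in> borel_measurable vol" using h by (intro drift(1)[OF \<mu>]) auto
    have i1: "integrable vol (\<lambda>x. \<phi> (t + h, drift h \<mu> x))"
      using ball_measures_integrable_continuous[OF \<mu>' c\<phi>[of "t + h"]] dm m\<phi> by (subst (asm) integrable_distr_eq) auto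
    have i2: "integrable vol (\<lambda>x. \<phi> (t, brenier_map \<mu> x))"
    proof -
      have "integrable (distr vol borel (brenier_map \<mu>)) (\<lambda>y. \<phi> (t, y))"
        using ball_measures_integrable_continuous[OF \<mu> c\<phi>[of t]] by (simp only: b(2))
      then show ?thesis using b(1) m\<phi> by (subst (asm) integrable_distr_eq) auto
    qed
    note i3 = plan_integrable[OF G \<mu>, of t]
    have "(\<integral>y. \<phi> (t + h, y) \<partial>distr vol borel (drift h \<mu>)) - (\<integral>y. \<phi> (t, y) \<partial>\<mu>) - h * plan_integral (flux \<phi>) t \<mu>
      = (\<integral>x. \<phi> (t + h, drift h \<mu> x) - \<phi> (t, brenier_map \<mu> x) - h * flux \<phi> t x (brenier_map \<mu> x) \<partial>vol)"
      using i1 i2 i3 dm m\<phi> by (simp add: integral_distr brenier_map_integral[OF \<mu> m\<phi>] plan_integral_def)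
    also have "\<bar>\<dots>\<bar> \<le> (\<integral>x. \<bar>\<phi> (t + h, drift h \<mu> x) - \<phi> (t, brenier_map \<mu> x) - h * flux \<phi> t x (brenier_map \<mu> x)\<bar> \<partial>vol)"
      by (rule integral_abs_bound)
    also have "\<dots> \<le> (\<integral>x. h * \<epsilon> \<partial>vol)"
    proof (rule integral_mono_AE)
      show "AE x in vol. \<bar>\<phi> (t + h, drift h \<mu> x) - \<phi> (t, brenier_map \<mu> x) - h * flux \<phi> t x (brenier_map \<mu> x)\<bar> \<le> h * \<epsilon>"
        using b(3) AE_vol_le
      proof eventually_elim
        fix x assume x: "norm (brenier_map \<mu> x) \<le> M" "norm x \<le> r"
        define y where "y = brenier_map \<mu> x"
        define u where "u s = \<phi> (t + s, y + s *\<^sub>R perp (x - y))" for s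
        have "((\<lambda>s. (t + s, y + s *\<^sub>R perp (x - y))) has_derivative (\<lambda>s. (s, s *\<^sub>R perp (x - y)))) (at s)" for s
          by (auto intro!: derivative_eq_intros)
        from has_derivative_compose[OF this partial_has_derivative[OF \<phi>]]
        have *: "((\<lambda>s. \<phi> (t + s, y + s *\<^sub>R perp (x - y))) has_derivative
            (\<lambda>s'. s' * time_derivative \<phi> (t + s, y + s *\<^sub>R perp (x - y)) +
              (s' *\<^sub>R perp (x - y)) \<bullet> space_gradient \<phi> (t + s, y + s *\<^sub>R perp (x - y)))) (at s)" for s
          by (simp only: prod.case)
        have du: "(u has_real_derivative w (s, t, x, y)) (at s)" for s
        proof -
          have "(\<lambda>s. s * a + (s *\<^sub>R p) \<bullet> b) = (*) (a + b \<bullet> p)" for a and b p :: "real ^ 3"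
            by (auto simp: fun_eq_iff algebra_simps inner_commute)
          then show ?thesis using * by (simp add: u_def[abs_def] w_def has_field_derivative_def)
        qed
        have "\<exists>z. 0 < z \<and> z < h \<and> u h - u 0 = (h - 0) * w (z, t, x, y)"
          by (rule MVT2) (use h du in auto)
        then obtain z where z: "0 < z" "z < h" "u h - u 0 = h * w (z, t, x, y)" by auto
        have "(z, t, x, y) \<in> K" "(0, t, x, y) \<in> K" using z h t x by (auto simp: K_def y_def)
        moreover have "dist (z, t, x, y) (0, t, x, y) < d" using z h by (simp add: dist_Pair_Pair)
        ultimately have "\<bar>w (z, t, x, y) - w (0, t, x, y)\<bar> < \<epsilon>" using d(2) by (auto simp: dist_real_def)
        moreover have "\<phi> (t + h, drift h \<mu> x) - \<phi> (t, brenier_map \<mu> x) - h * flux \<phi> t x (brenier_map \<mu> x)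
            = h * (w (z, t, x, y) - w (0, t, x, y))"
          using z(3) by (simp add: u_def w_def drift_def flux_def y_def right_diff_distrib)
        ultimately show "\<bar>\<phi> (t + h, drift h \<mu> x) - \<phi> (t, brenier_map \<mu> x) - h * flux \<phi> t x (brenier_map \<mu> x)\<bar> \<le> h * \<epsilon>"
          using h by (simp add: abs_mult)
      qed
    qed (use i1 i2 i3 in auto)
    also have "\<dots> = h * \<epsilon>" using vol.prob_space by simp
    finally show ?thesis .
  qed
  then show ?thesis using d(1) by (intro exI[of _ "min 1 d"]) auto
qed

text \<open>Telescoping: the consistency errors \<open>h * \<epsilon>\<close> of single steps add up
  to the elapsed time multiplied by \<open>\<epsilon>\<close>.\<close>

lemma euler_sum:
  assumes \<rho>0: "\<rho>0 \<in> ball_measures M0" and h: "h > 0"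
    and step: "\<And>t \<mu>. \<mu> \<in> ball_measures (growth M0 T) \<Longrightarrow> 0 \<le> t \<Longrightarrow> t \<le> T \<Longrightarrow>
      \<bar>(\<integral>y. \<phi> (t + h, y) \<partial>distr vol borel (drift h \<mu>)) - (\<integral>y. \<phi> (t, y) \<partial>\<mu>)
      - h * plan_integral (flux \<phi>) t \<mu>\<bar> \<le> h * \<epsilon>"
  shows "real N * h \<le> T \<Longrightarrow> \<bar>(\<integral>y. \<phi> (real N * h, y) \<partial>euler h \<rho>0 N) - (\<integral>y. \<phi> (0, y) \<partial>\<rho>0)
      - (\<Sum>k<N. plan_integral (flux \<phi>) (real k * h) (euler h \<rho>0 k) * h)\<bar> \<le> real N * h * \<epsilon>"
proof (induction N)
  case (Suc N)
  have le: "real N * h \<le> T" using Suc.prems h by (simp add: algebra_simps)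
  have "real N * h + h = real (Suc N) * h" by (simp add: algebra_simps)
  then have "\<bar>(\<integral>y. \<phi> (real (Suc N) * h, y) \<partial>euler h \<rho>0 (Suc N)) - (\<integral>y. \<phi> (real N * h, y) \<partial>euler h \<rho>0 N)
      - h * plan_integral (flux \<phi>) (real N * h) (euler h \<rho>0 N)\<bar> \<le> h * \<epsilon>"
    using step[OF euler_ball_le[OF \<rho>0 _ le], of "real N * h"] h le by simp
  moreover have "real (Suc N) * h * \<epsilon> = real N * h * \<epsilon> + h * \<epsilon>" by (simp add: algebra_simps)
  moreover have "(\<Sum>k<Suc N. plan_integral (flux \<phi>) (real k * h) (euler h \<rho>0 k) * h)
      = (\<Sum>k<N. plan_integral (flux \<phi>) (real k * h) (euler h \<rho>0 k) * h) + h * plan_integral (flux \<phi>) (real N * h) (euler h \<rho>0 N)"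
    by (simp add: mult.commute)
  ultimately show ?case using Suc.IH[OF le] by linarith
qed simp

section \<open>Convergence of the scheme\<close>

text \<open>The subsequence is chosen once on the half-line, so the limit curve does not depend on
  the horizon. For each \<open>T\<close> the weak formulation is the limit of the telescoped sums,
  read as integrals of step functions in time.\<close>

theorem global_existence:
  assumes \<rho>0: "\<rho>0 \<in> ball_measures M0"
  shows "\<exists>\<rho>. \<forall>T>0. weak_measure_solution \<Omega> T \<rho>0 \<rho>"
proof -
  define h where "h n = 1 / real (Suc n)" for n
  have h: "h n > 0" for n by (simp add: h_def)
  have h0: "h \<longlonglongrightarrow> 0" unfolding h_def by (intro LIMSEQ_Suc[OF lim_1_over_n])
  have M0: "M0 \<ge> 0" by (rule ball_measures_nonneg[OF \<rho>0])
  define \<nu> where "\<nu> n t = euler (h n) \<rho>0 (step_index (h n) t)" for n t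
  have \<nu>: "\<nu> n t \<in> ball_measures (growth M0 t)" if "0 \<le> t" for n t
    unfolding \<nu>_def using h[of n] step_index(1)[OF h that, of n] by (intro euler_ball_le[OF \<rho>0]) auto
  have equi: "wdist (\<nu> n s) (\<nu> n t) \<le> (growth M0 T + r) * (\<bar>s - t\<bar> + h n)" if "s \<in> {0..T}" "t \<in> {0..T}" for n s t T
    unfolding \<nu>_def by (rule euler_curve_equi[OF \<rho>0 h that])
  have Cpos: "growth M0 T + r \<ge> 0" for T using M0 r_nonneg by (simp add: growth_def)
  have "\<exists>C\<ge>0. \<forall>n. \<forall>s\<in>{0..T}. \<forall>t\<in>{0..T}. wdist (\<nu> n s) (\<nu> n t) \<le> C * (\<bar>s - t\<bar> + h n)" for T
    using equi[of _ T] Cpos[of T] by blast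
  from curve_compactness[of \<nu> "growth M0", OF \<nu> h0 this]
  obtain k \<sigma> where k: "strict_mono (k :: nat \<Rightarrow> nat)" and \<sigma>: "\<And>t. 0 \<le> t \<Longrightarrow> \<sigma> t \<in> ball_measures (growth M0 t)"
    and lim: "\<And>t. 0 \<le> t \<Longrightarrow> (\<lambda>n. wdist (\<nu> (k n) t) (\<sigma> t)) \<longlonglongrightarrow> 0" by blast
  have hk: "(\<lambda>n. h (k n)) \<longlonglongrightarrow> 0" using LIMSEQ_subseq_LIMSEQ[OF h0 k] by (simp add: o_def)
  have "weak_measure_solution \<Omega> T \<rho>0 \<sigma>" if T: "T > 0" for T
  proof -
    define M where "M = growth M0 T"
    have \<sigma>M: "\<sigma> t \<in> ball_measures M" and \<nu>M: "\<nu> n t \<in> ball_measures M" if "t \<in> {0..T}" for t n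
      using that \<sigma>[of t] \<nu>[of t n] ball_measures_mono[OF growth_mono[OF M0, of t T]] by (auto simp: M_def)
    have lip: "wdist (\<sigma> s) (\<sigma> t) \<le> (M + r) * \<bar>s - t\<bar>" if st: "s \<in> {0..T}" "t \<in> {0..T}" for s t
    proof (rule wdist_limit_le[OF \<nu>M[OF st(1)] \<nu>M[OF st(2)] \<sigma>M[OF st(1)] \<sigma>M[OF st(2)] lim lim])
      show "wdist (\<nu> (k n) s) (\<nu> (k n) t) \<le> (M + r) * (\<bar>s - t\<bar> + h (k n))" for n unfolding M_def by (rule equi[OF st])
      have "(\<lambda>n. (M + r) * (\<bar>s - t\<bar> + h (k n))) \<longlonglongrightarrow> (M + r) * (\<bar>s - t\<bar> + 0)" by (intro tendsto_intros hk)
      then show "(\<lambda>n. (M + r) * (\<bar>s - t\<bar> + h (k n))) \<longlonglongrightarrow> (M + r) * \<bar>s - t\<bar>" by simp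
    qed (use st in auto)
    have wc: "wcurve M T \<sigma>" by (rule wcurveI_lipschitz[OF \<sigma>M lip])
    have idx: "(\<lambda>n. real (step_index (h (k n)) t) * h (k n)) \<longlonglongrightarrow> t" if t: "0 \<le> t" for t
    proof (rule tendsto_sandwich[where f = "\<lambda>n. t - h (k n)" and h = "\<lambda>_. t"])
      have "(\<lambda>n. t - h (k n)) \<longlonglongrightarrow> t - 0" by (intro tendsto_intros hk)
      then show "(\<lambda>n. t - h (k n)) \<longlonglongrightarrow> t" by simp
      show "\<forall>\<^sub>F n in sequentially. t - h (k n) \<le> real (step_index (h (k n)) t) * h (k n)"
        using step_index(2)[OF h t] by (intro always_eventually allI) (simp add: algebra_simps less_imp_le)
    qed (use step_index(1)[OF h t] in auto)
    have eq: "(\<integral>t. plan_integral (flux \<phi>) t (\<sigma> t) \<partial>lebesgue_on {0..T}) = (\<integral>x. \<phi> (T, x) \<partial>\<sigma> T) - (\<integral>x. \<phi> (0, x) \<partial>\<rho>0)"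
      if \<phi>: "\<phi> \<in> test_functions" for \<phi>
    proof -
      have c: "C_k (Suc 0) \<phi>" using \<phi> unfolding test_functions_def by blast
      note G = flux_parts_continuous(4)[OF c]
      define N where "N n = step_index (h (k n)) T" for n
      define a where "a n i = plan_integral (flux \<phi>) (real i * h (k n)) (euler (h (k n)) \<rho>0 i)" for n i
      \<comment> \<open>The Riemann sum as a step function, equal to \<open>0\<close> between the
        last grid time \<open>real (N n) * h (k n)\<close> and \<open>T\<close>.\<close>
      define S where "S n t = (\<Sum>i<N n. a n i * indicator {real i * h (k n)..<real (Suc i) * h (k n)} t)" for n and t :: real
      have NT: "real (N n) * h (k n) \<le> T" for n unfolding N_def using T by (intro step_index(1) h) auto
      have S_eq: "S n t = plan_integral (flux \<phi>) (real (step_index (h (k n)) t) * h (k n)) (\<nu> (k n) t)"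
        if t: "0 \<le> t" "t < real (N n) * h (k n)" for n t
      proof -
        define i where "i = step_index (h (k n)) t"
        have i: "real i * h (k n) \<le> t" "t < (real i + 1) * h (k n)" using step_index[OF h t(1), of "k n"] by (auto simp: i_def)
        have "real i * h (k n) < real (N n) * h (k n)" using i(1) t(2) by linarith
        then have iN: "i < N n" using h[of "k n"] by simp
        have ind: "indicator {real j * h (k n)..<real (Suc j) * h (k n)} t = (if j = i then 1 else 0 :: real)" for j
        proof (cases "j = i")
          case False
          have "\<not> (real j * h (k n) \<le> t \<and> t < real (Suc j) * h (k n))"
          proof
            assume *: "real j * h (k n) \<le> t \<and> t < real (Suc j) * h (k n)"
            have "real j * h (k n) < (real i + 1) * h (k n)" "real i * h (k n) < real (Suc j) * h (k n)" using * i by linarith+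
            then have "real j < real i + 1" "real i < real (Suc j)" using h[of "k n"] by (simp_all only: mult_less_cancel_right_pos)
            then show False using False by linarith
          qed
          then show ?thesis using False by simp
        qed (use i in \<open>simp add: add.commute\<close>)
        have "S n t = (\<Sum>j<N n. if j = i then a n j else 0)"
          unfolding S_def ind by (intro sum.cong) auto
        also have "\<dots> = a n i" using iN by simp
        finally show ?thesis by (simp add: a_def \<nu>_def i_def)
      qed
      obtain B where B: "B \<ge> 0" "\<forall>t. \<forall>\<mu>\<in>ball_measures M. \<bar>t\<bar> \<le> T \<longrightarrow> \<bar>plan_integral (flux \<phi>) t \<mu>\<bar> \<le> B"
        using plan_integral_bound[OF G, of M T] by blast
      have S_out: "S n t = 0" if "real (N n) * h (k n) \<le> t" for n t
      proof -
        have "indicator {real i * h (k n)..<real (Suc i) * h (k n)} t = (0 :: real)" if "i < N n" for i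
        proof -
          have "real (Suc i) * h (k n) \<le> real (N n) * h (k n)" using that h[of "k n"] by (intro mult_right_mono) auto
          then show ?thesis using \<open>real (N n) * h (k n) \<le> t\<close> by simp
        qed
        then show ?thesis unfolding S_def by (intro sum.neutral) auto
      qed
      have S_bound: "\<bar>S n t\<bar> \<le> B" if t: "t \<in> {0..T}" for n t
      proof (cases "t < real (N n) * h (k n)")
        case True
        have "\<bar>real (step_index (h (k n)) t) * h (k n)\<bar> \<le> T" using step_index(1)[OF h, of t "k n"] t h[of "k n"] by simp
        then show ?thesis using S_eq[of t n] True t B(2) \<nu>M[OF t] by simp
      qed (use S_out B in auto)
      \<comment> \<open>The endpoint is left out because \<open>S n T\<close> is \<open>0\<close>
        for every \<open>n\<close>; a single time is negligible.\<close>
      have S_lim: "(\<lambda>n. S n t) \<longlonglongrightarrow> plan_integral (flux \<phi>) t (\<sigma> t)" if t: "0 \<le> t" "t < T" for t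
      proof -
        have tT: "t \<in> {0..T}" using t by simp
        have "(\<lambda>n. plan_integral (flux \<phi>) (real (step_index (h (k n)) t) * h (k n)) (\<nu> (k n) t)) \<longlonglongrightarrow> plan_integral (flux \<phi>) t (\<sigma> t)"
          by (rule plan_integral_tendsto[OF G idx[OF t(1)] \<nu>M[OF tT] \<sigma>M[OF tT] lim[OF t(1)]])
        moreover have "eventually (\<lambda>n. t < real (N n) * h (k n)) sequentially"
          unfolding N_def using T t by (intro order_tendstoD(1)[OF idx]) auto
        then have "eventually (\<lambda>n. plan_integral (flux \<phi>) (real (step_index (h (k n)) t) * h (k n)) (\<nu> (k n) t) = S n t) sequentially"
          by eventually_elim (use S_eq t in auto)
        ultimately show ?thesis by (rule Lim_transform_eventually)
      qed
      have S_int: "(\<integral>t. S n t \<partial>lebesgue_on {0..T}) = (\<Sum>i<N n. a n i * h (k n))" for n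
      proof -
        have ind: "integrable (lebesgue_on {0..T}) (indicator {real i * h (k n)..<real (Suc i) * h (k n)} :: real \<Rightarrow> real)
          \<and> (\<integral>t. indicator {real i * h (k n)..<real (Suc i) * h (k n)} t \<partial>lebesgue_on {0..T}) = h (k n)" if "i < N n" for i
        proof -
          have "real (Suc i) * h (k n) \<le> real (N n) * h (k n)" using that h[of "k n"] by (intro mult_right_mono) auto
          have sub: "{real i * h (k n)..<real (Suc i) * h (k n)} \<subseteq> {0..T}"
          proof
            fix t assume "t \<in> {real i * h (k n)..<real (Suc i) * h (k n)}"
            then have t: "real i * h (k n) \<le> t" "t \<le> T" using \<open>real (Suc i) * h (k n) \<le> real (N n) * h (k n)\<close> NT[of n] by auto
            have "0 \<le> real i * h (k n)" using h[of "k n"] by simp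
            then have "0 \<le> t" using t(1) by linarith
            then show "t \<in> {0..T}" using t(2) by simp
          qed
          have len: "real i * h (k n) \<le> real (Suc i) * h (k n)" using h[of "k n"] by (intro mult_right_mono) auto
          have "emeasure (lebesgue_on {0..T}) {real i * h (k n)..<real (Suc i) * h (k n)} = ennreal (h (k n))"
            using sub len by (subst emeasure_restrict_space) (auto simp: algebra_simps)
          moreover have "{real i * h (k n)..<real (Suc i) * h (k n)} \<in> sets (lebesgue_on {0..T})"
            using sub by (subst sets_restrict_space_iff) auto
          moreover have "{real i * h (k n)..<real (Suc i) * h (k n)} \<inter> {0..T} = {real i * h (k n)..<real (Suc i) * h (k n)}"
            using sub by blast
          ultimately show ?thesis using h[of "k n"] by (auto simp: measure_def less_imp_le simp del: of_nat_Suc)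
        qed
        show ?thesis unfolding S_def using ind by (subst Bochner_Integration.integral_sum) auto
      qed
      have S_meas: "S n \<in> borel_measurable (lebesgue_on {0..T})" for n
        unfolding S_def[abs_def]
        by (intro measurable_restrict_space1 measurable_completion borel_measurable_sum borel_measurable_times
            borel_measurable_const borel_measurable_indicator) simp_all
      have I: "(\<lambda>n. \<integral>t. S n t \<partial>lebesgue_on {0..T}) \<longlonglongrightarrow> (\<integral>t. plan_integral (flux \<phi>) t (\<sigma> t) \<partial>lebesgue_on {0..T})"
      proof (rule integral_dominated_convergence[where w = "\<lambda>_. B"])
        have "AE t in lebesgue. t \<noteq> T"
          by (rule AE_completion) (rule AE_lborel_singleton)
        then have "AE t in lebesgue. t \<in> {0..T} \<longrightarrow> t \<noteq> T" by eventually_elim simp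
        then have "AE t in lebesgue_on {0..T}. t \<noteq> T" by (subst AE_restrict_space_iff) auto
        then show "AE t in lebesgue_on {0..T}. (\<lambda>n. S n t) \<longlonglongrightarrow> plan_integral (flux \<phi>) t (\<sigma> t)"
          using AE_space by eventually_elim (use S_lim in auto)
        show "AE t in lebesgue_on {0..T}. norm (S n t) \<le> B" for n using AE_space by eventually_elim (use S_bound in auto)
        show "(\<lambda>t. plan_integral (flux \<phi>) t (\<sigma> t)) \<in> borel_measurable (lebesgue_on {0..T})"
          using continuous_imp_integrable_real[OF wcurve_plan_continuous[OF wc G]] by (rule borel_measurable_integrable)
        show "integrable (lebesgue_on {0..T}) (\<lambda>_. B)"
          using continuous_imp_integrable_real[of 0 T "\<lambda>_. B"] by simp
      qed (rule S_meas)
      \<comment> \<open>Time and measure both move with \<open>n\<close> here, so the terminal term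
        is treated as a plan integral, for which joint convergence is known.\<close>
      have "(\<lambda>n. (\<integral>y. \<phi> (real (N n) * h (k n), y) \<partial>euler (h (k n)) \<rho>0 (N n))) \<longlonglongrightarrow> (\<integral>y. \<phi> (T, y) \<partial>\<sigma> T)"
      proof -
        have TT: "T \<in> {0..T}" using T by simp
        have G\<phi>: "jointly_continuous (\<lambda>t x y. \<phi> (t, y))" by (rule continuous_on_snd_pair[OF C_k_continuous[OF c]])
        have ev: "(\<integral>y. \<phi> (t, y) \<partial>\<mu>) = plan_integral (\<lambda>t x y. \<phi> (t, y)) t \<mu>" if "\<mu> \<in> ball_measures M" for t \<mu>
          unfolding plan_integral_def
          by (intro brenier_map_integral[OF that] borel_measurable_continuous_onI
              continuous_on_compose2[OF C_k_continuous[OF c]]) (auto intro!: continuous_intros)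
        have "(\<lambda>n. plan_integral (\<lambda>t x y. \<phi> (t, y)) (real (N n) * h (k n)) (\<nu> (k n) T)) \<longlonglongrightarrow> plan_integral (\<lambda>t x y. \<phi> (t, y)) T (\<sigma> T)"
          unfolding N_def using T by (intro plan_integral_tendsto[OF G\<phi> idx \<nu>M[OF TT] \<sigma>M[OF TT] lim]) auto
        then show ?thesis using ev[OF \<nu>M[OF TT]] ev[OF \<sigma>M[OF TT]] by (simp add: \<nu>_def N_def)
      qed
      then have L: "(\<lambda>n. (\<integral>y. \<phi> (real (N n) * h (k n), y) \<partial>euler (h (k n)) \<rho>0 (N n)) - (\<integral>y. \<phi> (0, y) \<partial>\<rho>0)
          - (\<integral>t. S n t \<partial>lebesgue_on {0..T})) \<longlonglongrightarrow>
          (\<integral>y. \<phi> (T, y) \<partial>\<sigma> T) - (\<integral>y. \<phi> (0, y) \<partial>\<rho>0) - (\<integral>t. plan_integral (flux \<phi>) t (\<sigma> t) \<partial>lebesgue_on {0..T})"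
        by (intro tendsto_intros I)
      have "(\<lambda>n. (\<integral>y. \<phi> (real (N n) * h (k n), y) \<partial>euler (h (k n)) \<rho>0 (N n)) - (\<integral>y. \<phi> (0, y) \<partial>\<rho>0)
          - (\<integral>t. S n t \<partial>lebesgue_on {0..T})) \<longlonglongrightarrow> 0"
      proof (rule LIMSEQ_I)
        fix e :: real assume e: "0 < e"
        \<comment> \<open>Accumulated over a total time of at most \<open>T\<close>, this tolerance
          costs \<open>e / 2\<close>.\<close>
        then have "e / (2 * T) > 0" using T by simp
        from drift_expansion[OF c this, of M T] obtain \<delta> where \<delta>: "\<delta> > 0"
          and step: "\<And>h t \<mu>. \<mu> \<in> ball_measures M \<Longrightarrow> 0 < h \<Longrightarrow> h < \<delta> \<Longrightarrow> 0 \<le> t \<Longrightarrow> t \<le> T \<Longrightarrow>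
            \<bar>(\<integral>y. \<phi> (t + h, y) \<partial>distr vol borel (drift h \<mu>)) - (\<integral>y. \<phi> (t, y) \<partial>\<mu>)
            - h * plan_integral (flux \<phi>) t \<mu>\<bar> \<le> h * (e / (2 * T))" by blast
        have "eventually (\<lambda>n. h (k n) < \<delta>) sequentially" using \<delta> by (intro order_tendstoD(2)[OF hk])
        then obtain n0 where n0: "\<And>n. n \<ge> n0 \<Longrightarrow> h (k n) < \<delta>" by (auto simp: eventually_sequentially)
        show "\<exists>n0. \<forall>n\<ge>n0. norm ((\<integral>y. \<phi> (real (N n) * h (k n), y) \<partial>euler (h (k n)) \<rho>0 (N n)) - (\<integral>y. \<phi> (0, y) \<partial>\<rho>0)
          - (\<integral>t. S n t \<partial>lebesgue_on {0..T}) - 0) < e"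
        proof (intro exI[of _ n0] allI impI)
          fix n assume n: "n0 \<le> n"
          have "\<bar>(\<integral>y. \<phi> (real (N n) * h (k n), y) \<partial>euler (h (k n)) \<rho>0 (N n)) - (\<integral>y. \<phi> (0, y) \<partial>\<rho>0)
              - (\<Sum>i<N n. a n i * h (k n))\<bar> \<le> real (N n) * h (k n) * (e / (2 * T))"
            unfolding a_def
            by (rule euler_sum[OF \<rho>0 h step[OF _ h n0[OF n], folded M_def] NT]) (simp_all add: M_def)
          also have "\<dots> \<le> T * (e / (2 * T))" using NT[of n] e T by (intro mult_right_mono) auto
          also have "\<dots> < e" using e T by simp
          finally show "norm ((\<integral>y. \<phi> (real (N n) * h (k n), y) \<partial>euler (h (k n)) \<rho>0 (N n)) - (\<integral>y. \<phi> (0, y) \<partial>\<rho>0)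
              - (\<integral>t. S n t \<partial>lebesgue_on {0..T}) - 0) < e" by (simp add: S_int)
        qed
      qed
      from LIMSEQ_unique[OF L this] show ?thesis by simp
    qed
    show ?thesis
      unfolding weak_measure_solution_def
    proof (intro conjI ballI)
      show "\<rho>0 \<in> prob_measures" by (rule ball_measuresD(1)[OF \<rho>0])
      show "continuous_map (top_of_set {0..T}) weak_star \<sigma>" by (rule wcurve_imp_weak_star[OF wc])
      \<comment> \<open>The \<open>+ 1\<close> passes from closed balls to the open ones of the
        definition.\<close>
      have "msupport (\<sigma> t) \<subseteq> ball 0 (growth M0 t + 1)" if "t \<in> {0..T}" for t
        using ball_measures_msupport[OF \<sigma>, of t] that by (auto simp: subset_iff)
      moreover have "mono_on {0..T} (\<lambda>t. growth M0 t + 1)" using growth_mono[OF M0] by (auto simp: mono_on_def)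
      ultimately show "\<exists>R. mono_on {0..T} R \<and> (\<forall>t\<in>{0..T}. msupport (\<sigma> t) \<subseteq> ball 0 (R t))" by blast
    qed (simp only: weak_form_iff[OF wc] eq)
  qed
  then show ?thesis by blast
qed

end

section \<open>A priori estimates\<close>

text \<open>Vanishing moments annihilate polynomials, and approximating \<open>k\<close> itself by
  one shows that the integral of its square is zero.\<close>

lemma continuous_moments_zero:
  fixes k :: "real \<Rightarrow> real"
  assumes k: "continuous_on {0..T} k" and T: "0 < T" and moments: "\<And>n. integral {0..T} (\<lambda>t. t ^ n * k t) = 0"
    and t: "t \<in> {0..T}"
  shows "k t = 0"
proof -
  note int = integrable_continuous_real
  have poly: "integral {0..T} (\<lambda>t. (\<Sum>i\<le>n. a i * t ^ i) * k t) = 0" for a and n :: nat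
  proof -
    have "integral {0..T} (\<lambda>t. (\<Sum>i\<le>n. a i * t ^ i) * k t) = integral {0..T} (\<lambda>t. \<Sum>i\<le>n. a i * (t ^ i * k t))"
      by (simp add: sum_distrib_right mult.assoc)
    also have "\<dots> = (\<Sum>i\<le>n. integral {0..T} (\<lambda>t. a i * (t ^ i * k t)))"
      by (intro integral_sum int continuous_intros k) auto
    also have "\<dots> = 0" using moments by simp
    finally show ?thesis .
  qed
  define Q where "Q = integral {0..T} (\<lambda>t. \<bar>k t\<bar>)"
  have Q: "Q \<ge> 0" unfolding Q_def by (intro integral_nonneg int continuous_intros k) auto
  have "integral {0..T} (\<lambda>t. k t * k t) \<le> 0"
  proof (rule field_le_epsilon)
    fix e :: real assume e: "0 < e"
    \<comment> \<open>Division by \<open>Q + 1\<close> covers the case \<open>Q = 0\<close>.\<close>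
    define e' where "e' = e / (Q + 1)"
    have e': "e' > 0" using e Q by (simp add: e'_def)
    obtain p where p: "real_polynomial_function p" "\<And>t. t \<in> {0..T} \<Longrightarrow> \<bar>k t - p t\<bar> < e'"
      using Stone_Weierstrass_real_polynomial_function[OF compact_Icc k e'] by blast
    obtain a n where pa: "p = (\<lambda>t. \<Sum>i\<le>n. a i * t ^ i)" using p(1) real_polynomial_function_iff_sum by blast
    have cp: "continuous_on {0..T} p" unfolding pa by (intro continuous_intros)
    have "integral {0..T} (\<lambda>t. k t * k t) = integral {0..T} (\<lambda>t. (k t - p t) * k t) + integral {0..T} (\<lambda>t. p t * k t)"
      by (subst integral_add[symmetric]) (auto intro!: int continuous_intros k cp simp: algebra_simps)
    also have "integral {0..T} (\<lambda>t. p t * k t) = 0" unfolding pa by (rule poly)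
    also have "integral {0..T} (\<lambda>t. (k t - p t) * k t) \<le> integral {0..T} (\<lambda>t. e' * \<bar>k t\<bar>)"
    proof (intro integral_le int continuous_intros k cp)
      fix t assume "t \<in> {0..T}"
      then have "\<bar>k t - p t\<bar> * \<bar>k t\<bar> \<le> e' * \<bar>k t\<bar>" using p(2) by (intro mult_right_mono) (auto intro: less_imp_le)
      then show "(k t - p t) * k t \<le> e' * \<bar>k t\<bar>" by (metis abs_le_iff abs_mult order_trans abs_ge_self)
    qed
    also have "\<dots> = e' * Q" by (simp add: Q_def)
    also have "\<dots> \<le> e' * (Q + 1)" using e' by (intro mult_left_mono) auto
    also have "\<dots> = e" using Q by (simp add: e'_def)
    finally show "integral {0..T} (\<lambda>t. k t * k t) \<le> 0 + e" by simp
  qed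
  moreover have "integral {0..T} (\<lambda>t. k t * k t) \<ge> 0" by (intro integral_nonneg int continuous_intros k) auto
  ultimately have "integral {0..T} (\<lambda>t. k t * k t) = 0" by simp
  then have "\<forall>t\<in>{0..T}. k t * k t = 0"
    by (subst (asm) integral_eq_0_iff) (auto intro!: continuous_intros k T)
  then show ?thesis using t by simp
qed

lemma C_k_power: "C_k k f \<Longrightarrow> C_k k (\<lambda>x. f x ^ n)"
  by (induction n) (auto intro: C_k_const C_k_mult)

lemma C_k_fst: "C_k k (\<lambda>z :: real \<times> (real ^ 3). fst z)"
  by (intro C_k_bounded_linear bounded_linear_fst)

lemma test_functions_C1: "\<phi> \<in> test_functions \<Longrightarrow> C_k (Suc 0) \<phi>"
  unfolding test_functions_def by blast

lemma test_functions_mult: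
  assumes \<phi>: "\<phi> \<in> test_functions" and \<theta>: "\<And>k. C_k k \<theta>"
  shows "(\<lambda>z. \<theta> z * \<phi> z) \<in> test_functions"
proof -
  have "bounded {z. \<phi> z \<noteq> 0}" using \<phi> by (simp add: test_functions_def compact_closure)
  then have "bounded {z. \<theta> z * \<phi> z \<noteq> 0}" by (rule bounded_subset) auto
  moreover have "C_k k (\<lambda>z. \<theta> z * \<phi> z)" for k
    using \<phi> by (intro C_k_mult \<theta>) (simp add: test_functions_def)
  ultimately show ?thesis by (simp add: test_functions_def compact_closure)
qed

lemma cutoff_test_functions:
  assumes \<psi>: "\<And>k. C_k k \<psi>" and A: "A \<ge> 0"
  shows "(\<lambda>z. cutoff A z * \<psi> z) \<in> test_functions"
proof -
  have "{z. cutoff A z * \<psi> z \<noteq> 0} \<subseteq> cball 0 (A + 1)" using cutoff_eq_0[OF _ A] by (force simp: not_le[symmetric])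
  then have "bounded {z. cutoff A z * \<psi> z \<noteq> 0}" using bounded_cball bounded_subset by blast
  then show ?thesis using C_k_mult[OF C_k_cutoff \<psi>] by (simp add: test_functions_def compact_closure)
qed

context source_domain
begin

text \<open>A power of time is a constant for the spatial gradient. For \<open>n = 0\<close> the
  truncated exponent \<open>n - 1\<close> is harmless since its coefficient is
  \<open>0\<close>.\<close>

lemma flux_time_power:
  assumes \<phi>: "C_k (Suc 0) \<phi>"
  shows "flux (\<lambda>z. fst z ^ n * \<phi> z) t x y = real n * t ^ (n - 1) * \<phi> (t, y) + t ^ n * flux \<phi> t x y"
proof -
  have c: "C_k (Suc 0) (\<lambda>z. fst z ^ n * \<phi> z)" by (intro C_k_mult C_k_power C_k_fst \<phi>)
  have "((\<lambda>s. s ^ n * \<phi> (s, y)) has_real_derivative real n * t ^ (n - 1) * \<phi> (t, y) + time_derivative \<phi> (t, y) * t ^ n) (at t)"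
    by (rule DERIV_mult[OF _ time_derivative_eq(1)[OF \<phi>]]) (auto intro!: derivative_eq_intros)
  moreover have "((\<lambda>s. s ^ n * \<phi> (s, y)) has_real_derivative time_derivative (\<lambda>z. fst z ^ n * \<phi> z) (t, y)) (at t)"
    using time_derivative_eq(1)[OF c, of y t] by simp
  ultimately have 1: "time_derivative (\<lambda>z. fst z ^ n * \<phi> z) (t, y) = real n * t ^ (n - 1) * \<phi> (t, y) + time_derivative \<phi> (t, y) * t ^ n"
    by (rule DERIV_unique[rotated])
  have "GDERIV (\<lambda>y. t ^ n * \<phi> (t, y)) y :> t ^ n *\<^sub>R space_gradient \<phi> (t, y) + \<phi> (t, y) *\<^sub>R 0"
    by (rule GDERIV_mult[OF GDERIV_const space_gradient_eq(1)[OF \<phi>]])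
  then have 2: "space_gradient (\<lambda>z. fst z ^ n * \<phi> z) (t, y) = t ^ n *\<^sub>R space_gradient \<phi> (t, y)"
    using space_gradient_eq(2)[OF c, of t y] grad_eqI by fastforce
  show ?thesis unfolding flux_def 1 2 by (simp add: algebra_simps)
qed

lemma flux_cong:
  assumes "C_k (Suc 0) \<psi>" "open U" "(t, y) \<in> U" "\<And>z. z \<in> U \<Longrightarrow> \<phi> z = \<psi> z"
  shows "flux \<phi> t x y = flux \<psi> t x y"
proof -
  have "(\<phi> has_derivative frechet_derivative \<psi> (at (t, y))) (at (t, y))"
    by (rule has_derivative_transform_within_open[OF C_k_SucD(1)[OF assms(1)] assms(2,3)]) (simp add: assms(4))
  from frechet_derivative_at[OF this] show ?thesis
    by (simp add: flux_def time_derivative_def space_gradient_def)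
qed

text \<open>The integral identity alone, in reduced form; it depends on the curve only through its
  values on \<open>[0, T]\<close>.\<close>

definition weak_form :: "real \<Rightarrow> (real ^ 3) measure \<Rightarrow> (real \<Rightarrow> (real ^ 3) measure) \<Rightarrow> bool"
  where "weak_form T \<rho>0 \<rho> \<longleftrightarrow> (\<forall>\<phi>\<in>test_functions.
    (\<integral>t. plan_integral (flux \<phi>) t (\<rho> t) \<partial>lebesgue_on {0..T}) = (\<integral>y. \<phi> (T, y) \<partial>\<rho> T) - (\<integral>y. \<phi> (0, y) \<partial>\<rho>0))"

text \<open>Let \<open>m\<close> and \<open>H\<close> be the two sides as functions of time. Testing
  with \<open>t ^ n * \<phi>\<close> and integrating \<open>H\<close> by parts reduces the moments
  of \<open>m - H\<close> to its value at \<open>T\<close>. The case \<open>n = 0\<close> makes that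
  value \<open>0\<close>, so all moments vanish and \<open>m = H\<close> throughout.\<close>

lemma weak_form_local:
  assumes \<rho>: "wcurve M T \<rho>" and T: "T > 0" and w: "weak_form T \<rho>0 \<rho>" and \<phi>: "\<phi> \<in> test_functions" and t: "t \<in> {0..T}"
  shows "(\<integral>y. \<phi> (t, y) \<partial>\<rho> t) = (\<integral>y. \<phi> (0, y) \<partial>\<rho>0) + integral {0..t} (\<lambda>s. plan_integral (flux \<phi>) s (\<rho> s))"
proof -
  note c = test_functions_C1[OF \<phi>]
  have c0: "continuous_on UNIV \<phi>" using c by (rule C_k_continuous)
  define m where "m s = (\<integral>y. \<phi> (s, y) \<partial>\<rho> s)" for s
  define m0 where "m0 = (\<integral>y. \<phi> (0, y) \<partial>\<rho>0)"
  define g where "g s = plan_integral (flux \<phi>) s (\<rho> s)" for s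
  define H where "H s = m0 + integral {0..s} g" for s
  have cg: "continuous_on {0..T} g" unfolding g_def by (rule wcurve_plan_continuous[OF \<rho> flux_parts_continuous(4)[OF c]])
  have cm: "continuous_on {0..T} m" unfolding m_def by (rule wcurve_integral_continuous[OF \<rho> c0])
  have dH: "(H has_vector_derivative g s) (at s within {0..T})" if "s \<in> {0..T}" for s
    unfolding H_def using integral_has_vector_derivative[OF cg that] by (auto intro!: derivative_eq_intros)
  have cH: "continuous_on {0..T} H"
    unfolding continuous_on_eq_continuous_within using dH has_vector_derivative_continuous by blast
  have ev: "m s = plan_integral (\<lambda>t x y. \<phi> (t, y)) s (\<rho> s)" if "s \<in> {0..T}" for s
    unfolding m_def plan_integral_def
    by (intro brenier_map_integral[OF wcurveD[OF \<rho> that]] borel_measurable_continuous_onI continuous_on_compose2[OF c0])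
       (auto intro!: continuous_intros)
  have main: "integral {0..T} (\<lambda>s. real n * s ^ (n - 1) * (m s - H s)) = T ^ n * (m T - H T)" for n
  proof -
    have \<phi>n: "(\<lambda>z. fst z ^ n * \<phi> z) \<in> test_functions" by (intro test_functions_mult \<phi> C_k_power C_k_fst)
    have pl: "plan_integral (flux (\<lambda>z. fst z ^ n * \<phi> z)) s (\<rho> s) = real n * s ^ (n - 1) * m s + s ^ n * g s" if s: "s \<in> {0..T}" for s
      using plan_integrable[OF flux_parts_continuous(4)[OF c] wcurveD[OF \<rho> s], of s]
        plan_integrable[OF continuous_on_snd_pair[OF c0] wcurveD[OF \<rho> s], of s]
      unfolding ev[OF s] g_def plan_integral_def flux_time_power[OF c] by simp
    have ci: "continuous_on {0..T} (\<lambda>s. real n * s ^ (n - 1) * m s + s ^ n * g s)" by (intro continuous_intros cm cg)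
    have "(\<integral>s. plan_integral (flux (\<lambda>z. fst z ^ n * \<phi> z)) s (\<rho> s) \<partial>lebesgue_on {0..T})
        = (\<integral>s. real n * s ^ (n - 1) * m s + s ^ n * g s \<partial>lebesgue_on {0..T})"
      by (intro Bochner_Integration.integral_cong) (auto simp: pl)
    also have "\<dots> = integral {0..T} (\<lambda>s. real n * s ^ (n - 1) * m s + s ^ n * g s)"
      by (intro lebesgue_integral_eq_integral continuous_imp_integrable_real ci) simp
    \<comment> \<open>\<open>0 ^ n\<close> is \<open>1\<close> exactly for \<open>n = 0\<close>, the
      only exponent for which the initial datum enters.\<close>
    finally have 1: "integral {0..T} (\<lambda>s. real n * s ^ (n - 1) * m s + s ^ n * g s) = T ^ n * m T - 0 ^ n * m0"
      using w \<phi>n by (auto simp: weak_form_def m_def m0_def)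
    have "((\<lambda>s. real n * s ^ (n - 1) * H s + s ^ n * g s) has_integral (T ^ n * H T - 0 ^ n * H 0)) {0..T}"
    proof (rule fundamental_theorem_of_calculus)
      fix s assume s: "s \<in> {0..T}"
      have "((\<lambda>s. s ^ n) has_real_derivative real n * s ^ (n - 1)) (at s within {0..T})"
        by (auto intro!: derivative_eq_intros)
      from DERIV_mult[OF this dH[OF s, unfolded has_real_derivative_iff_has_vector_derivative[symmetric]]]
      show "((\<lambda>s. s ^ n * H s) has_vector_derivative real n * s ^ (n - 1) * H s + s ^ n * g s) (at s within {0..T})"
        by (simp add: has_real_derivative_iff_has_vector_derivative[symmetric] mult.commute)
    qed (use T in simp)
    then have 2: "integral {0..T} (\<lambda>s. real n * s ^ (n - 1) * H s + s ^ n * g s) = T ^ n * H T - 0 ^ n * m0"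
      by (simp add: H_def integral_unique)
    have "integral {0..T} (\<lambda>s. real n * s ^ (n - 1) * (m s - H s))
        = integral {0..T} (\<lambda>s. (real n * s ^ (n - 1) * m s + s ^ n * g s) - (real n * s ^ (n - 1) * H s + s ^ n * g s))"
      by (simp add: algebra_simps)
    also have "\<dots> = T ^ n * (m T - H T)"
    proof -
      have "continuous_on {0..T} (\<lambda>s. real n * s ^ (n - 1) * H s + s ^ n * g s)" by (intro continuous_intros cH cg)
      from integral_diff[OF integrable_continuous_real[OF ci] integrable_continuous_real[OF this]]
      show ?thesis unfolding 1 2 by (simp add: algebra_simps)
    qed
    finally show ?thesis .
  qed
  have end_eq: "m T - H T = 0" using main[of 0] by simp
  have moments: "integral {0..T} (\<lambda>s. s ^ n * (m s - H s)) = 0" for n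
  proof -
    have "integral {0..T} (\<lambda>s. real (Suc n) * (s ^ n * (m s - H s))) = 0"
      using main[of "Suc n"] end_eq by (simp add: mult.assoc)
    then show ?thesis by (simp del: of_nat_Suc)
  qed
  have "continuous_on {0..T} (\<lambda>s. m s - H s)" by (intro continuous_intros cm cH)
  from continuous_moments_zero[OF this T moments t] have "m t - H t = 0" .
  then show ?thesis by (simp add: m_def H_def m0_def g_def[abs_def])
qed

lemma plan_integral_mono_bound:
  assumes G: "jointly_continuous G" and \<mu>: "\<mu> \<in> ball_measures M"
    and le: "\<And>x y. norm x \<le> r \<Longrightarrow> norm y \<le> M \<Longrightarrow> G t x y \<le> B"
  shows "plan_integral G t \<mu> \<le> B"
proof -
  have "plan_integral G t \<mu> \<le> (\<integral>x. B \<partial>vol)"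
    unfolding plan_integral_def
  proof (rule integral_mono_AE[OF plan_integrable[OF G \<mu>]])
    show "AE x in vol. G t x (brenier_map \<mu> x) \<le> B"
      using brenier_map(3)[OF \<mu>] AE_vol_le by eventually_elim (rule le)
  qed simp
  then show ?thesis using vol.prob_space by simp
qed

lemma plan_integral_abs_bound:
  assumes G: "jointly_continuous G" and \<mu>: "\<mu> \<in> ball_measures M"
    and le: "\<And>x y. norm x \<le> r \<Longrightarrow> norm y \<le> M \<Longrightarrow> \<bar>G t x y\<bar> \<le> B"
  shows "\<bar>plan_integral G t \<mu>\<bar> \<le> B"
proof -
  have "jointly_continuous (\<lambda>t x y. - G t x y)" using G unfolding case_prod_beta' by (intro continuous_intros)
  from plan_integral_mono_bound[OF this \<mu>, of t B] have "plan_integral (\<lambda>t x y. - G t x y) t \<mu> \<le> B"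
    using le by (simp add: abs_le_iff)
  moreover have "plan_integral G t \<mu> \<le> B" using le by (intro plan_integral_mono_bound[OF G \<mu>]) (simp add: abs_le_iff)
  ultimately show ?thesis by (simp add: plan_integral_def)
qed

text \<open>The extra \<open>1\<close> in the radius puts \<open>(t, y)\<close> into an open ball on
  which the cutoff is \<open>1\<close>, so derivatives agree and not only values.\<close>

lemma flux_cutoff:
  assumes \<psi>: "\<And>k. C_k k \<psi>" and t: "\<bar>t\<bar> \<le> T" and y: "norm y \<le> M"
  shows "flux (\<lambda>z. cutoff (T + M + 1) z * \<psi> z) t x y = flux \<psi> t x y"
proof (rule flux_cong[OF \<psi>, where U = "ball 0 (T + M + 1)"])
  have "norm (t, y) \<le> \<bar>t\<bar> + norm y" using norm_Pair_le[of t y] by simp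
  then show "(t, y) \<in> ball 0 (T + M + 1)" using t y by simp
  show "cutoff (T + M + 1) z * \<psi> z = \<psi> z" if "z \<in> ball 0 (T + M + 1)" for z
    using that by (simp add: cutoff_eq_1)
qed simp

text \<open>All measures live on one ball and times are bounded, so replacing a smooth function by
  its cutoff changes no term.\<close>

lemma weak_form_smooth:
  assumes \<rho>: "wcurve M T \<rho>" and T: "T > 0" and w: "weak_form T \<rho>0 \<rho>" and \<rho>0: "\<rho>0 \<in> ball_measures M"
    and \<psi>: "\<And>k. C_k k \<psi>" and t: "t \<in> {0..T}"
  shows "(\<integral>y. \<psi> (t, y) \<partial>\<rho> t) = (\<integral>y. \<psi> (0, y) \<partial>\<rho>0) + integral {0..t} (\<lambda>s. plan_integral (flux \<psi>) s (\<rho> s))"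
proof -
  define \<phi> where "\<phi> z = cutoff (T + M + 1) z * \<psi> z" for z
  have M: "M \<ge> 0" by (rule ball_measures_nonneg[OF \<rho>0])
  have \<phi>: "\<phi> \<in> test_functions" unfolding \<phi>_def using T M by (intro cutoff_test_functions \<psi>) simp
  have eq: "\<phi> (s, y) = \<psi> (s, y)" if "s \<in> {0..T}" "norm y \<le> M" for s y
  proof -
    have "norm (s, y) \<le> T + M + 1" using norm_Pair_le[of s y] that by simp
    then show ?thesis by (simp add: \<phi>_def cutoff_eq_1)
  qed
  have int_eq: "(\<integral>y. \<phi> (s, y) \<partial>\<mu>) = (\<integral>y. \<psi> (s, y) \<partial>\<mu>)" if s: "s \<in> {0..T}" and \<mu>: "\<mu> \<in> ball_measures M" for s \<mu>
  proof (rule integral_cong_AE)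
    show "AE y in \<mu>. \<phi> (s, y) = \<psi> (s, y)" using ball_measuresD(2)[OF \<mu>] by eventually_elim (rule eq[OF s])
    have "continuous_on UNIV (\<lambda>y. f (s, y))" if "C_k 0 f" for f :: "real \<times> (real ^ 3) \<Rightarrow> real"
      by (rule continuous_on_compose2[OF C_k_continuous[OF that]]) (auto intro!: continuous_intros)
    moreover have "C_k 0 \<phi>" using \<phi> unfolding test_functions_def by blast
    ultimately show "(\<lambda>y. \<phi> (s, y)) \<in> borel_measurable \<mu>" "(\<lambda>y. \<psi> (s, y)) \<in> borel_measurable \<mu>"
      using ball_measures_integrable_continuous[OF \<mu>] \<psi>[of 0] by (blast dest: borel_measurable_integrable)+
  qed
  have "plan_integral (flux \<phi>) s (\<rho> s) = plan_integral (flux \<psi>) s (\<rho> s)" if s: "s \<in> {0..t}" for s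
    unfolding plan_integral_def
  proof (rule integral_cong_AE)
    have s': "s \<in> {0..T}" using s t by auto
    note b = wcurveD[OF \<rho> s']
    show "AE x in vol. flux \<phi> s x (brenier_map (\<rho> s) x) = flux \<psi> s x (brenier_map (\<rho> s) x)"
      using brenier_map(3)[OF b] by eventually_elim (use s' in \<open>simp add: \<phi>_def[abs_def] flux_cutoff[OF \<psi>]\<close>)
    show "(\<lambda>x. flux \<phi> s x (brenier_map (\<rho> s) x)) \<in> borel_measurable vol"
      "(\<lambda>x. flux \<psi> s x (brenier_map (\<rho> s) x)) \<in> borel_measurable vol"
      using plan_integrable[OF flux_parts_continuous(4)[OF test_functions_C1[OF \<phi>]] b]
        plan_integrable[OF flux_parts_continuous(4)[OF \<psi>] b] by auto
  qed
  then have "integral {0..t} (\<lambda>s. plan_integral (flux \<phi>) s (\<rho> s)) = integral {0..t} (\<lambda>s. plan_integral (flux \<psi>) s (\<rho> s))"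
    by (intro Henstock_Kurzweil_Integration.integral_cong)
  then show ?thesis
    using weak_form_local[OF \<rho> T w \<phi> t] int_eq[OF t wcurveD[OF \<rho> t]] int_eq[OF _ \<rho>0, of 0] T by simp
qed

lemma flat_1_deriv:
  obtains S' where "\<And>x. (flat 1 has_real_derivative S' x) (at x)" "\<And>x. S' x \<ge> 0"
proof -
  have "flat ([:0, 0, 1:] * (1 - pderiv 1)) x \<ge> 0" for x by (simp add: flat_def pderiv_1)
  then show ?thesis using that[OF flat_deriv] by blast
qed

section \<open>Bounds on support and speed\<close>

text \<open>Up to time \<open>T\<close> the test function of \<open>weak_form_support\<close>
  vanishes only where \<open>y \<bullet> y + 1\<close> is at most
  \<open>exp (r * T) * (R\<^sup>2 + 1)\<close>; the radius drops the \<open>1\<close> on the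
  left.\<close>

definition support_bound :: "real \<Rightarrow> real \<Rightarrow> real"
  where "support_bound R T = sqrt (exp (r * T) * (R\<^sup>2 + 1))"

text \<open>The test function \<open>S(e\<^sup>-\<^sup>r\<^sup>t (|y|\<^sup>2 + 1) - (R\<^sup>2 + 1))\<close>, with \<open>S\<close> non-decreasing and vanishing exactly on
  \<open>(-\<infinity>,0]\<close>, is non-increasing along the flow since \<open>y\<close> is orthogonal to \<open>perp y\<close>.\<close>

lemma weak_form_support:
  assumes \<rho>: "wcurve M T \<rho>" and T: "T > 0" and w: "weak_form T \<rho>0 \<rho>" and \<rho>0: "\<rho>0 \<in> ball_measures R"
    and t: "t \<in> {0..T}"
  shows "\<rho> t \<in> ball_measures (support_bound R T)"
proof -
  \<comment> \<open>\<open>M\<close> is whatever ball the curve happens to live on. It makes the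
    integrals meaningful, and the final radius is free of it.\<close>
  define N where "N = max M R"
  have \<rho>N: "wcurve N T \<rho>" using \<rho> ball_measures_mono[of M N] by (auto simp: wcurve_def N_def)
  have \<rho>0N: "\<rho>0 \<in> ball_measures N" using \<rho>0 ball_measures_mono[of R N] by (auto simp: N_def)
  define q where "q z = exp ((- r) * fst z) * (snd z \<bullet> snd z + 1) - (R\<^sup>2 + 1)" for z :: "real \<times> (real ^ 3)"
  define \<psi> where "\<psi> z = flat 1 (q z)" for z
  have Cexp: "C_k k (exp :: real \<Rightarrow> real)" for k
  proof (induction k)
    case (Suc k)
    show ?case by (rule C_k_DERIV[OF _ Suc]) (auto intro!: derivative_eq_intros)
  qed (simp add: continuous_on_exp)
  have Csnd: "C_k k (\<lambda>z :: real \<times> (real ^ 3). snd z \<bullet> snd z)" for k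
  proof -
    have "(\<lambda>z :: real \<times> (real ^ 3). snd z \<bullet> snd z) = (\<lambda>z. \<Sum>b\<in>Basis. (snd z \<bullet> b) * (snd z \<bullet> b))"
      by (rule ext, rule euclidean_inner)
    moreover have "C_k k (\<lambda>z :: real \<times> (real ^ 3). \<Sum>b\<in>Basis. (snd z \<bullet> b) * (snd z \<bullet> b))"
      by (intro C_k_sum C_k_mult C_k_bounded_linear bounded_linear_inner_left_comp bounded_linear_snd)
    ultimately show ?thesis by simp
  qed
  have Cq: "C_k k q" for k
  proof -
    have "C_k k (\<lambda>z :: real \<times> (real ^ 3). exp ((- r) * fst z))" by (rule C_k_compose[OF Cexp C_k_cmult[OF C_k_fst]])
    then show ?thesis unfolding q_def[abs_def] by (intro C_k_diff C_k_mult C_k_add C_k_const Csnd)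
  qed
  have C\<psi>: "C_k k \<psi>" for k unfolding \<psi>_def[abs_def] by (rule C_k_compose[OF C_k_flat Cq])
  obtain S' where S': "\<And>x. (flat 1 has_real_derivative S' x) (at x)" "\<And>x. S' x \<ge> 0" using flat_1_deriv by blast
  have flux_le: "flux \<psi> s x y \<le> 0" if x: "norm x \<le> r" for s x y
  proof -
    have "((\<lambda>s. q (s, y)) has_real_derivative (- r) * exp ((- r) * s) * (y \<bullet> y + 1)) (at s)"
      unfolding q_def by (auto intro!: derivative_eq_intros)
    from DERIV_chain2[OF S'(1) this]
    have 1: "time_derivative \<psi> (s, y) = S' (q (s, y)) * ((- r) * exp ((- r) * s) * (y \<bullet> y + 1))"
      using DERIV_unique[OF time_derivative_eq(1)[OF C\<psi>]] by (simp add: \<psi>_def)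
    have "GDERIV (\<lambda>y. q (s, y)) y :> (2 * exp ((- r) * s)) *\<^sub>R y"
      unfolding q_def gderiv_def by (auto intro!: derivative_eq_intros simp: inner_commute algebra_simps)
    from GDERIV_DERIV_compose[OF this S'(1)]
    have 2: "space_gradient \<psi> (s, y) = S' (q (s, y)) *\<^sub>R (2 * exp ((- r) * s)) *\<^sub>R y"
      using space_gradient_eq(2)[OF C\<psi>, of s y] grad_eqI by (fastforce simp: \<psi>_def)
    have "flux \<psi> s x y = S' (q (s, y)) * exp ((- r) * s) * (2 * (y \<bullet> perp x) - r * (y \<bullet> y + 1))"
      unfolding flux_def 1 2 by (simp add: perp_diff inner_diff_right inner_perp_self algebra_simps)
    \<comment> \<open>Only the label contributes to radial growth, and
      \<open>2 * norm y \<le> y \<bullet> y + 1\<close> absorbs it; hence the \<open>+ 1\<close> and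
      the decay rate \<open>r\<close> in the test function.\<close>
    moreover have "2 * (y \<bullet> perp x) \<le> r * (y \<bullet> y + 1)"
    proof -
      have "y \<bullet> perp x \<le> norm y * norm (perp x)" by (rule norm_cauchy_schwarz)
      also have "\<dots> \<le> norm y * r" using norm_perp_le[of x] x by (intro mult_left_mono) auto
      finally have "2 * (y \<bullet> perp x) \<le> r * (2 * norm y)" by (simp add: mult.commute)
      also have "\<dots> \<le> r * (y \<bullet> y + 1)"
        proof (intro mult_left_mono r_nonneg)
        have "0 \<le> (norm y - 1)\<^sup>2" by simp
        then show "2 * norm y \<le> y \<bullet> y + 1" by (simp add: power2_diff power2_norm_eq_inner)
      qed
      finally show ?thesis .
    qed
    ultimately show ?thesis using S'(2) by (simp add: mult_nonneg_nonpos)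
  qed
  have "(\<integral>y. \<psi> (t, y) \<partial>\<rho> t) = (\<integral>y. \<psi> (0, y) \<partial>\<rho>0) + integral {0..t} (\<lambda>s. plan_integral (flux \<psi>) s (\<rho> s))"
    by (rule weak_form_smooth[OF \<rho>N T w \<rho>0N C\<psi> t])
  moreover have "(\<integral>y. \<psi> (0, y) \<partial>\<rho>0) = 0"
  proof (rule integral_eq_zero_AE)
    show "AE y in \<rho>0. \<psi> (0, y) = 0" using ball_measuresD(2)[OF \<rho>0]
    proof eventually_elim
      fix y :: "real ^ 3" assume "norm y \<le> R"
      then have "(norm y)\<^sup>2 \<le> R\<^sup>2" by (intro power_mono) auto
      then show "\<psi> (0, y) = 0" by (simp add: \<psi>_def q_def flat_1(2) power2_norm_eq_inner)
    qed
  qed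
  moreover have "integral {0..t} (\<lambda>s. plan_integral (flux \<psi>) s (\<rho> s)) \<le> integral {0..t} (\<lambda>s. 0)"
  proof (rule integral_le)
    note G = flux_parts_continuous(4)[OF C\<psi>]
    show "(\<lambda>s. plan_integral (flux \<psi>) s (\<rho> s)) integrable_on {0..t}"
      by (intro integrable_continuous_real continuous_on_subset[OF wcurve_plan_continuous[OF \<rho> G]]) (use t in auto)
    show "plan_integral (flux \<psi>) s (\<rho> s) \<le> 0" if "s \<in> {0..t}" for s
      using that t by (intro plan_integral_mono_bound[OF G wcurveD[OF \<rho>]] flux_le) auto
  qed auto
  ultimately have le: "(\<integral>y. \<psi> (t, y) \<partial>\<rho> t) \<le> 0" by simp
  have c\<psi>: "continuous_on UNIV (\<lambda>y. \<psi> (t, y))"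
    by (rule continuous_on_compose2[OF C_k_continuous[OF C\<psi>[of 0]]]) (auto intro!: continuous_intros)
  note i = ball_measures_integrable_continuous[OF wcurveD[OF \<rho> t] c\<psi>]
  have nn: "0 \<le> \<psi> z" for z by (simp add: \<psi>_def flat_1)
  \<comment> \<open>A nonnegative function with nonpositive integral vanishes almost everywhere, and
    \<open>flat 1\<close> vanishes only at nonpositive arguments.\<close>
  have "(\<integral>y. \<psi> (t, y) \<partial>\<rho> t) = 0" using le nn by (intro antisym integral_nonneg_AE) auto
  then have "AE y in \<rho> t. \<psi> (t, y) = 0" using integral_nonneg_eq_0_iff_AE[OF i] nn by auto
  then have "AE y in \<rho> t. y \<in> cball 0 (support_bound R T)"
  proof eventually_elim
    fix y assume "\<psi> (t, y) = 0"
    then have "q (t, y) \<le> 0" using flat_1(3)[of "q (t, y)"] by (cases "q (t, y) > 0") (auto simp: \<psi>_def)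
    then have "y \<bullet> y + 1 \<le> exp (r * t) * (R\<^sup>2 + 1)" by (simp add: q_def exp_minus field_simps)
    also have "\<dots> \<le> exp (r * T) * (R\<^sup>2 + 1)" using t r_nonneg by (intro mult_right_mono) (auto simp: mult_left_mono)
    finally have "(norm y)\<^sup>2 \<le> exp (r * T) * (R\<^sup>2 + 1)" by (simp add: power2_norm_eq_inner)
    then show "y \<in> cball 0 (support_bound R T)" by (simp add: support_bound_def real_le_rsqrt)
  qed
  then show ?thesis using ball_measuresD(1)[OF wcurveD[OF \<rho> t]] by (simp add: ball_measures_def)
qed

text \<open>The directional derivative along \<open>D\<close> itself is
  \<open>D \<bullet> D\<close>, while the difference quotients are at most
  \<open>norm D\<close>.\<close>

lemma GDERIV_nonexpansive:
  fixes f :: "'a::euclidean_space \<Rightarrow> real"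
  assumes lip: "1-lipschitz_on UNIV f" and D: "GDERIV f x :> D"
  shows "norm D \<le> 1"
proof -
  have "((\<lambda>t. (f (x + t *\<^sub>R D) - f x) / t) \<longlongrightarrow> D \<bullet> D) (at 0)"
    using GDERIV_line[OF D, of D] by (simp add: has_field_derivative_iff)
  moreover have "eventually (\<lambda>t. (f (x + t *\<^sub>R D) - f x) / t \<le> norm D) (at (0 :: real))"
    unfolding eventually_at_filter
  proof (intro always_eventually allI impI)
    fix t :: real assume "t \<noteq> 0"
    have "\<bar>f (x + t *\<^sub>R D) - f x\<bar> \<le> \<bar>t\<bar> * norm D" using lipschitz_onD[OF lip, of "x + t *\<^sub>R D" x] by (simp add: dist_norm)
    then have "\<bar>(f (x + t *\<^sub>R D) - f x) / t\<bar> \<le> norm D" using \<open>t \<noteq> 0\<close> by (simp add: abs_divide divide_le_eq mult.commute)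
    then show "(f (x + t *\<^sub>R D) - f x) / t \<le> norm D" by linarith
  qed
  ultimately have "D \<bullet> D \<le> norm D" by (intro tendsto_upperbound) auto
  then have "norm D * norm D \<le> norm D * 1" by (simp add: dot_square_norm power2_eq_square)
  then show ?thesis by (cases "D = 0") auto
qed

text \<open>A time-independent 1-Lipschitz function has gradient of norm at most \<open>1\<close>,
  so its flux is bounded by the maximal speed \<open>M + r\<close>, uniformly over the class
  defining \<open>wdist\<close>.\<close>

lemma weak_form_lipschitz:
  assumes \<rho>: "wcurve M T \<rho>" and T: "T > 0" and w: "weak_form T \<rho>0 \<rho>" and \<rho>0: "\<rho>0 \<in> ball_measures M"
    and s: "s \<in> {0..T}" and t: "t \<in> {0..T}"
  shows "wdist (\<rho> s) (\<rho> t) \<le> (M + r) * \<bar>s - t\<bar>"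
proof (rule wdist_le)
  fix f assume f: "f \<in> smooth_nonexpansive"
  define \<psi> where "\<psi> z = f (snd z)" for z :: "real \<times> (real ^ 3)"
  have Cf: "C_k k f" for k using f by (simp add: smooth_nonexpansive_def)
  have C\<psi>: "C_k k \<psi>" for k
  proof -
    \<comment> \<open>Stated for general \<open>g\<close>, since the induction passes to partial
      derivatives, which need not be 1-Lipschitz.\<close>
    have "C_k k (\<lambda>z :: real \<times> (real ^ 3). g (snd z))" if "C_k k g" for g :: "real ^ 3 \<Rightarrow> real"
      using that
    proof (induction k arbitrary: g)
      case 0
      then show ?case by (auto intro!: continuous_on_compose2[of UNIV g] continuous_intros)
    next
      case (Suc k)
      show ?case
      proof (rule C_k_SucI)
        fix z :: "real \<times> (real ^ 3)"
        show "((\<lambda>z. g (snd z)) has_derivative (\<lambda>h. frechet_derivative g (at (snd z)) (snd h))) (at z)"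
          by (rule has_derivative_compose[OF _ C_k_SucD(1)[OF Suc.prems]]) (auto intro!: derivative_eq_intros)
      next
        fix b :: "real \<times> (real ^ 3)" assume b: "b \<in> Basis"
        show "C_k k (\<lambda>z :: real \<times> (real ^ 3). frechet_derivative g (at (snd z)) (snd b))"
        \<comment> \<open>The second component of a basis vector of the product is a basis vector
          or, in the time direction, \<open>0\<close>.\<close>
        proof (cases "snd b \<in> Basis")
          case True
          then show ?thesis by (intro Suc.IH C_k_SucD(2)[OF Suc.prems])
        next
          case False
          then have "snd b = 0" using b by (auto simp: Basis_prod_def)
          moreover have "frechet_derivative g (at y) 0 = 0" for y
            using has_derivative_linear[OF C_k_SucD(1)[OF Suc.prems]] by (rule linear_0)
          ultimately show ?thesis by (simp add: C_k_const)
        qed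
      qed
    qed
    then show ?thesis unfolding \<psi>_def[abs_def] using Cf by blast
  qed
  note G = flux_parts_continuous(4)[OF C\<psi>]
  have M: "M \<ge> 0" by (rule ball_measures_nonneg[OF \<rho>0])
  have flux_le: "\<bar>flux \<psi> u x y\<bar> \<le> M + r" if "norm x \<le> r" "norm y \<le> M" for u x y
  proof -
    have "((\<lambda>u. \<psi> (u, y)) has_real_derivative 0) (at u)" by (simp add: \<psi>_def)
    then have 1: "time_derivative \<psi> (u, y) = 0" using DERIV_unique[OF time_derivative_eq(1)[OF C\<psi>]] by blast
    have "GDERIV f y :> space_gradient \<psi> (u, y)" using space_gradient_eq(1)[OF C\<psi>, of u y] by (simp add: \<psi>_def)
    then have g: "norm (space_gradient \<psi> (u, y)) \<le> 1" using f by (intro GDERIV_nonexpansive) (auto simp: smooth_nonexpansive_def)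
    have "\<bar>space_gradient \<psi> (u, y) \<bullet> perp (x - y)\<bar> \<le> norm (space_gradient \<psi> (u, y)) * norm (perp (x - y))"
      by (rule Cauchy_Schwarz_ineq2)
    also have "\<dots> \<le> 1 * (M + r)"
      using g norm_perp_le[of "x - y"] norm_triangle_ineq4[of x y] that by (intro mult_mono) auto
    finally show ?thesis by (simp add: flux_def 1)
  qed
  have bnd: "\<bar>plan_integral (flux \<psi>) u (\<rho> u)\<bar> \<le> M + r" if "u \<in> {0..T}" for u
    by (rule plan_integral_abs_bound[OF G wcurveD[OF \<rho> that] flux_le])
  have cg: "continuous_on {0..T} (\<lambda>u. plan_integral (flux \<psi>) u (\<rho> u))" by (rule wcurve_plan_continuous[OF \<rho> G])
  have *: "\<bar>(\<integral>y. f y \<partial>\<rho> t) - (\<integral>y. f y \<partial>\<rho> s)\<bar> \<le> (M + r) * (t - s)" if s: "s \<in> {0..T}" and t: "t \<in> {0..T}" and st: "s \<le> t" for s t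
  proof -
    have i: "(\<lambda>u. plan_integral (flux \<psi>) u (\<rho> u)) integrable_on {0..t}"
      by (intro integrable_continuous_real continuous_on_subset[OF cg]) (use t in auto)
    have "(\<integral>y. f y \<partial>\<rho> t) - (\<integral>y. f y \<partial>\<rho> s) = integral {0..t} (\<lambda>u. plan_integral (flux \<psi>) u (\<rho> u)) - integral {0..s} (\<lambda>u. plan_integral (flux \<psi>) u (\<rho> u))"
      using weak_form_smooth[OF \<rho> T w \<rho>0 C\<psi> t] weak_form_smooth[OF \<rho> T w \<rho>0 C\<psi> s] by (simp add: \<psi>_def)
    also have "\<dots> = integral {s..t} (\<lambda>u. plan_integral (flux \<psi>) u (\<rho> u))"
      using Henstock_Kurzweil_Integration.integral_combine[OF _ st i] s by simp
    also have "\<bar>\<dots>\<bar> \<le> (M + r) * (t - s)"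
    proof -
      have "continuous_on {s..t} (\<lambda>u. plan_integral (flux \<psi>) u (\<rho> u))" using s t by (intro continuous_on_subset[OF cg]) auto
      from integral_bound[OF st this, of "M + r"] show ?thesis using bnd s t by simp
    qed
    finally show ?thesis .
  qed
  show "\<bar>(\<integral>y. f y \<partial>\<rho> s) - (\<integral>y. f y \<partial>\<rho> t)\<bar> \<le> (M + r) * \<bar>s - t\<bar>"
    using *[OF s t] *[OF t s] by (cases "s \<le> t") (auto simp: abs_minus_commute)
qed

end

section \<open>Compactness of solutions\<close>

abbreviation real_curves :: "real \<Rightarrow> (real \<Rightarrow> real) metric"
  where "real_curves T \<equiv> cfunspace (top_of_set {0..T}) euclidean_metric"

lemma weak_star_curve_prob:
  assumes c: "continuous_map (top_of_set {0..T}) weak_star \<rho>" and t: "t \<in> {0..T}"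
  shows "\<rho> t \<in> prob_measures"
  using continuous_map_funspace[OF c] t by (auto simp: Pi_iff topspace_weak_star)

context source_domain
begin

section \<open>Compact sets of Lipschitz curves\<close>

text \<open>All solutions with data in one ball, restricted to \<open>[0, T]\<close>, lie in one
  such set. It carries a genuine metric, so sequential compactness is enough there.\<close>

definition lip_curves :: "real \<Rightarrow> real \<Rightarrow> real \<Rightarrow> (real \<Rightarrow> (real ^ 3) measure) set"
  where "lip_curves M C T = {\<rho> \<in> extensional {0..T}. (\<forall>t\<in>{0..T}. \<rho> t \<in> ball_measures M) \<and>
    (\<forall>s\<in>{0..T}. \<forall>t\<in>{0..T}. wdist (\<rho> s) (\<rho> t) \<le> C * \<bar>s - t\<bar>)}"

definition curve_dist :: "real \<Rightarrow> (real \<Rightarrow> (real ^ 3) measure) \<Rightarrow> (real \<Rightarrow> (real ^ 3) measure) \<Rightarrow> real"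
  where "curve_dist T \<rho> \<sigma> = (SUP t\<in>{0..T}. wdist (\<rho> t) (\<sigma> t))"

lemma lip_curvesD:
  assumes "\<rho> \<in> lip_curves M C T"
  shows "\<rho> \<in> extensional {0..T}" "\<And>t. t \<in> {0..T} \<Longrightarrow> \<rho> t \<in> ball_measures M"
    "\<And>s t. s \<in> {0..T} \<Longrightarrow> t \<in> {0..T} \<Longrightarrow> wdist (\<rho> s) (\<rho> t) \<le> C * \<bar>s - t\<bar>" "wcurve M T \<rho>"
  using assms wcurveI_lipschitz[of T \<rho> M C] by (auto simp: lip_curves_def)

lemma wdist_le_radii:
  assumes "\<mu> \<in> ball_measures M" "\<nu> \<in> ball_measures N" shows "wdist \<mu> \<nu> \<le> M + N"
  by (rule wdist_le) (rule wdist_bdd[OF assms])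

context
  fixes M C T :: real
  assumes T: "T > 0"
begin

lemma curve_dist_upper:
  assumes "\<rho> \<in> lip_curves M C T" "\<sigma> \<in> lip_curves M C T" "t \<in> {0..T}"
  shows "wdist (\<rho> t) (\<sigma> t) \<le> curve_dist T \<rho> \<sigma>"
  unfolding curve_dist_def
proof (rule cSUP_upper[OF assms(3)])
  show "bdd_above ((\<lambda>t. wdist (\<rho> t) (\<sigma> t)) ` {0..T})"
    by (rule bdd_aboveI2[where M = "M + M"]) (intro wdist_le_radii lip_curvesD(2)[OF assms(1)] lip_curvesD(2)[OF assms(2)])
qed

lemma curve_dist_least: "(\<And>t. t \<in> {0..T} \<Longrightarrow> wdist (\<rho> t) (\<sigma> t) \<le> e) \<Longrightarrow> curve_dist T \<rho> \<sigma> \<le> e"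
  unfolding curve_dist_def using T by (intro cSUP_least) auto

text \<open>\<open>Metric_space\<close> asks for nonnegativity and symmetry at all arguments, while
  the supremum \<open>curve_dist\<close> is controlled only for curves in a common ball; hence the
  value \<open>0\<close> elsewhere.\<close>

lemma lip_curves_metric: "Metric_space (lip_curves M C T) (\<lambda>\<rho> \<sigma>. if \<rho> \<in> lip_curves M C T \<and> \<sigma> \<in> lip_curves M C T then curve_dist T \<rho> \<sigma> else 0)"
proof
  note b = lip_curvesD(2)
  have T0: "0 \<in> {0..T}" using T by simp
  have nn: "0 \<le> curve_dist T \<rho> \<sigma>" if "\<rho> \<in> lip_curves M C T" "\<sigma> \<in> lip_curves M C T" for \<rho> \<sigma>
    using curve_dist_upper[OF that T0] wdist_nonneg[OF b[OF that(1) T0] b[OF that(2) T0]] by linarith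
  show "0 \<le> (if \<rho> \<in> lip_curves M C T \<and> \<sigma> \<in> lip_curves M C T then curve_dist T \<rho> \<sigma> else 0)" for \<rho> \<sigma>
    using nn by simp
  have sym: "curve_dist T \<rho> \<sigma> = curve_dist T \<sigma> \<rho>" for \<rho> \<sigma>
    unfolding curve_dist_def by (simp add: wdist_sym)
  then show "(if \<rho> \<in> lip_curves M C T \<and> \<sigma> \<in> lip_curves M C T then curve_dist T \<rho> \<sigma> else 0) =
      (if \<sigma> \<in> lip_curves M C T \<and> \<rho> \<in> lip_curves M C T then curve_dist T \<sigma> \<rho> else 0)" for \<rho> \<sigma>
    by (simp add: conj_commute)
  fix \<rho> \<sigma> assume \<rho>: "\<rho> \<in> lip_curves M C T" and \<sigma>: "\<sigma> \<in> lip_curves M C T"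
  show "(if \<rho> \<in> lip_curves M C T \<and> \<sigma> \<in> lip_curves M C T then curve_dist T \<rho> \<sigma> else 0) = 0 \<longleftrightarrow> \<rho> = \<sigma>"
  proof
    assume "(if \<rho> \<in> lip_curves M C T \<and> \<sigma> \<in> lip_curves M C T then curve_dist T \<rho> \<sigma> else 0) = 0"
    then have "curve_dist T \<rho> \<sigma> = 0" using \<rho> \<sigma> by simp
    then have "\<rho> t = \<sigma> t" if "t \<in> {0..T}" for t
      using curve_dist_upper[OF \<rho> \<sigma> that] wdist_nonneg[OF b[OF \<rho> that] b[OF \<sigma> that]]
      by (intro wdist_eq_0[OF b[OF \<rho> that] b[OF \<sigma> that]]) simp
    then show "\<rho> = \<sigma>" by (rule extensionalityI[OF lip_curvesD(1)[OF \<rho>] lip_curvesD(1)[OF \<sigma>]])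
  next
    assume "\<rho> = \<sigma>"
    then have "curve_dist T \<rho> \<sigma> \<le> 0" by (intro curve_dist_least) (simp add: wdist_self)
    then show "(if \<rho> \<in> lip_curves M C T \<and> \<sigma> \<in> lip_curves M C T then curve_dist T \<rho> \<sigma> else 0) = 0"
      using nn[OF \<rho> \<sigma>] by simp
  qed
  fix \<tau> assume \<tau>: "\<tau> \<in> lip_curves M C T"
  have "curve_dist T \<rho> \<tau> \<le> curve_dist T \<rho> \<sigma> + curve_dist T \<sigma> \<tau>"
  proof (rule curve_dist_least)
    fix t assume t: "t \<in> {0..T}"
    show "wdist (\<rho> t) (\<tau> t) \<le> curve_dist T \<rho> \<sigma> + curve_dist T \<sigma> \<tau>"
      using wdist_triangle[OF b[OF \<rho> t] b[OF \<sigma> t] b[OF \<tau> t]] curve_dist_upper[OF \<rho> \<sigma> t] curve_dist_upper[OF \<sigma> \<tau> t] by linarith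
  qed
  then show "(if \<rho> \<in> lip_curves M C T \<and> \<tau> \<in> lip_curves M C T then curve_dist T \<rho> \<tau> else 0)
      \<le> (if \<rho> \<in> lip_curves M C T \<and> \<sigma> \<in> lip_curves M C T then curve_dist T \<rho> \<sigma> else 0)
        + (if \<sigma> \<in> lip_curves M C T \<and> \<tau> \<in> lip_curves M C T then curve_dist T \<sigma> \<tau> else 0)"
    using \<rho> \<sigma> \<tau> by simp
qed

interpretation L: Metric_space "lip_curves M C T"
    "\<lambda>\<rho> \<sigma>. if \<rho> \<in> lip_curves M C T \<and> \<sigma> \<in> lip_curves M C T then curve_dist T \<rho> \<sigma> else 0"
  by (rule lip_curves_metric)

text \<open>A common Lipschitz constant reduces uniform convergence to a finite net of
  times.\<close>

lemma lip_curves_pointwise_imp_uniform: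
  assumes \<rho>: "\<And>n. \<rho> n \<in> lip_curves M C T" and \<sigma>: "\<sigma> \<in> lip_curves M C T" and C: "C \<ge> 0"
    and lim: "\<And>t. t \<in> {0..T} \<Longrightarrow> (\<lambda>n. wdist (\<rho> n t) (\<sigma> t)) \<longlonglongrightarrow> 0"
  shows "limitin L.mtopology \<rho> \<sigma> sequentially"
  unfolding L.limit_metric_sequentially
proof (intro conjI allI impI \<sigma>)
  fix e :: real assume e: "0 < e"
  \<comment> \<open>\<open>C + 1\<close> avoids division by \<open>0\<close>. The two Lipschitz
    errors together stay below \<open>e / 2\<close>, and the net contributes
    \<open>e / 4\<close>.\<close>
  define d where "d = e / (4 * (C + 1))"
  have d: "d > 0" "2 * (C * d) < e / 2"
  proof -
    show "d > 0" using e C by (simp add: d_def)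
    have "C * d < (C + 1) * d" using \<open>d > 0\<close> by simp
    also have "(C + 1) * d = e / 4" using C by (auto simp: d_def field_simps)
    finally show "2 * (C * d) < e / 2" by simp
  qed
  have "\<exists>k. finite k \<and> {0..T} \<subseteq> (\<Union>x\<in>k. ball x d)"
    using compact_Icc[of 0 T] d(1) unfolding compact_eq_totally_bounded by blast
  then obtain k0 where k0: "finite k0" "{0..T} \<subseteq> (\<Union>x\<in>k0. ball x d)" by blast
  \<comment> \<open>Net points may fall outside the interval; clamping brings them back and takes
    none farther from a time in \<open>[0, T]\<close>.\<close>
  define k where "k = (\<lambda>x. max 0 (min T x)) ` k0"
  have k: "finite k" "k \<subseteq> {0..T}" using k0(1) T by (auto simp: k_def)
  have near: "\<exists>x\<in>k. \<bar>t - x\<bar> \<le> d" if t: "t \<in> {0..T}" for t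
  proof -
    obtain x where x: "x \<in> k0" "\<bar>x - t\<bar> < d" using k0(2) t by (auto simp: dist_real_def)
    have "\<bar>t - max 0 (min T x)\<bar> \<le> d" using x(2) t by (auto simp: max_def min_def)
    then show ?thesis using x(1) by (auto simp: k_def)
  qed
  have "eventually (\<lambda>n. wdist (\<rho> n x) (\<sigma> x) < e / 4) sequentially" if "x \<in> k" for x
    using e by (intro order_tendstoD(2)[OF lim]) (use that k in auto)
  then have "eventually (\<lambda>n. \<forall>x\<in>k. wdist (\<rho> n x) (\<sigma> x) < e / 4) sequentially"
    using k(1) by (intro eventually_ball_finite) auto
  then obtain N where N: "\<And>n x. n \<ge> N \<Longrightarrow> x \<in> k \<Longrightarrow> wdist (\<rho> n x) (\<sigma> x) < e / 4" by (auto simp: eventually_sequentially)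
  have "curve_dist T (\<rho> n) \<sigma> \<le> 3 * e / 4" if n: "n \<ge> N" for n
  proof (rule curve_dist_least)
    fix t assume t: "t \<in> {0..T}"
    obtain x where x: "x \<in> k" "\<bar>t - x\<bar> \<le> d" using near[OF t] by blast
    then have x0: "x \<in> {0..T}" using k by blast
    note b = lip_curvesD(2)[OF \<rho>[of n]] and c = lip_curvesD(2)[OF \<sigma>]
    have Cd: "C * \<bar>t - x\<bar> \<le> C * d" using C x(2) by (intro mult_left_mono)
    have "wdist (\<rho> n t) (\<rho> n x) \<le> C * d" using lip_curvesD(3)[OF \<rho> t x0, of n] Cd by linarith
    moreover have "wdist (\<sigma> x) (\<sigma> t) \<le> C * d" using lip_curvesD(3)[OF \<sigma> x0 t] Cd by (simp add: abs_minus_commute)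
    ultimately show "wdist (\<rho> n t) (\<sigma> t) \<le> 3 * e / 4"
      using wdist_triangle[OF b[OF t] b[OF x0] c[OF t]] wdist_triangle[OF b[OF x0] c[OF x0] c[OF t]] N[OF n x(1)] d(2) by linarith
  qed
  then show "\<exists>N. \<forall>n\<ge>N. \<rho> n \<in> lip_curves M C T \<and>
      (if \<rho> n \<in> lip_curves M C T \<and> \<sigma> \<in> lip_curves M C T then curve_dist T (\<rho> n) \<sigma> else 0) < e"
    using \<rho> \<sigma> e by (intro exI[of _ N]) (force intro: le_less_trans)
qed

lemma lip_curves_compact:
  assumes C: "C \<ge> 0"
  shows "compactin L.mtopology (lip_curves M C T)"
  unfolding L.compactin_sequentially
proof (intro conjI allI impI subset_refl)
  fix \<rho> :: "nat \<Rightarrow> real \<Rightarrow> (real ^ 3) measure" assume "range \<rho> \<subseteq> lip_curves M C T"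
  then have \<rho>: "\<rho> n \<in> lip_curves M C T" for n by blast
  \<comment> \<open>Frozen after time \<open>T\<close>, the curves extend to the half-line on which
    \<open>curve_compactness\<close> works, with the same constant and zero curve error.\<close>
  define \<nu> where "\<nu> n t = \<rho> n (min T t)" for n t
  have \<nu>: "\<nu> n t \<in> ball_measures M" if "0 \<le> t" for n t
    unfolding \<nu>_def using that T by (intro lip_curvesD(2)[OF \<rho>]) auto
  have "\<exists>C\<ge>0. \<forall>n. \<forall>s\<in>{0..T'}. \<forall>t\<in>{0..T'}. wdist (\<nu> n s) (\<nu> n t) \<le> C * (\<bar>s - t\<bar> + 0)" for T'
  proof (intro exI[of _ C] conjI C allI ballI)
    fix n s t assume st: "s \<in> {0..T'}" "t \<in> {0..T'}"
    have "wdist (\<nu> n s) (\<nu> n t) \<le> C * \<bar>min T s - min T t\<bar>"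
      unfolding \<nu>_def using st T by (intro lip_curvesD(3)[OF \<rho>]) auto
    also have "\<dots> \<le> C * \<bar>s - t\<bar>" using C by (intro mult_left_mono) (auto simp: min_def)
    finally show "wdist (\<nu> n s) (\<nu> n t) \<le> C * (\<bar>s - t\<bar> + 0)" by simp
  qed
  from curve_compactness[of \<nu> "\<lambda>_. M" "\<lambda>_. 0", OF \<nu> tendsto_const this]
  obtain k \<sigma> where k: "strict_mono (k :: nat \<Rightarrow> nat)" and \<sigma>: "\<And>t. 0 \<le> t \<Longrightarrow> \<sigma> t \<in> ball_measures M"
    and lim: "\<And>t. 0 \<le> t \<Longrightarrow> (\<lambda>n. wdist (\<nu> (k n) t) (\<sigma> t)) \<longlonglongrightarrow> 0" by blast
  define \<sigma>' where "\<sigma>' = restrict \<sigma> {0..T}"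
  have lim': "(\<lambda>n. wdist (\<rho> (k n) t) (\<sigma> t)) \<longlonglongrightarrow> 0" if "t \<in> {0..T}" for t
    using lim[of t] that by (simp add: \<nu>_def)
  have \<sigma>': "\<sigma>' \<in> lip_curves M C T"
    unfolding lip_curves_def
  proof (intro CollectI conjI ballI)
    fix s t assume s: "s \<in> {0..T}" and t: "t \<in> {0..T}"
    have s0: "0 \<le> s" and t0: "0 \<le> t" using s t by auto
    have "wdist (\<sigma> s) (\<sigma> t) \<le> C * \<bar>s - t\<bar>"
      by (rule wdist_limit_le[OF lip_curvesD(2)[OF \<rho> s] lip_curvesD(2)[OF \<rho> t] \<sigma>[OF s0] \<sigma>[OF t0] lim'[OF s] lim'[OF t]
            lip_curvesD(3)[OF \<rho> s t] tendsto_const])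
    then show "wdist (\<sigma>' s) (\<sigma>' t) \<le> C * \<bar>s - t\<bar>" using s t by (simp add: \<sigma>'_def)
  qed (use \<sigma> in \<open>auto simp: \<sigma>'_def\<close>)
  have "limitin L.mtopology (\<lambda>n. \<rho> (k n)) \<sigma>' sequentially"
    using lim' by (intro lip_curves_pointwise_imp_uniform \<rho> \<sigma>' C) (simp add: \<sigma>'_def)
  then show "\<exists>l r. l \<in> lip_curves M C T \<and> strict_mono (r :: nat \<Rightarrow> nat) \<and> limitin L.mtopology (\<rho> \<circ> r) l sequentially"
    using k \<sigma>' by (auto simp: o_def)
qed

lemma measure_curves_integral_cfunspace:
  assumes \<rho>: "\<rho> \<in> measure_curves T" and f: "f \<in> C0_functions"
  shows "(\<lambda>t\<in>{0..T}. \<integral>x. f x \<partial>\<rho> t) \<in> mspace (real_curves T)"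
proof -
  have "continuous_on {0..T} (\<lambda>t. \<integral>x. f x \<partial>\<rho> t)"
    using \<rho> by (intro weak_star_integral_continuous[OF _ f]) (simp add: measure_curves_def)
  then have "continuous_on {0..T} (\<lambda>t\<in>{0..T}. \<integral>x. f x \<partial>\<rho> t)"
    by (subst continuous_on_cong[OF refl, where g = "\<lambda>t. \<integral>x. f x \<partial>\<rho> t"]) auto
  then show ?thesis by (subst compactin_mspace_cfunspace) (auto simp: compactin_subtopology)
qed

lemma lip_curves_measure_curves: "lip_curves M C T \<subseteq> measure_curves T"
proof
  fix \<rho> assume \<rho>: "\<rho> \<in> lip_curves M C T"
  then show "\<rho> \<in> measure_curves T"
    using lip_curvesD(1)[OF \<rho>] wcurve_imp_weak_star[OF lip_curvesD(4)[OF \<rho>]] by (simp add: measure_curves_def)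
qed

text \<open>\<open>curve_topology\<close> is pulled back from a product over all of
  \<open>C0_functions\<close> and is not given by a metric, so compactness is imported as a
  continuous image of the metric space above.\<close>

lemma lip_curves_continuous: "continuous_map L.mtopology (curve_topology T) (\<lambda>\<rho>. \<rho>)"
  unfolding curve_topology_def
proof (rule continuous_map_pullback')
  show "topspace L.mtopology \<subseteq> (\<lambda>\<rho>. \<rho>) -` measure_curves T" using lip_curves_measure_curves by simp
  have "continuous_map L.mtopology (mtopology_of (real_curves T)) (\<lambda>\<rho>. \<lambda>t\<in>{0..T}. \<integral>x. f x \<partial>\<rho> t)"
    if f: "f \<in> C0_functions" for f
    unfolding mtopology_of_def L.metric_continuous_map[OF Metric_space_mspace_mdist]
  proof (intro conjI ballI allI impI)
    show "(\<lambda>\<rho>. \<lambda>t\<in>{0..T}. \<integral>x. f x \<partial>\<rho> t) ` lip_curves M C T \<subseteq> mspace (real_curves T)"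
      using measure_curves_integral_cfunspace[OF _ f] lip_curves_measure_curves by blast
    fix \<rho> and e :: real assume \<rho>: "\<rho> \<in> lip_curves M C T" and e: "0 < e"
    have T0: "0 \<in> {0..T}" using T by simp
    have M: "M \<ge> 0" by (rule ball_measures_nonneg[OF lip_curvesD(2)[OF \<rho> T0]])
    have cf: "continuous_on UNIV f" using f by (simp add: C0_functions_def)
    obtain g c where g: "g \<in> smooth_nonexpansive" "c > 0" "\<And>y. norm y \<le> M \<Longrightarrow> \<bar>f y - c * g y\<bar> \<le> e / 8"
      using smooth_nonexpansive_approx[OF cf _ M, of "e / 8"] e by auto
    show "\<exists>\<delta>>0. \<forall>\<sigma>. \<sigma> \<in> lip_curves M C T \<and> (if \<rho> \<in> lip_curves M C T \<and> \<sigma> \<in> lip_curves M C T then curve_dist T \<rho> \<sigma> else 0) < \<delta> \<longrightarrow>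
        mdist (real_curves T) (\<lambda>t\<in>{0..T}. \<integral>x. f x \<partial>\<rho> t) (\<lambda>t\<in>{0..T}. \<integral>x. f x \<partial>\<sigma> t) < e"
    proof (intro exI[of _ "e / (4 * c)"] conjI allI impI)
      show "0 < e / (4 * c)" using e g by simp
      fix \<sigma> assume *: "\<sigma> \<in> lip_curves M C T \<and> (if \<rho> \<in> lip_curves M C T \<and> \<sigma> \<in> lip_curves M C T then curve_dist T \<rho> \<sigma> else 0) < e / (4 * c)"
      then have \<sigma>: "\<sigma> \<in> lip_curves M C T" and d: "curve_dist T \<rho> \<sigma> < e / (4 * c)" using \<rho> by auto
      have "mdist (real_curves T) (\<lambda>t\<in>{0..T}. \<integral>x. f x \<partial>\<rho> t) (\<lambda>t\<in>{0..T}. \<integral>x. f x \<partial>\<sigma> t) \<le> e / 2"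
      proof (rule mdist_cfunspace_le)
        fix t assume "t \<in> topspace (top_of_set {0..T})"
        then have t: "t \<in> {0..T}" by simp
        have "wdist (\<rho> t) (\<sigma> t) \<le> e / (4 * c)" using curve_dist_upper[OF \<rho> \<sigma> t] d by linarith
        then have "c * wdist (\<rho> t) (\<sigma> t) \<le> c * (e / (4 * c))" using g(2) by (intro mult_left_mono) auto
        also have "\<dots> = e / 4" using g(2) by simp
        finally have "\<bar>(\<integral>x. f x \<partial>\<rho> t) - (\<integral>x. f x \<partial>\<sigma> t)\<bar> \<le> e / 2"
          using wdist_integral_le[OF lip_curvesD(2)[OF \<rho> t] lip_curvesD(2)[OF \<sigma> t] g(1,2) cf g(3)] by linarith
        then show "mdist euclidean_metric ((\<lambda>t\<in>{0..T}. \<integral>x. f x \<partial>\<rho> t) t) ((\<lambda>t\<in>{0..T}. \<integral>x. f x \<partial>\<sigma> t) t) \<le> e / 2"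
          using t by (simp add: dist_real_def)
      qed (use e in simp)
      then show "mdist (real_curves T) (\<lambda>t\<in>{0..T}. \<integral>x. f x \<partial>\<rho> t) (\<lambda>t\<in>{0..T}. \<integral>x. f x \<partial>\<sigma> t) < e"
        using e by linarith
    qed
  qed
  then show "continuous_map L.mtopology (product_topology (\<lambda>_. mtopology_of (real_curves T)) C0_functions)
      ((\<lambda>\<rho>. \<lambda>f\<in>C0_functions. \<lambda>t\<in>{0..T}. \<integral>x. f x \<partial>\<rho> t) \<circ> (\<lambda>\<rho>. \<rho>))"
    by (auto simp: continuous_map_componentwise)
qed

lemma curve_topology_compactin:
  assumes "C \<ge> 0" shows "compactin (curve_topology T) (lip_curves M C T)"
  using image_compactin[OF lip_curves_compact[OF assms] lip_curves_continuous] by simp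

end

section \<open>Separation and limits in the curve topology\<close>

lemma curve_topology_map_continuous:
  "continuous_map (curve_topology T) (product_topology (\<lambda>_. mtopology_of (real_curves T)) C0_functions)
    (\<lambda>\<rho>. \<lambda>f\<in>C0_functions. \<lambda>t\<in>{0..T}. \<integral>x. f x \<partial>\<rho> t)"
proof -
  have "continuous_map (curve_topology T) (product_topology (\<lambda>_. mtopology_of (real_curves T)) C0_functions)
    (id \<circ> (\<lambda>\<rho>. \<lambda>f\<in>C0_functions. \<lambda>t\<in>{0..T}. \<integral>x. f x \<partial>\<rho> t))"
    unfolding curve_topology_def by (rule continuous_map_pullback) auto
  then show ?thesis by simp
qed

text \<open>Integrals of \<open>C0_functions\<close> separate probability measures, so the defining
  map is injective into a Hausdorff product. Compact sets are therefore closed and contain the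
  limits of their sequences.\<close>

lemma curve_topology_Hausdorff: "Hausdorff_space (curve_topology T)"
proof (rule Hausdorff_space_injective_preimage[OF _ curve_topology_map_continuous])
  show "Hausdorff_space (product_topology (\<lambda>_. mtopology_of (real_curves T)) C0_functions)"
    unfolding Hausdorff_space_product_topology mtopology_of_def
    by (intro disjI2 ballI Metric_space.Hausdorff_space_mtopology Metric_space_mspace_mdist)
  show "inj_on (\<lambda>\<rho>. \<lambda>f\<in>C0_functions. \<lambda>t\<in>{0..T}. \<integral>x. f x \<partial>\<rho> t) (topspace (curve_topology T))"
  proof (rule inj_onI)
    fix \<rho> \<sigma> assume "\<rho> \<in> topspace (curve_topology T)" "\<sigma> \<in> topspace (curve_topology T)"
      and eq: "(\<lambda>f\<in>C0_functions. \<lambda>t\<in>{0..T}. \<integral>x. f x \<partial>\<rho> t) = (\<lambda>f\<in>C0_functions. \<lambda>t\<in>{0..T}. \<integral>x. f x \<partial>\<sigma> t)"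
    then have m: "\<rho> \<in> measure_curves T" "\<sigma> \<in> measure_curves T" by (simp_all add: topspace_curve_topology)
    show "\<rho> = \<sigma>"
    proof (rule extensionalityI[of _ "{0..T}"])
      show "\<rho> \<in> extensional {0..T}" "\<sigma> \<in> extensional {0..T}" using m by (auto simp: measure_curves_def)
      fix t assume t: "t \<in> {0..T}"
      have p: "\<rho> t \<in> prob_measures" "\<sigma> t \<in> prob_measures"
        using m weak_star_curve_prob[OF _ t] by (auto simp: measure_curves_def)
      show "\<rho> t = \<sigma> t"
      proof (rule prob_measures_eqI[OF p])
        fix f assume "f \<in> C0_functions"
        then have "(\<lambda>t\<in>{0..T}. \<integral>x. f x \<partial>\<rho> t) = (\<lambda>t\<in>{0..T}. \<integral>x. f x \<partial>\<sigma> t)" using fun_cong[OF eq, of f] by simp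
        from fun_cong[OF this, of t] show "(\<integral>x. f x \<partial>\<rho> t) = (\<integral>x. f x \<partial>\<sigma> t)" using t by simp
      qed
    qed
  qed
qed

lemma limitin_curve_topology_imp_pointwise:
  assumes lim: "limitin (curve_topology T) \<rho> \<sigma> sequentially" and f: "f \<in> C0_functions" and t: "t \<in> {0..T}"
  shows "(\<lambda>n. \<integral>x. f x \<partial>\<rho> n t) \<longlonglongrightarrow> (\<integral>x. f x \<partial>\<sigma> t)"
proof -
  interpret F: Metric_space "mspace (real_curves T)" "mdist (real_curves T)"
    by (rule Metric_space_mspace_mdist)
  have c: "continuous_map (curve_topology T) F.mtopology (\<lambda>\<rho>. \<lambda>t\<in>{0..T}. \<integral>x. f x \<partial>\<rho> t)"
    using curve_topology_map_continuous[of T] f by (auto simp: continuous_map_componentwise mtopology_of_def)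
  have "limitin F.mtopology ((\<lambda>\<rho>. \<lambda>t\<in>{0..T}. \<integral>x. f x \<partial>\<rho> t) \<circ> \<rho>) (\<lambda>t\<in>{0..T}. \<integral>x. f x \<partial>\<sigma> t) sequentially"
    by (rule continuous_map_limit[OF c lim])
  then have l: "(\<lambda>t\<in>{0..T}. \<integral>x. f x \<partial>\<sigma> t) \<in> mspace (real_curves T)"
    and near: "\<And>e. e > 0 \<Longrightarrow> \<exists>N. \<forall>n\<ge>N. (\<lambda>t\<in>{0..T}. \<integral>x. f x \<partial>\<rho> n t) \<in> mspace (real_curves T) \<and>
      mdist (real_curves T) (\<lambda>t\<in>{0..T}. \<integral>x. f x \<partial>\<rho> n t) (\<lambda>t\<in>{0..T}. \<integral>x. f x \<partial>\<sigma> t) < e"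
    unfolding F.limit_metric_sequentially by auto
  show ?thesis
  proof (rule metric_LIMSEQ_I)
    fix e :: real assume e: "0 < e"
    obtain N where N: "\<forall>n\<ge>N. (\<lambda>t\<in>{0..T}. \<integral>x. f x \<partial>\<rho> n t) \<in> mspace (real_curves T) \<and>
      mdist (real_curves T) (\<lambda>t\<in>{0..T}. \<integral>x. f x \<partial>\<rho> n t) (\<lambda>t\<in>{0..T}. \<integral>x. f x \<partial>\<sigma> t) < e"
      using near[OF e] by (elim exE)
    have "dist (\<integral>x. f x \<partial>\<rho> n t) (\<integral>x. f x \<partial>\<sigma> t) < e" if n: "n \<ge> N" for n
    proof -
      have A: "(\<lambda>t\<in>{0..T}. \<integral>x. f x \<partial>\<rho> n t) \<in> mspace (real_curves T)"
        using N n by blast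
      have "mdist euclidean_metric ((\<lambda>t\<in>{0..T}. \<integral>x. f x \<partial>\<rho> n t) t) ((\<lambda>t\<in>{0..T}. \<integral>x. f x \<partial>\<sigma> t) t)
          \<le> mdist (real_curves T) (\<lambda>t\<in>{0..T}. \<integral>x. f x \<partial>\<rho> n t) (\<lambda>t\<in>{0..T}. \<integral>x. f x \<partial>\<sigma> t)"
        by (rule mdist_cfunspace_imp_mdist_le[OF A l order_refl]) (use t in simp)
      also have "\<dots> < e" using N n by blast
      finally show ?thesis using t by simp
    qed
    then show "\<exists>N. \<forall>n\<ge>N. dist (\<integral>x. f x \<partial>\<rho> n t) (\<integral>x. f x \<partial>\<sigma> t) < e" by blast
  qed
qed

section \<open>Solutions and their limits\<close>

text \<open>The radius \<open>Q T\<close> from the definition may differ from one solution to the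
  next. It serves only to place the curve on some ball, after which the a priori estimates replace
  it by constants in \<open>R\<close>, \<open>T\<close> and \<open>r\<close>.\<close>

lemma weak_measure_solutionD:
  assumes s: "weak_measure_solution \<Omega> T \<rho>0 \<rho>" and T: "T > 0" and \<rho>0: "msupport \<rho>0 \<subseteq> ball 0 R"
  shows "\<rho>0 \<in> ball_measures R" "restrict \<rho> {0..T} \<in> lip_curves (support_bound R T) (max (support_bound R T) R + r) T"
    "weak_form T \<rho>0 \<rho>"
proof -
  have p: "\<rho>0 \<in> prob_measures" and c: "continuous_map (top_of_set {0..T}) weak_star \<rho>"
    using s by (auto simp: weak_measure_solution_def)
  obtain Q where Q: "mono_on {0..T} Q" "\<And>t. t \<in> {0..T} \<Longrightarrow> msupport (\<rho> t) \<subseteq> ball 0 (Q t)"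
    using s by (auto simp: weak_measure_solution_def)
  have b: "\<rho> t \<in> ball_measures (Q T)" if t: "t \<in> {0..T}" for t
  proof (rule msupport_imp_ball_measures)
    show "\<rho> t \<in> prob_measures" by (rule weak_star_curve_prob[OF c t])
    have "Q t \<le> Q T" using Q(1) t T by (auto simp: mono_on_def)
    then show "msupport (\<rho> t) \<subseteq> cball 0 (Q T)" using Q(2)[OF t] by (auto simp: subset_iff)
  qed
  have w: "wcurve (Q T) T \<rho>" by (rule weak_star_imp_wcurve[OF c b])
  show wf: "weak_form T \<rho>0 \<rho>"
    unfolding weak_form_def using s weak_form_iff[OF w] by (simp add: weak_measure_solution_def)
  show \<rho>0R: "\<rho>0 \<in> ball_measures R" using \<rho>0 by (intro msupport_imp_ball_measures[OF p]) auto
  \<comment> \<open>The speed estimate wants the initial datum and the curve in one ball.\<close>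
  define N where "N = max (support_bound R T) R"
  have b': "\<rho> t \<in> ball_measures (support_bound R T)" if "t \<in> {0..T}" for t
    by (rule weak_form_support[OF w T wf \<rho>0R that])
  have w': "wcurve N T \<rho>"
    using b' ball_measures_mono[of "support_bound R T" N] by (intro weak_star_imp_wcurve[OF c]) (auto simp: N_def)
  have \<rho>0N: "\<rho>0 \<in> ball_measures N" using \<rho>0R ball_measures_mono[of R N] by (auto simp: N_def)
  have "wdist (\<rho> s) (\<rho> t) \<le> (N + r) * \<bar>s - t\<bar>" if "s \<in> {0..T}" "t \<in> {0..T}" for s t
    by (rule weak_form_lipschitz[OF w' T wf \<rho>0N that])
  then show "restrict \<rho> {0..T} \<in> lip_curves (support_bound R T) (max (support_bound R T) R + r) T"
    using b' by (auto simp: lip_curves_def N_def)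
qed

text \<open>At each time the flux integrals converge by \<open>plan_integral_tendsto\<close>, and
  the common ball dominates them in time.\<close>

lemma weak_form_limit:
  assumes \<rho>: "\<And>n. wcurve M T (\<rho> n)" and \<sigma>: "wcurve M T \<sigma>" and \<rho>0: "\<And>n. \<rho>0 n \<in> ball_measures M" and \<sigma>0: "\<sigma>0 \<in> ball_measures M"
    and T: "T > 0" and w: "\<And>n. weak_form T (\<rho>0 n) (\<rho> n)"
    and lim0: "(\<lambda>n. wdist (\<rho>0 n) \<sigma>0) \<longlonglongrightarrow> 0" and lim: "\<And>t. t \<in> {0..T} \<Longrightarrow> (\<lambda>n. wdist (\<rho> n t) (\<sigma> t)) \<longlonglongrightarrow> 0"
  shows "weak_form T \<sigma>0 \<sigma>"
  unfolding weak_form_def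
proof
  fix \<phi> assume \<phi>: "\<phi> \<in> test_functions"
  note c = test_functions_C1[OF \<phi>]
  note G = flux_parts_continuous(4)[OF c]
  have TT: "T \<in> {0..T}" using T by simp
  obtain B where B: "\<forall>t. \<forall>\<mu>\<in>ball_measures M. \<bar>t\<bar> \<le> T \<longrightarrow> \<bar>plan_integral (flux \<phi>) t \<mu>\<bar> \<le> B"
    using plan_integral_bound[OF G, of M T] by blast
  have "(\<lambda>n. \<integral>t. plan_integral (flux \<phi>) t (\<rho> n t) \<partial>lebesgue_on {0..T}) \<longlonglongrightarrow> (\<integral>t. plan_integral (flux \<phi>) t (\<sigma> t) \<partial>lebesgue_on {0..T})"
  proof (rule integral_dominated_convergence[where w = "\<lambda>_. B"])
    show "AE t in lebesgue_on {0..T}. (\<lambda>n. plan_integral (flux \<phi>) t (\<rho> n t)) \<longlonglongrightarrow> plan_integral (flux \<phi>) t (\<sigma> t)"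
      using AE_space
    proof eventually_elim
      fix t assume "t \<in> space (lebesgue_on {0..T})"
      then have t: "t \<in> {0..T}" by simp
      show "(\<lambda>n. plan_integral (flux \<phi>) t (\<rho> n t)) \<longlonglongrightarrow> plan_integral (flux \<phi>) t (\<sigma> t)"
        by (rule plan_integral_tendsto[OF G tendsto_const wcurveD[OF \<rho> t] wcurveD[OF \<sigma> t] lim[OF t]])
    qed
    show "AE t in lebesgue_on {0..T}. norm (plan_integral (flux \<phi>) t (\<rho> n t)) \<le> B" for n
      using AE_space by eventually_elim (use B wcurveD[OF \<rho>] in auto)
    show "(\<lambda>t. plan_integral (flux \<phi>) t (\<rho> n t)) \<in> borel_measurable (lebesgue_on {0..T})" for n
      using continuous_imp_integrable_real[OF wcurve_plan_continuous[OF \<rho> G]] by (rule borel_measurable_integrable)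
    show "(\<lambda>t. plan_integral (flux \<phi>) t (\<sigma> t)) \<in> borel_measurable (lebesgue_on {0..T})"
      using continuous_imp_integrable_real[OF wcurve_plan_continuous[OF \<sigma> G]] by (rule borel_measurable_integrable)
    show "integrable (lebesgue_on {0..T}) (\<lambda>_. B)"
      using continuous_imp_integrable_real[of 0 T "\<lambda>_. B"] by simp
  qed
  moreover have "(\<lambda>n. (\<integral>y. \<phi> (T, y) \<partial>\<rho> n T) - (\<integral>y. \<phi> (0, y) \<partial>\<rho>0 n)) \<longlonglongrightarrow> (\<integral>y. \<phi> (T, y) \<partial>\<sigma> T) - (\<integral>y. \<phi> (0, y) \<partial>\<sigma>0)"
  proof -
    have cy: "continuous_on UNIV (\<lambda>y. \<phi> (s, y))" for s
      by (rule continuous_on_compose2[OF C_k_continuous[OF c]]) (auto intro!: continuous_intros)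
    show ?thesis
      by (intro tendsto_diff wdist_tendsto_integral[OF wcurveD[OF \<rho> TT] wcurveD[OF \<sigma> TT] lim[OF TT] cy]
          wdist_tendsto_integral[OF \<rho>0 \<sigma>0 lim0 cy])
  qed
  moreover have "(\<integral>t. plan_integral (flux \<phi>) t (\<rho> n t) \<partial>lebesgue_on {0..T}) = (\<integral>y. \<phi> (T, y) \<partial>\<rho> n T) - (\<integral>y. \<phi> (0, y) \<partial>\<rho>0 n)" for n
    using w[of n] \<phi> by (simp add: weak_form_def)
  ultimately show "(\<integral>t. plan_integral (flux \<phi>) t (\<sigma> t) \<partial>lebesgue_on {0..T}) = (\<integral>y. \<phi> (T, y) \<partial>\<sigma> T) - (\<integral>y. \<phi> (0, y) \<partial>\<sigma>0)"
    by (simp add: LIMSEQ_unique)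
qed

lemma weak_form_restrict:
  assumes "T > 0" shows "weak_form T \<rho>0 (restrict \<rho> {0..T}) \<longleftrightarrow> weak_form T \<rho>0 \<rho>"
proof -
  have "(\<integral>t. plan_integral (flux \<phi>) t (restrict \<rho> {0..T} t) \<partial>lebesgue_on {0..T}) = (\<integral>t. plan_integral (flux \<phi>) t (\<rho> t) \<partial>lebesgue_on {0..T})" for \<phi>
    by (intro Bochner_Integration.integral_cong) auto
  then show ?thesis using assms by (simp add: weak_form_def)
qed

text \<open>A compact set in a Hausdorff space is closed, so the closure of the sequence and each
  limit stay in \<open>lip_curves\<close>, bounds included.\<close>

theorem solutions_compact:
  assumes T: "T > 0" and sol: "\<And>n. weak_measure_solution \<Omega> T (\<rho>0 n) (\<rho> n)" and supp: "\<And>n. msupport (\<rho>0 n) \<subseteq> ball 0 R"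
  shows "precompact_in (curve_topology T) (range (\<lambda>n. restrict (\<rho> n) {0..T}))"
    "strict_mono (k :: nat \<Rightarrow> nat) \<Longrightarrow> limitin (curve_topology T) (\<lambda>n. restrict (\<rho> (k n)) {0..T}) \<sigma> sequentially \<Longrightarrow>
      \<exists>\<sigma>0. weak_measure_solution \<Omega> T \<sigma>0 \<sigma>"
proof -
  note s = weak_measure_solutionD[OF sol T supp]
  define M where "M = support_bound R T"
  define C where "C = max M R + r"
  have mem: "restrict (\<rho> n) {0..T} \<in> lip_curves M C T" for n using s(2) by (simp add: M_def C_def)
  have C: "C \<ge> 0" using ball_measures_nonneg[OF s(1)] r_nonneg by (simp add: C_def)
  note cpt = curve_topology_compactin[OF T C, of M]
  have closed: "closedin (curve_topology T) (lip_curves M C T)" by (rule compactin_imp_closedin[OF curve_topology_Hausdorff cpt])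
  show "precompact_in (curve_topology T) (range (\<lambda>n. restrict (\<rho> n) {0..T}))"
    unfolding precompact_in_def
  proof
    have "range (\<lambda>n. restrict (\<rho> n) {0..T}) \<subseteq> lip_curves M C T" using mem by blast
    then show "range (\<lambda>n. restrict (\<rho> n) {0..T}) \<subseteq> topspace (curve_topology T)"
      using closedin_subset[OF closed] by blast
    have "curve_topology T closure_of range (\<lambda>n. restrict (\<rho> n) {0..T}) \<subseteq> lip_curves M C T"
      using mem by (intro closure_of_minimal closed) blast
    then show "compactin (curve_topology T) (curve_topology T closure_of range (\<lambda>n. restrict (\<rho> n) {0..T}))"
      by (rule closed_compactin[OF cpt]) simp
  qed
  assume k: "strict_mono k" and lim: "limitin (curve_topology T) (\<lambda>n. restrict (\<rho> (k n)) {0..T}) \<sigma> sequentially"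
  have \<sigma>: "\<sigma> \<in> lip_curves M C T"
    by (rule limitin_closedin[OF lim closed]) (use mem in auto)
  \<comment> \<open>Convergence of the curves does not directly address the data
    \<open>\<rho>0\<close>, so a limit datum is extracted along a further subsequence.\<close>
  obtain j \<sigma>0 where j: "strict_mono (j :: nat \<Rightarrow> nat)" "\<sigma>0 \<in> ball_measures R" "(\<lambda>n. wdist (\<rho>0 (k (j n))) \<sigma>0) \<longlonglongrightarrow> 0"
    using ball_measures_seq_compact[of "\<lambda>n. \<rho>0 (k n)" R, OF s(1)] by blast
  define N where "N = max M R"
  have up: "ball_measures M \<subseteq> ball_measures N" "ball_measures R \<subseteq> ball_measures N"
    by (auto simp: N_def intro!: ball_measures_mono)
  have wN: "wcurve N T \<tau>" if "\<tau> \<in> lip_curves M C T" for \<tau>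
    using lip_curvesD(4)[OF that] up by (auto simp: wcurve_def)
  have pl: "(\<lambda>n. wdist (restrict (\<rho> (k n)) {0..T} t) (\<sigma> t)) \<longlonglongrightarrow> 0" if t: "t \<in> {0..T}" for t
    using limitin_curve_topology_imp_pointwise[OF lim _ t] ball_measuresD(1)[OF lip_curvesD(2)[OF \<sigma> t]]
    by (intro ball_measures_C0_imp_wdist(2)[OF lip_curvesD(2)[OF mem t]])
  have "weak_form T \<sigma>0 \<sigma>"
  proof (rule weak_form_limit[OF wN[OF mem] wN[OF \<sigma>] _ _ T _ j(3)])
    show "\<rho>0 (k (j n)) \<in> ball_measures N" for n using s(1) up by blast
    show "\<sigma>0 \<in> ball_measures N" using j(2) up by blast
    show "weak_form T (\<rho>0 (k (j n))) (restrict (\<rho> (k (j n))) {0..T})" for n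
      using s(3) by (simp add: weak_form_restrict[OF T])
    show "(\<lambda>n. wdist (restrict (\<rho> (k (j n))) {0..T} t) (\<sigma> t)) \<longlonglongrightarrow> 0" if "t \<in> {0..T}" for t
      using LIMSEQ_subseq_LIMSEQ[OF pl[OF that] j(1)] by (simp add: o_def)
  qed
  moreover have "msupport (\<sigma> t) \<subseteq> ball 0 (M + 1)" if "t \<in> {0..T}" for t
    using ball_measures_msupport[OF lip_curvesD(2)[OF \<sigma> that]] by (auto simp: subset_iff)
  then have "\<exists>R. mono_on {0..T} R \<and> (\<forall>t\<in>{0..T}. msupport (\<sigma> t) \<subseteq> ball 0 (R t))"
    by (intro exI[of _ "\<lambda>_. M + 1"]) (auto simp: mono_on_def)
  ultimately show "\<exists>\<sigma>0. weak_measure_solution \<Omega> T \<sigma>0 \<sigma>"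
    unfolding weak_measure_solution_def weak_form_def
    using ball_measuresD(1)[OF j(2)] wcurve_imp_weak_star[OF wN[OF \<sigma>]] by (auto simp: weak_form_iff[OF wN[OF \<sigma>]])
qed

end

theorem theorem2p2:
  fixes \<Omega> :: "(real ^ 3) set"
  assumes "open \<Omega>" and "connected \<Omega>" and "bounded \<Omega>"
    and "emeasure lebesgue \<Omega> = 1"
    and "emeasure lebesgue (frontier \<Omega>) = 0"
  shows "(\<forall>\<rho>0\<in>prob_measures. compact (msupport \<rho>0) \<longrightarrow>
            (\<exists>\<rho>. \<forall>T>0. weak_measure_solution \<Omega> T \<rho>0 \<rho>))
       \<and> (\<forall>T>0. \<forall>R>0. \<forall>(\<rho>0 :: nat \<Rightarrow> (real ^ 3) measure) (\<rho> :: nat \<Rightarrow> real \<Rightarrow> (real ^ 3) measure).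
            (\<forall>n. weak_measure_solution \<Omega> T (\<rho>0 n) (\<rho> n)) \<longrightarrow>
            (\<forall>n. msupport (\<rho>0 n) \<subseteq> ball 0 R) \<longrightarrow>
            precompact_in (curve_topology T) (range (\<lambda>n. restrict (\<rho> n) {0..T})) \<and>
            (\<forall>r \<sigma>. strict_mono (r :: nat \<Rightarrow> nat) \<longrightarrow>
               limitin (curve_topology T) (\<lambda>k. restrict (\<rho> (r k)) {0..T}) \<sigma> sequentially \<longrightarrow>
               (\<exists>\<sigma>0. weak_measure_solution \<Omega> T \<sigma>0 \<sigma>)))"
proof -
  obtain d where d: "\<And>x. x \<in> \<Omega> \<Longrightarrow> norm x \<le> d" using assms(3) by (auto simp: bounded_iff)
  interpret source_domain \<Omega> d by standard (use assms(1,4) d in auto)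
  have "\<exists>\<rho>. \<forall>T>0. weak_measure_solution \<Omega> T \<rho>0 \<rho>" if \<rho>0: "\<rho>0 \<in> prob_measures" "compact (msupport \<rho>0)" for \<rho>0
  proof -
    obtain B where "\<And>y. y \<in> msupport \<rho>0 \<Longrightarrow> norm y \<le> B" using compact_imp_bounded[OF \<rho>0(2)] by (auto simp: bounded_iff)
    then have "\<rho>0 \<in> ball_measures B" by (intro msupport_imp_ball_measures[OF \<rho>0(1)]) auto
    then show ?thesis by (rule global_existence)
  qed
  moreover have "precompact_in (curve_topology T) (range (\<lambda>n. restrict (\<rho> n) {0..T})) \<and>
      (\<forall>r \<sigma>. strict_mono (r :: nat \<Rightarrow> nat) \<longrightarrow>
         limitin (curve_topology T) (\<lambda>k. restrict (\<rho> (r k)) {0..T}) \<sigma> sequentially \<longrightarrow>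
         (\<exists>\<sigma>0. weak_measure_solution \<Omega> T \<sigma>0 \<sigma>))"
    if "T > 0" "\<And>n. weak_measure_solution \<Omega> T (\<rho>0 n) (\<rho> n)" "\<And>n. msupport (\<rho>0 n) \<subseteq> ball 0 R"
    for T R and \<rho>0 :: "nat \<Rightarrow> (real ^ 3) measure" and \<rho> :: "nat \<Rightarrow> real \<Rightarrow> (real ^ 3) measure"
    using solutions_compact[of T \<rho>0 \<rho> R, OF that] by blast
  ultimately show ?thesis by blast
qed

end
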